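(* Let $G$ be a connected abelian Lie group and $\phi:Q\to M$ a principal $G$-bundle. Let $\mathcal{U}\subset Q\times Q$ be of $D$-type and let $\mathcal{B}_d:\mathcal{U}^{(3)}\to G$ be the discrete curvature of a discrete connection on $\phi$ with domain $\mathcal{U}$. Given a connection $1$-form $\mathcal{A}$ on $\phi$ with curvature $\mathcal{R}(\mathcal{B}_d)$, there exist an open set of $D$-type $\mathcal{U}_0\subset\mathcal{U}$ and a discrete connection form $\mathcal{A}_d$ with domain $\mathcal{U}_0$ that integrates $\mathcal{A}$ (that is, $F_C(\mathcal{A}_d)=\mathcal{A}$) and has curvature $\mathcal{B}_d$.
   Context: $G$ is written additively and has Lie algebra $\mathfrak{g}$; $\phi:Q\to M$ is a smooth principal bundle for a left action of $G$ on $Q$, with $g\in G$ acting by $l^Q_g$, and $l^{TQ}_g:=Tl^Q_g$. For $\xi\in\mathfrak{g}$, $\xi_Q(q):=\frac{d}{dt}\big|_{t=0}l^Q_{\exp(t\xi)}(q)$. A connection $1$-form (continuous connection) on $\phi$ is a smooth $\mathfrak{g}$-valued $1$-form $\mathcal{A}:TQ\to\mathfrak{g}$ with $\mathcal{A}(\xi_Q(q))=\xi$ and $\mathcal{A}(l^{TQ}_g(v))=\mathrm{Ad}_g(\mathcal{A}(v))=\mathcal{A}(v)$. Put $h(q,\delta m):=\delta q-(\mathcal{A}(\delta q))_Q(q)$ for any $\delta q\in T_qQ$ with $T_q\phi(\delta q)=\delta m$, and $s:TM\to(TQ)/G$, $s(\delta m):=[h(q,\delta m)]$. Sections of $(TQ)/G\to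 M$ are identified with $G$-invariant vector fields on $Q$. Let $\tilde{\mathfrak{g}}:=(Q\times\mathfrak{g})/G$ be the adjoint bundle and $\phi_1:\tilde{\mathfrak{g}}\to(TQ)/G$, $\phi_1([q,\xi]):=[\xi_Q(q)]$ (injective). The curvature of $\mathcal{A}$ is the vector bundle morphism $\mathcal{B}:TM\oplus TM\to\tilde{\mathfrak{g}}$ determined by $\phi_1(\mathcal{B}(X,Y))=s([X,Y])-[s(X),s(Y)]$ for vector fields $X,Y$ on $M$. An open subset $\mathcal{U}\subset Q\times Q$ is of $D$-type if it is $G\times G$-invariant and contains the diagonal $\Delta_Q$. A discrete connection (form) with domain $\mathcal{U}$ is a smooth function $\mathcal{A}_d:\mathcal{U}\to G$ with $\mathcal{A}_d(q,q)=0$ and $\mathcal{A}_d(l^Q_g(q),l^Q_{g'}(q'))=g'+\mathcal{A}_d(q,q')-g$ for all $(q,q')\in\mathcal{U}$, $g,g'\in G$. With $\mathcal{U}^{(3)}:=\{(q_0,q_1,q_2)\in Q^3:(q_i,q_j)\in\mathcal{U}\text{ for all }0\le i<j\le2\}$, its discrete curvature is $\mathcal{B}_d:\mathcal{U}^{(3)}\to G$, $\mathcal{B}_d(q_0,q_1,q_2):=\mathcal{A}_d(q_0,q_1)-\mathcal{A}_d(q_0,q_2)+\mathcal{A}_d(q_1,q_2)$. A discrete connection with domain $\mathcal{U}_0\subset\mathcal{U}$ "has curvature $\mathcal{B}_d$" if its discrete curvature equals $\mathcal{B}_d$ on $\mathcal{U}_0^{(3)}$. The derived connection is $F_C(\mathcal{A}_d)(v_q):=D_2\mathcal{A}_d(q,q)(v_q)=T_{(q,q)}\mathcal{A}_d(0,v_q)$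 for $v_q\in T_qQ$, a connection $1$-form. If $\mathcal{B}_d$ is the discrete curvature of some discrete connection $\mathcal{A}'_d$ with domain $\mathcal{U}$, then $\mathcal{R}(\mathcal{B}_d)$ denotes the curvature of $F_C(\mathcal{A}'_d)$; it does not depend on the choice of $\mathcal{A}'_d$. *)

theory Defs
  imports "HOL-Analysis.Analysis"
begin

section \<open>Model spaces and smooth maps between open subsets of them\<close>

text \<open>
  Finite-dimensional real inner product spaces: a finite set with trivial orthogonal complement
  spans. The class \<^class>\<open>euclidean_space\<close> is not used for the model spaces of manifolds
  because it excludes dimension zero (the trivial Lie group, discrete base manifolds).
\<close>

class fin_dim_inner = real_inner +
  assumes finite_total_set: "\<exists>B. finite B \<and> (\<forall>x. (\<forall>b\<in>B. inner b x = 0) \<longrightarrow> x = 0)"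

instance euclidean_space \<subseteq> fin_dim_inner
proof
  show "\<exists>B::'a set. finite B \<and> (\<forall>x. (\<forall>b\<in>B. inner b x = 0) \<longrightarrow> x = 0)"
    by (intro exI[of _ Basis]) (auto simp: euclidean_all_zero_iff inner_commute)
qed

instance prod :: (fin_dim_inner, fin_dim_inner) fin_dim_inner
proof
  obtain B :: "'a set" where B: "finite B" "\<And>x. (\<forall>b\<in>B. inner b x = 0) \<Longrightarrow> x = 0"
    using finite_total_set by blast
  obtain C :: "'b set" where C: "finite C" "\<And>x. (\<forall>b\<in>C. inner b x = 0) \<Longrightarrow> x = 0"
    using finite_total_set by blast
  let ?D = "(\<lambda>b. (b, 0::'b)) ` B \<union> (\<lambda>c. (0::'a, c)) ` C"
  have "x = 0" if "\<forall>d\<in>?D. inner d x = 0" for x :: "'a \<times> 'b"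
  proof -
    have "\<forall>b\<in>B. inner b (fst x) = 0" "\<forall>c\<in>C. inner c (snd x) = 0"
      using that by (force simp: inner_prod_def)+
    then show ?thesis using B(2) C(2) by (simp add: prod_eq_iff)
  qed
  then show "\<exists>D::('a \<times> 'b) set. finite D \<and> (\<forall>x. (\<forall>d\<in>D. inner d x = 0) \<longrightarrow> x = 0)"
    using B(1) C(1) by (intro exI[of _ ?D]) auto
qed

text \<open>\<open>Ck_on k S f\<close>: \<open>f\<close> is of class \<open>C\<^sup>k\<close> on the open subset \<open>S\<close> of a finite-dimensional space.\<close>

primrec Ck_on :: "nat \<Rightarrow> 'a::real_normed_vector set \<Rightarrow> ('a \<Rightarrow> 'b::real_normed_vector) \<Rightarrow> bool" where
  "Ck_on 0 S f \<longleftrightarrow> continuous_on S f"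
| "Ck_on (Suc k) S f \<longleftrightarrow>
     (\<forall>x\<in>S. f differentiable (at x)) \<and> (\<forall>v. Ck_on k S (\<lambda>x. frechet_derivative f (at x) v))"

definition Cinf_on :: "'a::real_normed_vector set \<Rightarrow> ('a \<Rightarrow> 'b::real_normed_vector) \<Rightarrow> bool" where
  "Cinf_on S f \<longleftrightarrow> (\<forall>k. Ck_on k S f)"

section \<open>Smooth manifolds\<close>

text \<open>
  The underlying set of a manifold is a whole type, whose topology is that of its type class; the
  smooth structure is given by an atlas, not necessarily maximal. A chart is a pair of its domain
  and its coordinate map; the values of the coordinate map off the domain are never used.
\<close>

type_synonym ('m, 'e) chart = "'m set \<times> ('m \<Rightarrow> 'e)"

abbreviation chart_dom :: "('m, 'e) chart \<Rightarrow> 'm set" where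
  "chart_dom c \<equiv> fst c"

abbreviation chart_map :: "('m, 'e) chart \<Rightarrow> 'm \<Rightarrow> 'e" where
  "chart_map c \<equiv> snd c"

abbreviation chart_img :: "('m, 'e) chart \<Rightarrow> 'e set" where
  "chart_img c \<equiv> chart_map c ` chart_dom c"

definition chart_inv :: "('m, 'e) chart \<Rightarrow> 'e \<Rightarrow> 'm" where
  "chart_inv c = inv_into (chart_dom c) (chart_map c)"

definition charts_at :: "('m, 'e) chart set \<Rightarrow> 'm \<Rightarrow> ('m, 'e) chart set" where
  "charts_at A p = {c \<in> A. p \<in> chart_dom c}"

definition smooth_manifold ::
  "('m::{t2_space,second_countable_topology}, 'e::fin_dim_inner) chart set \<Rightarrow> bool" where
  "smooth_manifold A \<longleftrightarrow>
     (\<forall>p. charts_at A p \<noteq> {}) \<and>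
     (\<forall>c\<in>A. open (chart_dom c) \<and> open (chart_img c) \<and>
        homeomorphism (chart_dom c) (chart_img c) (chart_map c) (chart_inv c)) \<and>
     (\<forall>c\<in>A. \<forall>d\<in>A. Cinf_on (chart_map c ` (chart_dom c \<inter> chart_dom d)) (chart_map d \<circ> chart_inv c))"

text \<open>Smoothness of \<open>f\<close> on an open subset \<open>S\<close>.\<close>

definition smooth_on ::
  "('m::topological_space, 'e::real_normed_vector) chart set \<Rightarrow>
   ('n::topological_space, 'f::real_normed_vector) chart set \<Rightarrow> 'm set \<Rightarrow> ('m \<Rightarrow> 'n) \<Rightarrow> bool" where
  "smooth_on A B S f \<longleftrightarrow> continuous_on S f \<and>
     (\<forall>c\<in>A. \<forall>d\<in>B. Cinf_on (chart_map c ` (S \<inter> chart_dom c \<inter> f -` chart_dom d))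
        (chart_map d \<circ> f \<circ> chart_inv c))"

definition diffeo_on ::
  "('m::topological_space, 'e::real_normed_vector) chart set \<Rightarrow>
   ('n::topological_space, 'f::real_normed_vector) chart set \<Rightarrow> 'm set \<Rightarrow> 'n set \<Rightarrow> ('m \<Rightarrow> 'n) \<Rightarrow> bool" where
  "diffeo_on A B S T f \<longleftrightarrow>
     bij_betw f S T \<and> smooth_on A B S f \<and> smooth_on B A T (inv_into S f)"

definition prod_atlas ::
  "('m, 'e) chart set \<Rightarrow> ('n, 'f) chart set \<Rightarrow> ('m \<times> 'n, 'e \<times> 'f) chart set" where
  "prod_atlas A B =
     (\<lambda>(c, d). (chart_dom c \<times> chart_dom d, map_prod (chart_map c) (chart_map d))) ` (A \<times> B)"

definition model_atlas :: "('e, 'e) chart set" where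
  "model_atlas = {(UNIV, \<lambda>x. x)}"

section \<open>Tangent vectors, tangent maps, vector fields\<close>

text \<open>
  A tangent vector at \<open>p\<close> is the family of its coordinate vectors in the charts around \<open>p\<close>, which
  are related by the derivatives of the transition maps; the family is zero at all other charts.
  Linear operations are pointwise. Elements of the tangent bundle are pairs of a base point and
  such a family.
\<close>

type_synonym ('m, 'e) tvec = "('m, 'e) chart \<Rightarrow> 'e"

definition tangent_space :: "('m, 'e::real_normed_vector) chart set \<Rightarrow> 'm \<Rightarrow> ('m, 'e) tvec set" where
  "tangent_space A p = {v.
     (\<forall>c. c \<notin> charts_at A p \<longrightarrow> v c = 0) \<and>
     (\<forall>c\<in>charts_at A p. \<forall>d\<in>charts_at A p.
        v d = frechet_derivative (chart_map d \<circ> chart_inv c) (at (chart_map c p)) (v c))}"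

definition tadd :: "('m, 'e) tvec \<Rightarrow> ('m, 'e) tvec \<Rightarrow> ('m, 'e::real_vector) tvec" where
  "tadd v w = (\<lambda>c. v c + w c)"

definition tdiff :: "('m, 'e) tvec \<Rightarrow> ('m, 'e) tvec \<Rightarrow> ('m, 'e::real_vector) tvec" where
  "tdiff v w = (\<lambda>c. v c - w c)"

definition tscale :: "real \<Rightarrow> ('m, 'e) tvec \<Rightarrow> ('m, 'e::real_vector) tvec" where
  "tscale r v = (\<lambda>c. r *\<^sub>R v c)"

text \<open>The tangent vector at \<open>p\<close> with coordinate vector \<open>x\<close> in the chart \<open>c\<close> around \<open>p\<close>.\<close>

definition tvec_of ::
  "('m, 'e::real_normed_vector) chart set \<Rightarrow> 'm \<Rightarrow> ('m, 'e) chart \<Rightarrow> 'e \<Rightarrow> ('m, 'e) tvec" where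
  "tvec_of A p c x = (\<lambda>d. if d \<in> charts_at A p
     then frechet_derivative (chart_map d \<circ> chart_inv c) (at (chart_map c p)) x else 0)"

text \<open>\<open>T\<^sub>p f\<close>, for \<open>f\<close> smooth near \<open>p\<close>; the chart \<open>c\<close> around \<open>p\<close> is immaterial.\<close>

definition tangent_map ::
  "('m, 'e::real_normed_vector) chart set \<Rightarrow> ('n, 'f::real_normed_vector) chart set \<Rightarrow>
   ('m \<Rightarrow> 'n) \<Rightarrow> 'm \<Rightarrow> ('m, 'e) tvec \<Rightarrow> ('n, 'f) tvec" where
  "tangent_map A B f p v =
     (let c = (SOME c. c \<in> charts_at A p) in
      (\<lambda>d. if d \<in> charts_at B (f p)
           then frechet_derivative (chart_map d \<circ> f \<circ> chart_inv c) (at (chart_map c p)) (v c)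
           else 0))"

definition velocity ::
  "('m, 'e::real_normed_vector) chart set \<Rightarrow> (real \<Rightarrow> 'm) \<Rightarrow> real \<Rightarrow> ('m, 'e) tvec" where
  "velocity A \<gamma> t =
     (\<lambda>d. if d \<in> charts_at A (\<gamma> t) then vector_derivative (chart_map d \<circ> \<gamma>) (at t) else 0)"

definition smooth_vector_field ::
  "('m, 'e::real_normed_vector) chart set \<Rightarrow> ('m \<Rightarrow> ('m, 'e) tvec) \<Rightarrow> bool" where
  "smooth_vector_field A X \<longleftrightarrow>
     (\<forall>p. X p \<in> tangent_space A p) \<and>
     (\<forall>c\<in>A. Cinf_on (chart_img c) (\<lambda>x. X (chart_inv c x) c))"

text \<open>
  In a chart, \<open>[X, Y] = DY(X) - DX(Y)\<close>, i.e. \<open>[X, Y] f = X (Y f) - Y (X f)\<close>.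
\<close>

definition lie_bracket ::
  "('m, 'e::real_normed_vector) chart set \<Rightarrow> ('m \<Rightarrow> ('m, 'e) tvec) \<Rightarrow> ('m \<Rightarrow> ('m, 'e) tvec) \<Rightarrow>
   'm \<Rightarrow> ('m, 'e) tvec" where
  "lie_bracket A X Y p = (\<lambda>c. if c \<in> charts_at A p
     then frechet_derivative (\<lambda>x. Y (chart_inv c x) c) (at (chart_map c p)) (X p c)
        - frechet_derivative (\<lambda>x. X (chart_inv c x) c) (at (chart_map c p)) (Y p c)
     else 0)"

section \<open>Abelian Lie groups, smooth actions and principal bundles\<close>

definition abelian_lie_group ::
  "('g::{t2_space,second_countable_topology,ab_group_add}, 'k::fin_dim_inner) chart set \<Rightarrow> bool" where
  "abelian_lie_group AG \<longleftrightarrow> smooth_manifold AG \<and>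
     smooth_on (prod_atlas AG AG) AG UNIV (\<lambda>(g, h). g + h) \<and>
     smooth_on AG AG UNIV uminus"

abbreviation lie_algebra ::
  "('g::ab_group_add, 'k::real_normed_vector) chart set \<Rightarrow> ('g, 'k) tvec set" where
  "lie_algebra AG \<equiv> tangent_space AG 0"

definition one_parameter_subgroup ::
  "('g::{topological_space,ab_group_add}, 'k::real_normed_vector) chart set \<Rightarrow>
   ('g, 'k) tvec \<Rightarrow> (real \<Rightarrow> 'g) \<Rightarrow> bool" where
  "one_parameter_subgroup AG \<xi> \<gamma> \<longleftrightarrow>
     smooth_on model_atlas AG UNIV \<gamma> \<and> (\<forall>s t. \<gamma> (s + t) = \<gamma> s + \<gamma> t) \<and> velocity AG \<gamma> 0 = \<xi>"

definition lie_exp ::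
  "('g::{topological_space,ab_group_add}, 'k::real_normed_vector) chart set \<Rightarrow> ('g, 'k) tvec \<Rightarrow> 'g" where
  "lie_exp AG \<xi> = (THE \<gamma>. one_parameter_subgroup AG \<xi> \<gamma>) 1"

text \<open>The fundamental vector field \<open>\<xi>\<^sub>Q\<close> of a left action \<open>l\<close>.\<close>

definition fund_field ::
  "('g::{topological_space,ab_group_add}, 'k::real_normed_vector) chart set \<Rightarrow>
   ('q, 'e::real_normed_vector) chart set \<Rightarrow> ('g \<Rightarrow> 'q \<Rightarrow> 'q) \<Rightarrow>
   ('g, 'k) tvec \<Rightarrow> 'q \<Rightarrow> ('q, 'e) tvec" where
  "fund_field AG AQ l \<xi> q = velocity AQ (\<lambda>t. l (lie_exp AG (tscale t \<xi>)) q) 0"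

definition smooth_action ::
  "('g::{topological_space,ab_group_add}, 'k::real_normed_vector) chart set \<Rightarrow>
   ('q::topological_space, 'e::real_normed_vector) chart set \<Rightarrow> ('g \<Rightarrow> 'q \<Rightarrow> 'q) \<Rightarrow> bool" where
  "smooth_action AG AQ l \<longleftrightarrow>
     (\<forall>q. l 0 q = q) \<and> (\<forall>g h q. l (g + h) q = l g (l h q)) \<and>
     smooth_on (prod_atlas AG AQ) AQ UNIV (\<lambda>(g, q). l g q)"

text \<open>
  Local triviality: around each point of \<open>M\<close> there is an equivariant diffeomorphism
  \<open>\<phi>\<^sup>-\<^sup>1(V) \<rightarrow> V \<times> G\<close> over \<open>V\<close>. It entails that \<open>\<phi>\<close> is a surjective submersion, that the action
  is free and that the fibres of \<open>\<phi>\<close> are the orbits.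
\<close>

definition principal_bundle ::
  "('g::{t2_space,second_countable_topology,ab_group_add}, 'k::fin_dim_inner) chart set \<Rightarrow>
   ('q::{t2_space,second_countable_topology}, 'e::fin_dim_inner) chart set \<Rightarrow>
   ('m::{t2_space,second_countable_topology}, 'b::fin_dim_inner) chart set \<Rightarrow>
   ('g \<Rightarrow> 'q \<Rightarrow> 'q) \<Rightarrow> ('q \<Rightarrow> 'm) \<Rightarrow> bool" where
  "principal_bundle AG AQ AM l \<phi> \<longleftrightarrow>
     abelian_lie_group AG \<and> smooth_manifold AQ \<and> smooth_manifold AM \<and>
     smooth_action AG AQ l \<and> smooth_on AQ AM UNIV \<phi> \<and> (\<forall>g q. \<phi> (l g q) = \<phi> q) \<and>
     (\<forall>m. \<exists>V \<psi>. open V \<and> m \<in> V \<and>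
        diffeo_on AQ (prod_atlas AM AG) (\<phi> -` V) (V \<times> UNIV) (\<lambda>q. (\<phi> q, \<psi> q)) \<and>
        (\<forall>q\<in>\<phi> -` V. \<forall>g. \<psi> (l g q) = g + \<psi> q))"

section \<open>Continuous connections and their curvature\<close>

text \<open>
  A connection form is given by its restrictions \<open>\<A> q\<close> to the tangent spaces. Smoothness of
  \<open>\<A> : TQ \<rightarrow> \<gg>\<close> is expressed in the charts of \<open>TQ\<close> induced by those of \<open>Q\<close> and in the linear
  coordinates of \<open>\<gg>\<close> given by charts at 0. As \<open>G\<close> is abelian, \<open>Ad\<^sub>g\<close> is the identity.
\<close>

definition connection_form ::
  "('g::{topological_space,ab_group_add}, 'k::real_normed_vector) chart set \<Rightarrow>
   ('q, 'e::real_normed_vector) chart set \<Rightarrow> ('g \<Rightarrow> 'q \<Rightarrow> 'q) \<Rightarrow>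
   ('q \<Rightarrow> ('q, 'e) tvec \<Rightarrow> ('g, 'k) tvec) \<Rightarrow> bool" where
  "connection_form AG AQ l \<A> \<longleftrightarrow>
     (\<forall>q. \<forall>v\<in>tangent_space AQ q. \<A> q v \<in> lie_algebra AG) \<and>
     (\<forall>q. \<forall>v\<in>tangent_space AQ q. \<forall>w\<in>tangent_space AQ q. \<A> q (tadd v w) = tadd (\<A> q v) (\<A> q w)) \<and>
     (\<forall>q. \<forall>v\<in>tangent_space AQ q. \<forall>r. \<A> q (tscale r v) = tscale r (\<A> q v)) \<and>
     (\<forall>c\<in>AQ. \<forall>d\<in>charts_at AG 0. Cinf_on (chart_img c \<times> UNIV)
        (\<lambda>(x, v). \<A> (chart_inv c x) (tvec_of AQ (chart_inv c x) c v) d)) \<and>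
     (\<forall>q. \<forall>\<xi>\<in>lie_algebra AG. \<A> q (fund_field AG AQ l \<xi> q) = \<xi>) \<and>
     (\<forall>g q. \<forall>v\<in>tangent_space AQ q. \<A> (l g q) (tangent_map AQ AQ (l g) q v) = \<A> q v)"

definition horizontal_lift ::
  "('g::{topological_space,ab_group_add}, 'k::real_normed_vector) chart set \<Rightarrow>
   ('q, 'e::real_normed_vector) chart set \<Rightarrow> ('m, 'b::real_normed_vector) chart set \<Rightarrow>
   ('g \<Rightarrow> 'q \<Rightarrow> 'q) \<Rightarrow> ('q \<Rightarrow> 'm) \<Rightarrow> ('q \<Rightarrow> ('q, 'e) tvec \<Rightarrow> ('g, 'k) tvec) \<Rightarrow>
   'q \<Rightarrow> ('m, 'b) tvec \<Rightarrow> ('q, 'e) tvec" where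
  "horizontal_lift AG AQ AM l \<phi> \<A> q u =
     (let v = (SOME v. v \<in> tangent_space AQ q \<and> tangent_map AQ AM \<phi> q v = u)
      in tdiff v (fund_field AG AQ l (\<A> q v) q))"

text \<open>
  Elements of \<open>(TQ)/G\<close> are the \<open>G\<close>-orbits in the tangent bundle. The action on \<open>Q \<times> \<gg>\<close> defining
  the adjoint bundle moves only the first component, again because \<open>Ad\<^sub>g\<close> is the identity.
\<close>

definition TQ_orbit ::
  "('q, 'e::real_normed_vector) chart set \<Rightarrow> ('g \<Rightarrow> 'q \<Rightarrow> 'q) \<Rightarrow>
   'q \<Rightarrow> ('q, 'e) tvec \<Rightarrow> ('q \<times> ('q, 'e) tvec) set" where
  "TQ_orbit AQ l q v = range (\<lambda>g. (l g q, tangent_map AQ AQ (l g) q v))"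

text \<open>Subtraction in a fibre of \<open>(TQ)/G\<close>.\<close>

definition TQ_orbit_diff ::
  "('q \<times> ('q, 'e::real_vector) tvec) set \<Rightarrow> ('q \<times> ('q, 'e) tvec) set \<Rightarrow>
   ('q \<times> ('q, 'e) tvec) set" where
  "TQ_orbit_diff a b = {(q, tdiff v w) | q v w. (q, v) \<in> a \<and> (q, w) \<in> b}"

definition adjoint_fibre ::
  "('g::ab_group_add, 'k::real_normed_vector) chart set \<Rightarrow> ('g \<Rightarrow> 'q \<Rightarrow> 'q) \<Rightarrow> ('q \<Rightarrow> 'm) \<Rightarrow>
   'm \<Rightarrow> ('q \<times> ('g, 'k) tvec) set set" where
  "adjoint_fibre AG l \<phi> m = {range (\<lambda>g. (l g q, \<xi>)) | q \<xi>. \<phi> q = m \<and> \<xi> \<in> lie_algebra AG}"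

text \<open>\<open>\<phi>\<^sub>1 [q, \<xi>] = [\<xi>\<^sub>Q(q)]\<close>, as the direct image of an orbit under the equivariant map
  \<open>(q, \<xi>) \<mapsto> \<xi>\<^sub>Q(q)\<close>.\<close>

definition phi1 ::
  "('g::{topological_space,ab_group_add}, 'k::real_normed_vector) chart set \<Rightarrow>
   ('q, 'e::real_normed_vector) chart set \<Rightarrow> ('g \<Rightarrow> 'q \<Rightarrow> 'q) \<Rightarrow>
   ('q \<times> ('g, 'k) tvec) set \<Rightarrow> ('q \<times> ('q, 'e) tvec) set" where
  "phi1 AG AQ l a = (\<lambda>(q, \<xi>). (q, fund_field AG AQ l \<xi> q)) ` a"

text \<open>The section \<open>s : TM \<rightarrow> (TQ)/G\<close> on the tangent vector \<open>u\<close> at \<open>m\<close>.\<close>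

definition splitting ::
  "('g::{topological_space,ab_group_add}, 'k::real_normed_vector) chart set \<Rightarrow>
   ('q, 'e::real_normed_vector) chart set \<Rightarrow> ('m, 'b::real_normed_vector) chart set \<Rightarrow>
   ('g \<Rightarrow> 'q \<Rightarrow> 'q) \<Rightarrow> ('q \<Rightarrow> 'm) \<Rightarrow> ('q \<Rightarrow> ('q, 'e) tvec \<Rightarrow> ('g, 'k) tvec) \<Rightarrow>
   'm \<Rightarrow> ('m, 'b) tvec \<Rightarrow> ('q \<times> ('q, 'e) tvec) set" where
  "splitting AG AQ AM l \<phi> \<A> m u =
     (let q = (SOME q. \<phi> q = m) in TQ_orbit AQ l q (horizontal_lift AG AQ AM l \<phi> \<A> q u))"

text \<open>
  The identification of sections of \<open>(TQ)/G \<rightarrow> M\<close> with \<open>G\<close>-invariant vector fields on \<open>Q\<close>, in both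
  directions, and the bracket of sections that it induces.
\<close>

definition field_of_section ::
  "('q \<Rightarrow> 'm) \<Rightarrow> ('m \<Rightarrow> ('q \<times> ('q, 'e) tvec) set) \<Rightarrow> 'q \<Rightarrow> ('q, 'e) tvec" where
  "field_of_section \<phi> \<sigma> q = (THE v. (q, v) \<in> \<sigma> (\<phi> q))"

definition section_of_field ::
  "('q \<Rightarrow> 'm) \<Rightarrow> ('q \<Rightarrow> ('q, 'e) tvec) \<Rightarrow> 'm \<Rightarrow> ('q \<times> ('q, 'e) tvec) set" where
  "section_of_field \<phi> Z m = {(q, Z q) | q. \<phi> q = m}"

definition section_bracket ::
  "('q, 'e::real_normed_vector) chart set \<Rightarrow> ('q \<Rightarrow> 'm) \<Rightarrow>
   ('m \<Rightarrow> ('q \<times> ('q, 'e) tvec) set) \<Rightarrow> ('m \<Rightarrow> ('q \<times> ('q, 'e) tvec) set) \<Rightarrow>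
   'm \<Rightarrow> ('q \<times> ('q, 'e) tvec) set" where
  "section_bracket AQ \<phi> \<sigma> \<tau> =
     section_of_field \<phi> (lie_bracket AQ (field_of_section \<phi> \<sigma>) (field_of_section \<phi> \<tau>))"

text \<open>
  The curvature \<open>\<B> : TM \<oplus> TM \<rightarrow> (Q \<times> \<gg>)/G\<close>, determined by
  \<open>\<phi>\<^sub>1 (\<B>(X, Y)) = s([X, Y]) - [s(X), s(Y)]\<close> for all vector fields on \<open>M\<close>. The value at
  \<open>u, v \<in> T\<^sub>mM\<close> is the element of the fibre over \<open>m\<close> that this prescribes for any global
  fields extending \<open>u\<close> and \<open>v\<close>.
\<close>

definition curvature ::
  "('g::{topological_space,ab_group_add}, 'k::real_normed_vector) chart set \<Rightarrow>
   ('q, 'e::real_normed_vector) chart set \<Rightarrow> ('m, 'b::real_normed_vector) chart set \<Rightarrow>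
   ('g \<Rightarrow> 'q \<Rightarrow> 'q) \<Rightarrow> ('q \<Rightarrow> 'm) \<Rightarrow> ('q \<Rightarrow> ('q, 'e) tvec \<Rightarrow> ('g, 'k) tvec) \<Rightarrow>
   'm \<Rightarrow> ('m, 'b) tvec \<Rightarrow> ('m, 'b) tvec \<Rightarrow> ('q \<times> ('g, 'k) tvec) set" where
  "curvature AG AQ AM l \<phi> \<A> m u v =
     (let s = splitting AG AQ AM l \<phi> \<A> in
      THE b. b \<in> adjoint_fibre AG l \<phi> m \<and>
        (\<forall>X Y. smooth_vector_field AM X \<and> smooth_vector_field AM Y \<and> X m = u \<and> Y m = v \<longrightarrow>
           phi1 AG AQ l b =
             TQ_orbit_diff (s m (lie_bracket AM X Y m))
               (section_bracket AQ \<phi> (\<lambda>x. s x (X x)) (\<lambda>x. s x (Y x)) m)))"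

section \<open>Discrete connections and their curvature\<close>

definition D_type :: "('g \<Rightarrow> 'q \<Rightarrow> 'q) \<Rightarrow> ('q::topological_space \<times> 'q) set \<Rightarrow> bool" where
  "D_type l U \<longleftrightarrow> open U \<and> (\<forall>q q' g g'. (q, q') \<in> U \<longrightarrow> (l g q, l g' q') \<in> U) \<and> (\<forall>q. (q, q) \<in> U)"

definition discrete_connection ::
  "('g::{topological_space,ab_group_add}, 'k::real_normed_vector) chart set \<Rightarrow>
   ('q::topological_space, 'e::real_normed_vector) chart set \<Rightarrow> ('g \<Rightarrow> 'q \<Rightarrow> 'q) \<Rightarrow>
   ('q \<times> 'q) set \<Rightarrow> ('q \<times> 'q \<Rightarrow> 'g) \<Rightarrow> bool" where
  "discrete_connection AG AQ l U Ad \<longleftrightarrow>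
     D_type l U \<and> smooth_on (prod_atlas AQ AQ) AG U Ad \<and> (\<forall>q. Ad (q, q) = 0) \<and>
     (\<forall>q q' g g'. (q, q') \<in> U \<longrightarrow> Ad (l g q, l g' q') = g' + Ad (q, q') - g)"

definition triples :: "('q \<times> 'q) set \<Rightarrow> ('q \<times> 'q \<times> 'q) set" where
  "triples U = {(q0, q1, q2). (q0, q1) \<in> U \<and> (q0, q2) \<in> U \<and> (q1, q2) \<in> U}"

definition discrete_curvature :: "('q \<times> 'q \<Rightarrow> 'g::ab_group_add) \<Rightarrow> 'q \<times> 'q \<times> 'q \<Rightarrow> 'g" where
  "discrete_curvature Ad = (\<lambda>(q0, q1, q2). Ad (q0, q1) - Ad (q0, q2) + Ad (q1, q2))"

definition has_discrete_curvature ::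
  "('q \<times> 'q) set \<Rightarrow> ('q \<times> 'q \<Rightarrow> 'g::ab_group_add) \<Rightarrow> ('q \<times> 'q \<times> 'q \<Rightarrow> 'g) \<Rightarrow> bool" where
  "has_discrete_curvature U Ad Bd \<longleftrightarrow> (\<forall>t\<in>triples U. discrete_curvature Ad t = Bd t)"

text \<open>\<open>F\<^sub>C(\<A>\<^sub>d)(v\<^sub>q) = D\<^sub>2\<A>\<^sub>d(q, q)(v\<^sub>q)\<close>, with values in \<open>T\<^sub>0G = \<gg>\<close> as \<open>\<A>\<^sub>d(q, q) = 0\<close>.\<close>

definition derived_connection ::
  "('g, 'k::real_normed_vector) chart set \<Rightarrow> ('q, 'e::real_normed_vector) chart set \<Rightarrow>
   ('q \<times> 'q \<Rightarrow> 'g) \<Rightarrow> 'q \<Rightarrow> ('q, 'e) tvec \<Rightarrow> ('g, 'k) tvec" where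
  "derived_connection AG AQ Ad q v = tangent_map AQ AG (\<lambda>q'. Ad (q, q')) q v"

text \<open>\<open>\<R>(\<B>\<^sub>d)\<close>: meaningful if \<open>Bd\<close> is the curvature of some discrete connection with domain \<open>U\<close>,
  whose choice is then immaterial.\<close>

definition curvature_of_discrete ::
  "('g::{topological_space,ab_group_add}, 'k::real_normed_vector) chart set \<Rightarrow>
   ('q::topological_space, 'e::real_normed_vector) chart set \<Rightarrow>
   ('m, 'b::real_normed_vector) chart set \<Rightarrow>
   ('g \<Rightarrow> 'q \<Rightarrow> 'q) \<Rightarrow> ('q \<Rightarrow> 'm) \<Rightarrow> ('q \<times> 'q) set \<Rightarrow> ('q \<times> 'q \<times> 'q \<Rightarrow> 'g) \<Rightarrow>
   'm \<Rightarrow> ('m, 'b) tvec \<Rightarrow> ('m, 'b) tvec \<Rightarrow> ('q \<times> ('g, 'k) tvec) set" where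
  "curvature_of_discrete AG AQ AM l \<phi> U Bd =
     curvature AG AQ AM l \<phi> (derived_connection AG AQ
       (SOME Ad. discrete_connection AG AQ l U Ad \<and> has_discrete_curvature U Ad Bd))"

end

theory Submission
  imports Defs "HOL-Computational_Algebra.Polynomial"
begin

text \<open>
  Let \<open>A'\<close> be the connection derived from a discrete connection \<open>A'\<^sub>d\<close> with curvature \<open>\<B>\<^sub>d\<close>. The
  difference of \<open>\<A>\<close> and \<open>A'\<close> descends to a \<open>\<gg>\<close>-valued 1-form \<open>\<alpha>\<close> on \<open>M\<close>, and equality of the
  curvatures means \<open>d\<alpha> = 0\<close>. Local potentials \<open>h\<^sub>i\<close> of \<open>\<alpha>\<close> differ by locally constant functions, so
  the differences \<open>h\<^sub>i(y) - h\<^sub>i(x)\<close> glue to a function \<open>F\<close> on a neighbourhood of the diagonal of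
  \<open>M \<times> M\<close> that satisfies the cocycle identity, and
  \<open>A\<^sub>d(q, q') = A'\<^sub>d(q, q') + exp F(\<phi> q, \<phi> q')\<close> has the required properties.

  The exponential map of the abelian group \<open>G\<close> is the inverse of a local potential of the
  Maurer-Cartan form, which is closed and whose potential is a local homomorphism.
\<close>

section \<open>Calculus on finite-dimensional inner product spaces\<close>

text \<open>The correction depends on base points only, so that it does not disturb equivariance in
  either variable, and it is a cocycle, so that it does not disturb the discrete curvature. The
  obstacle is that a closed form has no global potential, while the cocycle identity ties together
  three points: one local potential has to serve all of them at once, and near any point only
  finitely many potentials may compete. A Lindelof cover with nested neighbourhoods achieves this.
  Connectedness of the group enters through surjectivity of the exponential map. It lets a vector
  space parametrise each fibre, with the action becoming translation. In such parameters (x, k) a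
  connection form is dk plus a form a(x), and its curvature is the exterior derivative of a; hence
  equal curvatures mean a closed difference. Since the exponential map may have a kernel, these
  parameters are local diffeomorphisms but in general no charts of the total space. Obtaining the
  exponential map from a potential replaces flows of vector fields by the Poincare lemma, which the
  main construction requires as well.\<close>

lemma fin_dim_orthonormal_expansion:
  "\<exists>B::'a::fin_dim_inner set. finite B \<and> (\<forall>x. (\<Sum>b\<in>B. inner x b *\<^sub>R b) = x)"
proof -
  obtain B :: "'a set" where B: "finite B" "\<And>x. (\<forall>b\<in>B. inner b x = 0) \<Longrightarrow> x = 0"
    using finite_total_set by blast
  obtain C where C: "finite C" "span C = span B" "pairwise orthogonal C"
    using basis_orthogonal[OF B(1)] by blast
  let ?C = "C - {0}"
  \<comment> \<open>\<open>S x\<close> is the orthogonal projection of \<open>x\<close> to the span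
    of \<open>C\<close>. The residual \<open>x - S x\<close> is orthogonal to
    \<open>span C = span B\<close>, and totality of \<open>B\<close> forces it to vanish.\<close>
  define S where "S x = (\<Sum>c\<in>?C. (inner x c / inner c c) *\<^sub>R c)" for x
  have s: "S x = x" for x
  proof -
    have o: "inner c (x - S x) = 0" if c: "c \<in> C" for c
    proof (cases "c = 0")
      case False
      have "inner c (S x) = (\<Sum>d\<in>?C. (inner x d / inner d d) * inner c d)"
        by (simp add: inner_sum_right S_def)
      also have "\<dots> = (\<Sum>d\<in>?C. if d = c then inner x c else 0)"
        using C(3) c False by (intro sum.cong) (auto simp: pairwise_def orthogonal_def)
      also have "\<dots> = inner x c" using C(1) c False by simp
      finally show ?thesis by (simp add: inner_diff_right inner_commute)
    qed simp
    have "orthogonal (x - S x) y" if "y \<in> span C" for y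
      by (rule orthogonal_to_span[OF that]) (simp add: o orthogonal_def inner_commute)
    then have "\<forall>b\<in>B. inner b (x - S x) = 0"
      by (simp add: C(2) orthogonal_def span_base inner_commute)
    then have "x - S x = 0" by (rule B(2))
    then show ?thesis by simp
  qed
  let ?n = "\<lambda>c::'a. (1 / norm c) *\<^sub>R c"
  have inj: "inj_on ?n ?C"
  proof (rule inj_onI, rule ccontr)
    fix c d assume cd: "c \<in> ?C" "d \<in> ?C" "?n c = ?n d" "c \<noteq> d"
    then have "inner c d = 0" using C(3) by (auto simp: pairwise_def orthogonal_def)
    then have "inner (?n c) (?n d) = 0" by simp
    then have "inner (?n c) (?n c) = 0" using cd(3) by simp
    then show False using cd(1) by simp
  qed
  have "(\<Sum>b\<in>?n ` ?C. inner x b *\<^sub>R b) = S x" for x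
    unfolding S_def sum.reindex[OF inj] o_def
    by (intro sum.cong) (auto simp: dot_square_norm power2_eq_square)
  with s C(1) show ?thesis by (intro exI[of _ "?n ` ?C"]) simp
qed

text \<open>Recorded through its expansion formula, which turns a linear map into a finite sum of
  its values on \<open>onb\<close> with continuous coefficients. This is how finite dimension enters
  the calculus below.\<close>

definition onb :: "'a::fin_dim_inner set" where
  "onb = (SOME B. finite B \<and> (\<forall>x. (\<Sum>b\<in>B. inner x b *\<^sub>R b) = x))"

lemma finite_onb [simp]: "finite onb"
  and onb_expand: "(\<Sum>b\<in>onb. inner x b *\<^sub>R b) = x"
  using someI_ex[OF fin_dim_orthonormal_expansion] unfolding onb_def by auto

lemma linear_onb_expand:
  fixes f :: "'a::fin_dim_inner \<Rightarrow> 'b::real_vector"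
  assumes "linear f"
  shows "f x = (\<Sum>b\<in>onb. inner x b *\<^sub>R f b)"
proof -
  have "f x = f (\<Sum>b\<in>onb. inner x b *\<^sub>R b)" by (simp add: onb_expand)
  also have "\<dots> = (\<Sum>b\<in>onb. inner x b *\<^sub>R f b)"
    using assms by (simp add: linear_sum linear_scale)
  finally show ?thesis .
qed

lemma linear_imp_bounded_linear:
  fixes f :: "'a::fin_dim_inner \<Rightarrow> 'b::real_normed_vector"
  assumes "linear f"
  shows "bounded_linear f"
proof -
  have "f = (\<lambda>x. \<Sum>b\<in>onb. inner x b *\<^sub>R f b)"
    using linear_onb_expand[OF assms] by blast
  moreover have "bounded_linear (\<lambda>x. \<Sum>b\<in>onb. inner x b *\<^sub>R f b)"
    by (intro bounded_linear_sum bounded_linear_scaleR_const bounded_linear_inner_left)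
  ultimately show ?thesis by simp
qed

text \<open>Stands in for the operator norm: finitely many values bound the map uniformly, at the
  price of a factor counting \<open>onb\<close>.\<close>

lemma norm_linear_le_onb:
  fixes f :: "'a::fin_dim_inner \<Rightarrow> 'b::real_normed_vector"
  assumes "linear f" "\<And>b. b \<in> onb \<Longrightarrow> norm b * norm (f b) \<le> c"
  shows "norm (f x) \<le> norm x * (real (card (onb :: 'a set)) * c)"
proof -
  have *: "norm (inner x b *\<^sub>R f b) \<le> norm x * c" if "b \<in> onb" for b
  proof -
    have "norm (inner x b *\<^sub>R f b) \<le> (norm x * norm b) * norm (f b)"
      using Cauchy_Schwarz_ineq2[of x b] by (simp add: mult_right_mono)
    also have "\<dots> \<le> norm x * c"
      using assms(2)[OF that] by (simp add: mult.assoc mult_left_mono)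
    finally show ?thesis .
  qed
  have "norm (f x) = norm (\<Sum>b\<in>onb. inner x b *\<^sub>R f b)"
    using linear_onb_expand[OF assms(1), of x] by simp
  also have "\<dots> \<le> (\<Sum>b\<in>(onb :: 'a set). norm x * c)" by (rule sum_norm_le) (rule *)
  finally show ?thesis by (simp add: ac_simps)
qed

instance fin_dim_inner \<subseteq> heine_borel
proof
  fix f :: "nat \<Rightarrow> 'a" assume "bounded (range f)"
  then obtain r where r: "\<And>n. norm (f n) \<le> r" by (auto simp: bounded_iff)
  \<comment> \<open>A bounded sequence stays in a sum of compact segments, one along each vector of
    \<open>onb\<close>; the induction builds this compact sum.\<close>
  have "\<exists>K. compact K \<and> (\<forall>x. norm x \<le> r \<longrightarrow> (\<Sum>b\<in>B. inner x b *\<^sub>R b) \<in> K)" if "finite B" for B :: "'a set"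
    using that
  proof induction
    case empty
    show ?case by (intro exI[of _ "{0}"]) simp
  next
    case (insert c B)
    then obtain K where K: "compact K" "\<And>x. norm x \<le> r \<Longrightarrow> (\<Sum>b\<in>B. inner x b *\<^sub>R b) \<in> K" by blast
    let ?L = "(\<lambda>t. t *\<^sub>R c) ` {- (r * norm c)..r * norm c}"
    have L: "compact ?L"
      by (intro compact_continuous_image continuous_intros) auto
    have "inner x c *\<^sub>R c \<in> ?L" if "norm x \<le> r" for x
    proof -
      have "\<bar>inner x c\<bar> \<le> r * norm c"
        using Cauchy_Schwarz_ineq2[of x c] that by (meson mult_right_mono norm_ge_zero order_trans)
      then show ?thesis by (intro imageI) (auto simp: abs_le_iff)
    qed
    then show ?case using compact_sums[OF L K(1)] K(2) insert.hyps
      by (intro exI[of _ "{x + y |x y. x \<in> ?L \<and> y \<in> K}"]) (simp, blast)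
  qed
  from this[OF finite_onb] obtain K :: "'a set" where K: "compact K" "\<And>x. norm x \<le> r \<Longrightarrow> x \<in> K"
    by (auto simp: onb_expand)
  then have "seq_compact K" "\<And>n. f n \<in> K" using r by (auto simp: compact_eq_seq_compact_metric)
  then show "\<exists>l r. strict_mono r \<and> (f \<circ> r) \<longlonglongrightarrow> l" unfolding seq_compact_def by blast
qed

instance fin_dim_inner \<subseteq> banach ..

section \<open>Derivatives, functions of class C^k and smooth functions\<close>

abbreviation FD :: "('a::real_normed_vector \<Rightarrow> 'b::real_normed_vector) \<Rightarrow> 'a \<Rightarrow> 'a \<Rightarrow> 'b" where
  "FD f x \<equiv> frechet_derivative f (at x)"

lemma FD_eq: "(f has_derivative f') (at x) \<Longrightarrow> FD f x = f'"
  by (metis frechet_derivative_at)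

lemma FD_cong:
  assumes "open S" "x \<in> S" "\<And>y. y \<in> S \<Longrightarrow> f y = g y"
  shows "FD f x = FD g x"
proof -
  have "(f has_derivative f') (at x) \<longleftrightarrow> (g has_derivative f') (at x)" for f'
    using assms has_derivative_transform_within_open[OF _ assms(1,2)] by metis
  then show ?thesis by (simp add: frechet_derivative_def)
qed

lemma Ck_on_cong:
  assumes "open S"
  shows "(\<And>x. x \<in> S \<Longrightarrow> f x = g x) \<Longrightarrow> Ck_on k S f = Ck_on k S g"
proof (induction k arbitrary: f g)
  case 0
  then show ?case by (simp cong: continuous_on_cong)
next
  case (Suc k)
  have "FD f x = FD g x" if "x \<in> S" for x using FD_cong[OF assms that Suc.prems] .
  then have "Ck_on k S (\<lambda>x. FD f x v) = Ck_on k S (\<lambda>x. FD g x v)" for v by (intro Suc.IH) simp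
  moreover have "f differentiable at x \<longleftrightarrow> g differentiable at x" if "x \<in> S" for x
    unfolding differentiable_def
    using Suc.prems has_derivative_transform_within_open[OF _ assms that] by metis
  ultimately show ?case by auto
qed

lemma Ck_on_SucD: "open S \<Longrightarrow> Ck_on (Suc k) S f \<Longrightarrow> Ck_on k S f"
proof (induction k arbitrary: f)
  case 0
  then show ?case
    by (auto simp: continuous_on_eq_continuous_at differentiable_imp_continuous_within)
next
  case (Suc k)
  then show ?case by (metis Ck_on.simps(2))
qed

text \<open>Lets the derivative be supplied in closed form instead of as a value of
  \<open>frechet_derivative\<close>.\<close>

lemma Ck_on_SucI:
  assumes "open S" "\<And>x. x \<in> S \<Longrightarrow> (f has_derivative f' x) (at x)" "\<And>v. Ck_on k S (\<lambda>x. f' x v)"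
  shows "Ck_on (Suc k) S f"
proof -
  have "Ck_on k S (\<lambda>x. FD f x v)" for v
    using assms(3)[of v] by (subst Ck_on_cong[OF assms(1)]) (auto simp: FD_eq[OF assms(2)])
  then show ?thesis using assms(2) by (auto simp: differentiable_def)
qed

lemma Ck_on_Suc_has_derivative:
  "Ck_on (Suc k) S f \<Longrightarrow> x \<in> S \<Longrightarrow> (f has_derivative FD f x) (at x)"
  by (simp add: frechet_derivative_works)

lemma Ck_on_subset: "Ck_on k S f \<Longrightarrow> T \<subseteq> S \<Longrightarrow> Ck_on k T f"
  by (induction k arbitrary: f) (auto intro: continuous_on_subset)

lemma Ck_on_const: "open S \<Longrightarrow> Ck_on k S (\<lambda>_. c)"
proof (induction k arbitrary: c)
  case (Suc k)
  then show ?case by (intro Ck_on_SucI[where f' = "\<lambda>_ _. 0"]) auto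
qed simp

lemma Ck_on_linear:
  assumes "open S" "bounded_linear f"
  shows "Ck_on k S f"
proof (cases k)
  case 0
  then show ?thesis using assms by (simp add: linear_continuous_on)
next
  case (Suc n)
  show ?thesis unfolding Suc
    by (rule Ck_on_SucI[where f' = "\<lambda>_. f"])
      (auto intro: Ck_on_const bounded_linear_imp_has_derivative assms)
qed

lemma Ck_on_add:
  assumes "open S"
  shows "Ck_on k S f \<Longrightarrow> Ck_on k S g \<Longrightarrow> Ck_on k S (\<lambda>x. f x + g x)"
proof (induction k arbitrary: f g)
  case (Suc k)
  then show ?case
    by (intro Ck_on_SucI[where f' = "\<lambda>x v. FD f x v + FD g x v", OF assms])
      (auto intro!: has_derivative_add simp: frechet_derivative_works)
qed (auto intro: continuous_intros)

lemma Ck_on_sum: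
  assumes "open S"
  shows "(\<And>i. i \<in> I \<Longrightarrow> Ck_on k S (f i)) \<Longrightarrow> Ck_on k S (\<lambda>x. \<Sum>i\<in>I. f i x)"
proof (induction I rule: infinite_finite_induct)
  case (insert i I)
  then show ?case using assms by (simp add: Ck_on_add)
qed (auto intro: Ck_on_const assms)

lemma Ck_on_bilinear:
  assumes "open S" and b: "bounded_bilinear p"
  shows "Ck_on k S f \<Longrightarrow> Ck_on k S g \<Longrightarrow> Ck_on k S (\<lambda>x. p (f x) (g x))"
proof (induction k arbitrary: f g)
  case 0
  then show ?case by (simp add: bounded_bilinear.continuous_on[OF b])
next
  case (Suc k)
  note k = Ck_on_SucD[OF assms(1)]
  have d: "((\<lambda>x. p (f x) (g x)) has_derivative (\<lambda>v. p (f x) (FD g x v) + p (FD f x v) (g x))) (at x)"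
    if x: "x \<in> S" for x
    by (rule bounded_bilinear.FDERIV[OF b Ck_on_Suc_has_derivative[OF Suc.prems(1) x]
          Ck_on_Suc_has_derivative[OF Suc.prems(2) x]])
  have "Ck_on k S (\<lambda>x. p (f x) (FD g x v) + p (FD f x v) (g x))" for v
    using Suc.prems k[OF Suc.prems(1)] k[OF Suc.prems(2)]
    by (intro Ck_on_add assms(1) Suc.IH) auto
  with d show ?case by (rule Ck_on_SucI[OF assms(1)])
qed

text \<open>The derivative of the composite applies \<open>FD g (f x)\<close> to a vector that moves
  with \<open>x\<close>. Expanding that vector in \<open>onb\<close> leaves products of scalars with
  \<open>FD g (f x) b\<close> for fixed \<open>b\<close>, and to these the induction hypothesis
  applies.\<close>

lemma Ck_on_compose:
  fixes f :: "'a::real_normed_vector \<Rightarrow> 'b::fin_dim_inner" and g :: "'b \<Rightarrow> 'c::real_normed_vector"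
  assumes S: "open S" "open T" "f ` S \<subseteq> T"
  shows "Ck_on k S f \<Longrightarrow> Ck_on k T g \<Longrightarrow> Ck_on k S (\<lambda>x. g (f x))"
proof (induction k arbitrary: g)
  case 0
  then show ?case using S by (auto intro: continuous_on_compose2)
next
  case (Suc k)
  have d: "((\<lambda>x. g (f x)) has_derivative (\<lambda>v. FD g (f x) (FD f x v))) (at x)" if "x \<in> S" for x
    using that Suc.prems S by (intro has_derivative_compose[of f _ _ _ g])
      (auto simp: frechet_derivative_works has_derivative_at_withinI image_subset_iff)
  have e: "FD g (f x) (FD f x v) = (\<Sum>b\<in>onb. inner (FD f x v) b *\<^sub>R FD g (f x) b)" if "x \<in> S" for x v
    using that Suc.prems S by (intro linear_onb_expand linear_frechet_derivative) auto
  have c: "Ck_on k S (\<lambda>x. \<Sum>b\<in>onb. inner (FD f x v) b *\<^sub>R FD g (f x) b)" for v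
    using Suc.prems Ck_on_SucD[OF S(1) Suc.prems(1)]
    by (intro Ck_on_sum S Ck_on_bilinear[OF S(1) bounded_bilinear_scaleR] Suc.IH
        Ck_on_bilinear[OF S(1) bounded_bilinear_inner] Ck_on_const) auto
  have "Ck_on k S (\<lambda>x. FD g (f x) (FD f x v))" for v
    by (subst Ck_on_cong[OF S(1)]) (rule e, assumption, rule c)
  with d show ?case by (rule Ck_on_SucI[OF S(1)])
qed

lemma Ck_on_Pair:
  assumes "open S"
  shows "Ck_on k S f \<Longrightarrow> Ck_on k S g \<Longrightarrow> Ck_on k S (\<lambda>x. (f x, g x))"
proof (induction k arbitrary: f g)
  case (Suc k)
  then show ?case
    by (intro Ck_on_SucI[where f' = "\<lambda>x v. (FD f x v, FD g x v)", OF assms])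
      (auto intro!: has_derivative_Pair simp: frechet_derivative_works)
qed (auto intro: continuous_intros)

lemma Cinf_on_has_derivative: "Cinf_on S f \<Longrightarrow> x \<in> S \<Longrightarrow> (f has_derivative FD f x) (at x)"
  unfolding Cinf_on_def using Ck_on_Suc_has_derivative by blast

lemma Cinf_on_continuous: "Cinf_on S f \<Longrightarrow> continuous_on S f"
  unfolding Cinf_on_def by (metis Ck_on.simps(1))

lemma Cinf_on_linear_FD: "Cinf_on S f \<Longrightarrow> x \<in> S \<Longrightarrow> linear (FD f x)"
  using Cinf_on_has_derivative has_derivative_linear by blast

lemma Cinf_on_FD: "Cinf_on S f \<Longrightarrow> Cinf_on S (\<lambda>x. FD f x v)"
  unfolding Cinf_on_def by (metis Ck_on.simps(2))

lemma Cinf_onI: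
  assumes "open S" "\<And>x. x \<in> S \<Longrightarrow> (f has_derivative f' x) (at x)" "\<And>v. Cinf_on S (\<lambda>x. f' x v)"
  shows "Cinf_on S f"
  unfolding Cinf_on_def
proof
  fix k show "Ck_on k S f"
    using Ck_on_SucD[OF assms(1)] Ck_on_SucI[OF assms(1,2)] assms(3) unfolding Cinf_on_def by blast
qed

lemma Cinf_on_cong: "open S \<Longrightarrow> (\<And>x. x \<in> S \<Longrightarrow> f x = g x) \<Longrightarrow> Cinf_on S f = Cinf_on S g"
  unfolding Cinf_on_def using Ck_on_cong by blast

lemma Cinf_on_congD: "open S \<Longrightarrow> Cinf_on S f \<Longrightarrow> (\<And>x. x \<in> S \<Longrightarrow> f x = g x) \<Longrightarrow> Cinf_on S g"
  using Cinf_on_cong by blast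

lemma Cinf_on_subset: "Cinf_on S f \<Longrightarrow> T \<subseteq> S \<Longrightarrow> Cinf_on T f"
  unfolding Cinf_on_def using Ck_on_subset by blast

lemma Cinf_on_const: "open S \<Longrightarrow> Cinf_on S (\<lambda>_. c)"
  by (simp add: Cinf_on_def Ck_on_const)

lemma Cinf_on_linear: "open S \<Longrightarrow> bounded_linear f \<Longrightarrow> Cinf_on S f"
  by (simp add: Cinf_on_def Ck_on_linear)

lemma Cinf_on_ident: "open S \<Longrightarrow> Cinf_on S (\<lambda>x. x)"
  by (intro Cinf_on_linear bounded_linear_ident)

lemma Cinf_on_add: "open S \<Longrightarrow> Cinf_on S f \<Longrightarrow> Cinf_on S g \<Longrightarrow> Cinf_on S (\<lambda>x. f x + g x)"
  by (simp add: Cinf_on_def Ck_on_add)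

lemma Cinf_on_sum: "open S \<Longrightarrow> (\<And>i. i \<in> I \<Longrightarrow> Cinf_on S (f i)) \<Longrightarrow> Cinf_on S (\<lambda>x. \<Sum>i\<in>I. f i x)"
  by (simp add: Cinf_on_def Ck_on_sum)

lemma Cinf_on_bilinear:
  "open S \<Longrightarrow> bounded_bilinear p \<Longrightarrow> Cinf_on S f \<Longrightarrow> Cinf_on S g \<Longrightarrow> Cinf_on S (\<lambda>x. p (f x) (g x))"
  by (simp add: Cinf_on_def Ck_on_bilinear)

lemma Cinf_on_scaleR:
  "open S \<Longrightarrow> Cinf_on S f \<Longrightarrow> Cinf_on S g \<Longrightarrow> Cinf_on S (\<lambda>x. f x *\<^sub>R g x)"
  by (rule Cinf_on_bilinear[OF _ bounded_bilinear_scaleR])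

lemma Cinf_on_inner:
  "open S \<Longrightarrow> Cinf_on S f \<Longrightarrow> Cinf_on S g \<Longrightarrow> Cinf_on S (\<lambda>x. inner (f x) (g x))"
  by (rule Cinf_on_bilinear[OF _ bounded_bilinear_inner])

lemma Cinf_on_minus: "open S \<Longrightarrow> Cinf_on S f \<Longrightarrow> Cinf_on S (\<lambda>x. - f x)"
  using Cinf_on_scaleR[of S "\<lambda>_. -1" f] by (simp add: Cinf_on_const)

lemma Cinf_on_diff: "open S \<Longrightarrow> Cinf_on S f \<Longrightarrow> Cinf_on S g \<Longrightarrow> Cinf_on S (\<lambda>x. f x - g x)"
  using Cinf_on_add[of S f "\<lambda>x. - g x"] by (simp add: Cinf_on_minus)

lemma Cinf_on_Pair: "open S \<Longrightarrow> Cinf_on S f \<Longrightarrow> Cinf_on S g \<Longrightarrow> Cinf_on S (\<lambda>x. (f x, g x))"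
  by (simp add: Cinf_on_def Ck_on_Pair)

lemma Cinf_on_fst: "open S \<Longrightarrow> Cinf_on S fst"
  and Cinf_on_snd: "open S \<Longrightarrow> Cinf_on S snd"
  by (intro Cinf_on_linear bounded_linear_fst bounded_linear_snd; assumption)+

lemma Cinf_on_compose:
  fixes f :: "'a::real_normed_vector \<Rightarrow> 'b::fin_dim_inner" and g :: "'b \<Rightarrow> 'c::real_normed_vector"
  assumes "open S" "open T" "\<And>x. x \<in> S \<Longrightarrow> f x \<in> T" "Cinf_on S f" "Cinf_on T g"
  shows "Cinf_on S (\<lambda>x. g (f x))"
  using assms Ck_on_compose[of S T f _ g] unfolding Cinf_on_def by blast

text \<open>Expanding \<open>w x\<close> in \<open>onb\<close> leaves finitely many fixed arguments,
  for which smoothness is assumed.\<close>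

lemma Cinf_on_linear_family:
  fixes \<beta> :: "'a::real_normed_vector \<Rightarrow> 'b::fin_dim_inner \<Rightarrow> 'c::real_normed_vector"
  assumes "open S" "\<And>v. Cinf_on S (\<lambda>x. \<beta> x v)" "\<And>x. x \<in> S \<Longrightarrow> linear (\<beta> x)" "Cinf_on S w"
  shows "Cinf_on S (\<lambda>x. \<beta> x (w x))"
proof -
  have "Cinf_on S (\<lambda>x. \<Sum>b\<in>onb. inner (w x) b *\<^sub>R \<beta> x b)"
    by (intro Cinf_on_sum Cinf_on_scaleR Cinf_on_inner Cinf_on_const assms)
  then show ?thesis
    using linear_onb_expand[OF assms(3)] by (subst Cinf_on_cong[OF assms(1)]) auto
qed

lemma Cinf_on_FD_apply:
  fixes f :: "'b::fin_dim_inner \<Rightarrow> 'c::real_normed_vector" and a :: "'a::real_normed_vector \<Rightarrow> 'b"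
  assumes "open S" "open T" "Cinf_on S f" "Cinf_on T a" "Cinf_on T w" "\<And>t. t \<in> T \<Longrightarrow> a t \<in> S"
  shows "Cinf_on T (\<lambda>t. FD f (a t) (w t))"
proof (rule Cinf_on_linear_family[OF assms(2) _ _ assms(5), of "\<lambda>t. FD f (a t)"])
  show "Cinf_on T (\<lambda>t. FD f (a t) v)" for v
    by (rule Cinf_on_compose[OF assms(2,1,6,4) Cinf_on_FD[OF assms(3)]])
  show "linear (FD f (a t))" if "t \<in> T" for t
    by (rule Cinf_on_linear_FD[OF assms(3) assms(6)[OF that]])
qed

lemma Ck_on_local:
  "(\<And>x. x \<in> S \<Longrightarrow> \<exists>N. open N \<and> x \<in> N \<and> Ck_on k N f) \<Longrightarrow> Ck_on k S f"
proof (induction k arbitrary: f)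
  case 0
  then have "isCont f x" if "x \<in> S" for x
    using that by (metis Ck_on.simps(1) continuous_on_eq_continuous_at)
  then show ?case by (simp add: continuous_at_imp_continuous_on)
next
  case (Suc k)
  have "f differentiable at x" if "x \<in> S" for x
    using Suc.prems[OF that] by auto
  moreover have "Ck_on k S (\<lambda>x. FD f x v)" for v
  proof (rule Suc.IH)
    fix x assume "x \<in> S"
    then show "\<exists>N. open N \<and> x \<in> N \<and> Ck_on k N (\<lambda>x. FD f x v)"
      using Suc.prems[of x] by (metis Ck_on.simps(2))
  qed
  ultimately show ?case by simp
qed

lemma Cinf_on_local:
  "(\<And>x. x \<in> S \<Longrightarrow> \<exists>N. open N \<and> x \<in> N \<and> Cinf_on N f) \<Longrightarrow> Cinf_on S f"
  unfolding Cinf_on_def by (metis Ck_on_local)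

lemma FD_compose:
  assumes "(f has_derivative f') (at x)" "(g has_derivative g') (at (f x))"
  shows "FD (\<lambda>x. g (f x)) x v = g' (f' v)"
  using FD_eq[OF has_derivative_compose[OF assms]] by simp

lemma has_vector_derivative_line:
  assumes "(f has_derivative f') (at (y + s *\<^sub>R v))"
  shows "((\<lambda>s. f (y + s *\<^sub>R v)) has_vector_derivative f' v) (at s)"
proof -
  have "((\<lambda>s. y + s *\<^sub>R v) has_derivative (\<lambda>h. h *\<^sub>R v)) (at s)"
    by (auto intro!: derivative_eq_intros)
  from has_derivative_compose[OF this assms] show ?thesis
    using linear_scale[OF has_derivative_linear[OF assms]] by (simp add: has_vector_derivative_def)
qed

section \<open>Mean value estimates and symmetry of second derivatives\<close>

text \<open>Continuity for each fixed vector is already continuity in operator norm, because the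
  finitely many members of \<open>onb\<close> control all vectors at once.\<close>

lemma linear_family_near:
  fixes \<beta> :: "'c::metric_space \<Rightarrow> 'a::fin_dim_inner \<Rightarrow> 'b::real_normed_vector"
  assumes S: "open S" "x \<in> S" and lin: "\<And>y. y \<in> S \<Longrightarrow> linear (\<beta> y)"
    and cont: "\<And>v. continuous_on S (\<lambda>y. \<beta> y v)" and e: "e > 0"
  obtains d where "d > 0" "\<And>y. dist y x < d \<Longrightarrow> y \<in> S"
    "\<And>y v. dist y x < d \<Longrightarrow> norm (\<beta> y v - \<beta> x v) \<le> norm v * e"
proof -
  define K where "K = real (card (onb :: 'a set))"
  \<comment> \<open>The \<open>+ 1\<close> keeps the divisor positive in dimension zero.\<close>
  define c where "c = e / (K + 1)"
  have c: "c > 0" "K * c \<le> e" using e by (auto simp: c_def K_def field_simps)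
  have "\<forall>\<^sub>F y in nhds x. y \<in> S \<and> norm b * norm (\<beta> y b - \<beta> x b) < c" for b
  proof -
    have "((\<lambda>y. norm b * norm (\<beta> y b - \<beta> x b)) \<longlongrightarrow> norm b * norm (\<beta> x b - \<beta> x b)) (nhds x)"
      using cont[of b] S
      by (intro tendsto_intros) (metis continuous_on_eq_continuous_at isCont_def tendsto_at_iff_tendsto_nhds)
    then have "\<forall>\<^sub>F y in nhds x. norm b * norm (\<beta> y b - \<beta> x b) < c"
      using c(1) by (intro order_tendstoD(2)) auto
    then show ?thesis using eventually_nhds_in_open[OF S] by (rule eventually_elim2) auto
  qed
  then have "\<forall>\<^sub>F y in nhds x. \<forall>b\<in>onb. y \<in> S \<and> norm b * norm (\<beta> y b - \<beta> x b) < c"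
    by (intro eventually_ball_finite) auto
  then have "\<forall>\<^sub>F y in nhds x. y \<in> S \<and> (\<forall>b\<in>onb. norm b * norm (\<beta> y b - \<beta> x b) < c)"
    using eventually_nhds_in_open[OF S] by (rule eventually_elim2) auto
  then obtain d where d: "d > 0" "\<And>y. dist y x < d \<Longrightarrow> y \<in> S"
    "\<And>y b. dist y x < d \<Longrightarrow> b \<in> onb \<Longrightarrow> norm b * norm (\<beta> y b - \<beta> x b) < c"
    unfolding eventually_nhds_metric by blast
  have "norm (\<beta> y v - \<beta> x v) \<le> norm v * e" if "dist y x < d" for y v
  proof -
    have "norm (\<beta> y v - \<beta> x v) \<le> norm v * (K * c)"
      unfolding K_def
    proof (rule norm_linear_le_onb[where f = "\<lambda>v. \<beta> y v - \<beta> x v"])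
      show "linear (\<lambda>v. \<beta> y v - \<beta> x v)"
        using lin[OF d(2)[OF that]] lin[OF S(2)] by (rule linear_compose_sub)
      show "norm b * norm (\<beta> y b - \<beta> x b) \<le> c" if "b \<in> onb" for b
        using d(3)[OF \<open>dist y x < d\<close> that] by simp
    qed
    also have "\<dots> \<le> norm v * e" by (intro mult_left_mono c) auto
    finally show ?thesis .
  qed
  with d(1,2) show thesis using that by blast
qed

text \<open>Along the segment from \<open>x\<close> to \<open>y\<close> the directional derivative
  stays within \<open>e\<close> of that at \<open>x\<close>, so the mean value inequality gives the
  Frechet estimate. Meant for functions defined by integrals, which are differentiated one line at a
  time.\<close>

lemma has_derivative_from_directional:
  fixes f :: "'a::fin_dim_inner \<Rightarrow> 'b::real_normed_vector"
  assumes S: "open S" "x \<in> S"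
    and dir: "\<And>y v. y \<in> S \<Longrightarrow> ((\<lambda>s. f (y + s *\<^sub>R v)) has_vector_derivative \<beta> y v) (at 0)"
    and lin: "\<And>y. y \<in> S \<Longrightarrow> linear (\<beta> y)"
    and cont: "\<And>v. continuous_on S (\<lambda>y. \<beta> y v)"
  shows "(f has_derivative \<beta> x) (at x)"
  unfolding has_derivative_at_alt
proof (intro conjI allI impI)
  show "bounded_linear (\<beta> x)" by (rule linear_imp_bounded_linear[OF lin[OF S(2)]])
  fix e :: real assume e: "e > 0"
  obtain d where d: "d > 0" "\<And>y. dist y x < d \<Longrightarrow> y \<in> S"
    and bound: "\<And>y v. dist y x < d \<Longrightarrow> norm (\<beta> y v - \<beta> x v) \<le> norm v * e"
    using linear_family_near[OF S lin cont e] by blast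
  have "norm (f y - f x - \<beta> x (y - x)) \<le> e * norm (y - x)" if y: "norm (y - x) < d" for y
  proof -
    define v where "v = y - x"
    have near: "dist (x + s *\<^sub>R v) x < d" if "s \<in> {0..1}" for s
    proof -
      have "norm (s *\<^sub>R v) \<le> norm v" using that by (simp add: mult_left_le_one_le)
      then show ?thesis using y by (simp add: dist_norm v_def)
    qed
    have "((\<lambda>s. f (x + s *\<^sub>R v)) has_vector_derivative \<beta> (x + s *\<^sub>R v) v) (at s within {0..1})"
      if "s \<in> {0..1}" for s
    proof -
      have "((\<lambda>t. f (x + s *\<^sub>R v + t *\<^sub>R v)) has_derivative (\<lambda>h. h *\<^sub>R \<beta> (x + s *\<^sub>R v) v)) (at (s - s))"
        using dir[OF d(2)[OF near[OF that]]] by (simp add: has_vector_derivative_def)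
      moreover have "((\<lambda>r. r - s) has_derivative (\<lambda>h. h)) (at s)"
        by (auto intro!: derivative_eq_intros)
      ultimately have "((\<lambda>r. f (x + s *\<^sub>R v + (r - s) *\<^sub>R v)) has_derivative
          (\<lambda>h. h *\<^sub>R \<beta> (x + s *\<^sub>R v) v)) (at s)"
        by (rule has_derivative_compose[rotated])
      then show ?thesis
        by (simp add: has_vector_derivative_def algebra_simps has_derivative_at_withinI)
    qed
    then have "norm (f (x + 1 *\<^sub>R v) - f (x + 0 *\<^sub>R v) - (1 - 0) *\<^sub>R \<beta> (x + 0 *\<^sub>R v) v)
        \<le> norm (1 - 0 :: real) * (norm v * e)"
    proof (rule vector_differentiable_bound_linearization)
      show "norm (\<beta> (x + s *\<^sub>R v) v - \<beta> (x + 0 *\<^sub>R v) v) \<le> norm v * e" if "s \<in> {0..1}" for s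
        using bound[OF near[OF that], of v] by simp
    qed (auto simp: closed_segment_eq_real_ivl)
    then show ?thesis by (simp add: v_def mult.commute)
  qed
  then show "\<exists>d>0. \<forall>y. norm (y - x) < d \<longrightarrow> norm (f y - f x - \<beta> x (y - x)) \<le> e * norm (y - x)"
    using d(1) by blast
qed

text \<open>The mean value theorem is applied twice, first along \<open>v\<close> to the increment
  of \<open>f\<close> in direction \<open>w\<close>, then along \<open>w\<close>. The second
  difference is symmetric in \<open>v\<close> and \<open>w\<close> while the mixed derivative is not
  visibly so; this is the source of the symmetry of second derivatives.\<close>

lemma second_difference_MVT:
  fixes f :: "'a::fin_dim_inner \<Rightarrow> real"
  assumes f: "Cinf_on (ball x r) f" and h: "h > 0" "h * (norm v + norm w) < r"
  shows "\<exists>y\<in>ball x r. f (x + h *\<^sub>R v + h *\<^sub>R w) - f (x + h *\<^sub>R v) - f (x + h *\<^sub>R w) + f x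
    = h * h * FD (\<lambda>y. FD f y v) y w"
proof -
  have inb: "x + s *\<^sub>R v + t *\<^sub>R w \<in> ball x r" if "0 \<le> s" "s \<le> h" "0 \<le> t" "t \<le> h" for s t
  proof -
    have "norm (s *\<^sub>R v + t *\<^sub>R w) \<le> s * norm v + t * norm w"
      using norm_triangle_ineq[of "s *\<^sub>R v" "t *\<^sub>R w"] that by simp
    also have "\<dots> \<le> h * norm v + h * norm w" using that by (intro add_mono mult_right_mono) auto
    also have "\<dots> < r" using h(2) by (simp add: distrib_left)
    also have "norm (s *\<^sub>R v + t *\<^sub>R w) = dist x (x + s *\<^sub>R v + t *\<^sub>R w)"
      unfolding dist_norm norm_minus_commute[of x] by (simp add: add.assoc)
    finally show ?thesis by simp
  qed
  have "\<exists>s>0. s < h \<and> (f (x + h *\<^sub>R w + h *\<^sub>R v) - f (x + h *\<^sub>R v)) - (f (x + h *\<^sub>R w + 0 *\<^sub>R v) - f (x + 0 *\<^sub>R v))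
     = (h - 0) * (FD f (x + h *\<^sub>R w + s *\<^sub>R v) v - FD f (x + s *\<^sub>R v) v)"
  proof (rule MVT2[OF h(1), of "\<lambda>s. f (x + h *\<^sub>R w + s *\<^sub>R v) - f (x + s *\<^sub>R v)"])
    fix s :: real assume s: "0 \<le> s" "s \<le> h"
    have 1: "x + h *\<^sub>R w + s *\<^sub>R v \<in> ball x r" "x + s *\<^sub>R v \<in> ball x r"
      using inb[of s h] inb[of s 0] s h(1) by (simp_all add: ac_simps)
    show "((\<lambda>s. f (x + h *\<^sub>R w + s *\<^sub>R v) - f (x + s *\<^sub>R v)) has_field_derivative
        FD f (x + h *\<^sub>R w + s *\<^sub>R v) v - FD f (x + s *\<^sub>R v) v) (at s)"
      unfolding has_real_derivative_iff_has_vector_derivative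
      by (intro has_vector_derivative_diff has_vector_derivative_line Cinf_on_has_derivative[OF f] 1)
  qed
  then obtain s where s: "0 < s" "s < h"
    "f (x + h *\<^sub>R w + h *\<^sub>R v) - f (x + h *\<^sub>R v) - f (x + h *\<^sub>R w) + f x
     = h * (FD f (x + h *\<^sub>R w + s *\<^sub>R v) v - FD f (x + s *\<^sub>R v) v)"
    by (auto simp: algebra_simps)
  have "\<exists>t>0. t < h \<and> FD f (x + s *\<^sub>R v + h *\<^sub>R w) v - FD f (x + s *\<^sub>R v + 0 *\<^sub>R w) v
     = (h - 0) * FD (\<lambda>y. FD f y v) (x + s *\<^sub>R v + t *\<^sub>R w) w"
  proof (rule MVT2[OF h(1), of "\<lambda>t. FD f (x + s *\<^sub>R v + t *\<^sub>R w) v"])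
    fix t :: real assume t: "0 \<le> t" "t \<le> h"
    show "((\<lambda>t. FD f (x + s *\<^sub>R v + t *\<^sub>R w) v) has_field_derivative
        FD (\<lambda>y. FD f y v) (x + s *\<^sub>R v + t *\<^sub>R w) w) (at t)"
      unfolding has_real_derivative_iff_has_vector_derivative
      using s t
      by (intro has_vector_derivative_line[where f = "\<lambda>y. FD f y v"]
          Cinf_on_has_derivative[OF Cinf_on_FD[OF f]] inb) auto
  qed
  then obtain t where t: "0 < t" "t < h"
    "FD f (x + s *\<^sub>R v + h *\<^sub>R w) v - FD f (x + s *\<^sub>R v) v
     = h * FD (\<lambda>y. FD f y v) (x + s *\<^sub>R v + t *\<^sub>R w) w" by auto
  show ?thesis
    using s t inb[of s t] by (intro bexI[of _ "x + s *\<^sub>R v + t *\<^sub>R w"]) (auto simp: ac_simps)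
qed

text \<open>If the mixed derivatives differed at \<open>x\<close>, continuity would keep each within
  half of the gap on a small ball. Yet one and the same second difference is \<open>h * h\<close>
  times a value of each on that ball.\<close>

lemma second_FD_symmetric_real:
  fixes f :: "'a::fin_dim_inner \<Rightarrow> real"
  assumes S: "open S" "x \<in> S" and f: "Cinf_on S f"
  shows "FD (\<lambda>y. FD f y v) x w = FD (\<lambda>y. FD f y w) x v"
proof (rule ccontr)
  define A where "A y = FD (\<lambda>y. FD f y v) y w" for y
  define B where "B y = FD (\<lambda>y. FD f y w) y v" for y
  assume "FD (\<lambda>y. FD f y v) x w \<noteq> FD (\<lambda>y. FD f y w) x v"
  then have ne: "\<bar>A x - B x\<bar> / 2 > 0" by (simp add: A_def B_def)
  have "continuous_on S A" "continuous_on S B"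
    unfolding A_def B_def by (intro Cinf_on_continuous Cinf_on_FD f)+
  then have "isCont A x" "isCont B x" using S by (auto simp: continuous_on_eq_continuous_at)
  from this[unfolded continuous_at_eps_delta, rule_format, OF ne] obtain d1 d2 where
    d: "d1 > 0" "\<And>y. dist y x < d1 \<Longrightarrow> dist (A y) (A x) < \<bar>A x - B x\<bar> / 2"
      "d2 > 0" "\<And>y. dist y x < d2 \<Longrightarrow> dist (B y) (B x) < \<bar>A x - B x\<bar> / 2"
    by blast
  obtain d3 where d3: "d3 > 0" "ball x d3 \<subseteq> S" using S openE by blast
  define r where "r = min d1 (min d2 d3)"
  have r: "r > 0" using d d3 by (simp add: r_def)
  have f': "Cinf_on (ball x r) f" using d3 by (intro Cinf_on_subset[OF f]) (auto simp: r_def)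
  \<comment> \<open>The summand 1 keeps \<open>k\<close> positive when both vectors vanish;
    \<open>h = r / (2 * k)\<close> then leaves the whole parallelogram inside the ball of radius
    \<open>r\<close>.\<close>
  define k where "k = norm v + norm w + 1"
  have k: "k > 0" "norm v + norm w \<le> k"
    unfolding k_def using norm_ge_zero[of v] norm_ge_zero[of w] by linarith+
  define h where "h = r / (2 * k)"
  have h: "h > 0" using r k by (simp add: h_def)
  have "h * (norm v + norm w) \<le> h * k" using h k by simp
  also have "\<dots> = r / 2" using k by (simp add: h_def)
  finally have hr: "h * (norm v + norm w) < r" using r by simp
  obtain y1 where y1: "y1 \<in> ball x r"
    "f (x + h *\<^sub>R v + h *\<^sub>R w) - f (x + h *\<^sub>R v) - f (x + h *\<^sub>R w) + f x = h * h * A y1"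
    using second_difference_MVT[OF f' h hr] unfolding A_def by blast
  have hr': "h * (norm w + norm v) < r" using hr by (simp add: add.commute)
  obtain y2 where y2: "y2 \<in> ball x r"
    "f (x + h *\<^sub>R w + h *\<^sub>R v) - f (x + h *\<^sub>R w) - f (x + h *\<^sub>R v) + f x = h * h * B y2"
    using second_difference_MVT[OF f' h hr'] unfolding B_def by blast
  have "h * h * A y1 = h * h * B y2" unfolding y1(2)[symmetric] y2(2)[symmetric] by (simp add: ac_simps)
  then have e: "A y1 = B y2" using h by simp
  have "dist (A y1) (A x) < \<bar>A x - B x\<bar> / 2" "dist (B y2) (B x) < \<bar>A x - B x\<bar> / 2"
    using d(2)[of y1] d(4)[of y2] y1(1) y2(1) by (simp_all add: r_def dist_commute)
  from dist_triangle_half_r[OF this(1) this(2)[folded e]] show False by (simp add: dist_real_def)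
qed

lemma second_FD_symmetric:
  fixes f :: "'a::fin_dim_inner \<Rightarrow> 'b::fin_dim_inner"
  assumes S: "open S" "x \<in> S" and f: "Cinf_on S f"
  shows "FD (\<lambda>y. FD f y v) x w = FD (\<lambda>y. FD f y w) x v"
proof -
  have i: "((\<lambda>y. inner (g y) b) has_derivative (\<lambda>v. inner (FD g y v) b)) (at y)"
    if "Cinf_on S g" "y \<in> S" for g :: "'a \<Rightarrow> 'b" and b y
    using Cinf_on_has_derivative[OF that] by (rule has_derivative_inner_left)
  have e: "inner (FD (\<lambda>y. FD f y v) x w) b = FD (\<lambda>y. FD (\<lambda>y. inner (f y) b) y v) x w" for v w b
  proof -
    have "FD (\<lambda>y. FD (\<lambda>y. inner (f y) b) y v) x = FD (\<lambda>y. inner (FD f y v) b) x"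
      using FD_eq[OF i[OF f]] by (intro FD_cong[OF S]) auto
    then show ?thesis using FD_eq[OF i[OF Cinf_on_FD[OF f] S(2)], of v b] by simp
  qed
  have "Cinf_on S (\<lambda>y. inner (f y) b)" for b
    using S f by (intro Cinf_on_inner Cinf_on_const)
  then have "inner (FD (\<lambda>y. FD f y v) x w) b = inner (FD (\<lambda>y. FD f y w) x v) b" for b
    unfolding e by (rule second_FD_symmetric_real[OF S])
  \<comment> \<open>A vector orthogonal to itself vanishes, so the components are compared in the
    direction of the difference.\<close>
  from this[of "FD (\<lambda>y. FD f y v) x w - FD (\<lambda>y. FD f y w) x v"]
  have "inner (FD (\<lambda>y. FD f y v) x w - FD (\<lambda>y. FD f y w) x v)
      (FD (\<lambda>y. FD f y v) x w - FD (\<lambda>y. FD f y w) x v) = 0"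
    by (simp only: inner_diff_left diff_self)
  then show ?thesis by simp
qed

text \<open>Expansion in \<open>onb\<close> reduces this to the product rule for finitely many
  products; reassembling the sums yields one term with the argument frozen at \<open>w x\<close> and
  one with the linear map frozen at \<open>x\<close>.\<close>

lemma has_derivative_linear_family:
  fixes \<beta> :: "'a::real_normed_vector \<Rightarrow> 'b::fin_dim_inner \<Rightarrow> 'c::real_normed_vector"
  assumes S: "open S" "x \<in> S" and lin: "\<And>y. y \<in> S \<Longrightarrow> linear (\<beta> y)"
    and \<beta>: "\<And>v. (\<lambda>y. \<beta> y v) differentiable (at x)" and w: "(w has_derivative w') (at x)"
  shows "((\<lambda>y. \<beta> y (w y)) has_derivative (\<lambda>a. FD (\<lambda>y. \<beta> y (w x)) x a + \<beta> x (w' a))) (at x)"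
proof -
  have \<beta>': "((\<lambda>y. \<beta> y v) has_derivative FD (\<lambda>y. \<beta> y v) x) (at x)" for v
    using \<beta> by (simp add: frechet_derivative_works)
  have "((\<lambda>y. \<Sum>b\<in>onb. inner (w x) b *\<^sub>R \<beta> y b) has_derivative
      (\<lambda>a. \<Sum>b\<in>onb. inner (w x) b *\<^sub>R FD (\<lambda>y. \<beta> y b) x a)) (at x)"
    by (intro has_derivative_sum has_derivative_scaleR_right \<beta>')
  then have "((\<lambda>y. \<beta> y (w x)) has_derivative
      (\<lambda>a. \<Sum>b\<in>onb. inner (w x) b *\<^sub>R FD (\<lambda>y. \<beta> y b) x a)) (at x)"
    by (rule has_derivative_transform_within_open[OF _ S]) (metis linear_onb_expand lin)
  then have 1: "(\<Sum>b\<in>onb. inner (w x) b *\<^sub>R FD (\<lambda>y. \<beta> y b) x a) = FD (\<lambda>y. \<beta> y (w x)) x a" for a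
    by (simp add: FD_eq)
  have "((\<lambda>y. \<Sum>b\<in>onb. inner (w y) b *\<^sub>R \<beta> y b) has_derivative
      (\<lambda>a. \<Sum>b\<in>onb. inner (w x) b *\<^sub>R FD (\<lambda>y. \<beta> y b) x a + inner (w' a) b *\<^sub>R \<beta> x b)) (at x)"
    by (intro has_derivative_sum has_derivative_scaleR has_derivative_inner_left w \<beta>')
  then have "((\<lambda>y. \<beta> y (w y)) has_derivative
      (\<lambda>a. \<Sum>b\<in>onb. inner (w x) b *\<^sub>R FD (\<lambda>y. \<beta> y b) x a + inner (w' a) b *\<^sub>R \<beta> x b)) (at x)"
    by (rule has_derivative_transform_within_open[OF _ S]) (metis linear_onb_expand lin)
  then show ?thesis
    by (simp add: sum.distrib 1 linear_onb_expand[OF lin[OF S(2)], symmetric])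
qed

text \<open>Differentiating \<open>W (f y) = FD f y (Y y)\<close> along \<open>X\<close> produces a
  second derivative of \<open>f\<close> in the directions of \<open>X\<close> and \<open>Y\<close>.
  By symmetry it cancels from the commutator, so brackets of related fields are again
  related.\<close>

lemma bracket_related:
  fixes f :: "'a::fin_dim_inner \<Rightarrow> 'b::fin_dim_inner"
  assumes S: "open S" "x \<in> S" and f: "Cinf_on S f"
    and d: "X differentiable (at x)" "Y differentiable (at x)"
      "Z differentiable (at (f x))" "W differentiable (at (f x))"
    and rel: "\<And>y. y \<in> S \<Longrightarrow> Z (f y) = FD f y (X y)" "\<And>y. y \<in> S \<Longrightarrow> W (f y) = FD f y (Y y)"
  shows "FD W (f x) (Z (f x)) - FD Z (f x) (W (f x)) = FD f x (FD Y x (X x) - FD X x (Y x))"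
proof -
  have key: "FD W (f x) (FD f x a) = FD (\<lambda>y. FD f y (Y x)) x a + FD f x (FD Y x a)"
    if d: "Y differentiable (at x)" "W differentiable (at (f x))"
      and rel: "\<And>y. y \<in> S \<Longrightarrow> W (f y) = FD f y (Y y)" for W Y a
  proof -
    have "((\<lambda>y. FD f y (Y y)) has_derivative (\<lambda>a. FD (\<lambda>y. FD f y (Y x)) x a + FD f x (FD Y x a))) (at x)"
      by (rule has_derivative_linear_family[OF S Cinf_on_linear_FD[OF f]
            differentiableI[OF Cinf_on_has_derivative[OF Cinf_on_FD[OF f] S(2)]]
            d(1)[unfolded frechet_derivative_works]])
    then have "((\<lambda>y. W (f y)) has_derivative (\<lambda>a. FD (\<lambda>y. FD f y (Y x)) x a + FD f x (FD Y x a))) (at x)"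
      by (rule has_derivative_transform_within_open[OF _ S]) (simp add: rel)
    moreover have "((\<lambda>y. W (f y)) has_derivative (\<lambda>a. FD W (f x) (FD f x a))) (at x)"
      by (rule has_derivative_compose[OF Cinf_on_has_derivative[OF f S(2)]
            d(2)[unfolded frechet_derivative_works]])
    ultimately show ?thesis by (auto dest: has_derivative_unique fun_cong)
  qed
  have 1: "FD W (f x) (FD f x a) = FD (\<lambda>y. FD f y (Y x)) x a + FD f x (FD Y x a)" for a
    by (rule key[OF d(2,4)]) (rule rel(2))
  have 2: "FD Z (f x) (FD f x a) = FD (\<lambda>y. FD f y (X x)) x a + FD f x (FD X x a)" for a
    by (rule key[OF d(1,3)]) (rule rel(1))
  show ?thesis
    unfolding rel[OF S(2)] 1 2 second_FD_symmetric[OF S f, of "Y x" "X x"]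
    using linear_diff[OF Cinf_on_linear_FD[OF f S(2)]] by simp
qed

section \<open>The Poincare lemma and a local inverse theorem\<close>

text \<open>The potential integrates \<open>\<beta>\<close> along rays from the centre. Closedness
  makes the derivative of the integrand in direction \<open>v\<close> an exact derivative along the
  ray, so that the integral collapses to the value \<open>\<beta> y v\<close> at the end
  point.\<close>

lemma Poincare_ball:
  fixes \<beta> :: "'a::fin_dim_inner \<Rightarrow> 'a \<Rightarrow> 'b::fin_dim_inner"
  assumes \<beta>: "\<And>v. Cinf_on (ball x0 r) (\<lambda>x. \<beta> x v)"
    and lin: "\<And>x. x \<in> ball x0 r \<Longrightarrow> linear (\<beta> x)"
    and closed: "\<And>x v w. x \<in> ball x0 r \<Longrightarrow> FD (\<lambda>x. \<beta> x v) x w = FD (\<lambda>x. \<beta> x w) x v"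
  shows "\<exists>f. Cinf_on (ball x0 r) f \<and> f x0 = 0 \<and> (\<forall>x\<in>ball x0 r. (f has_derivative \<beta> x) (at x))"
proof -
  let ?B = "ball x0 r"
  define f where "f x = integral (cbox 0 1) (\<lambda>t::real. \<beta> (x0 + t *\<^sub>R (x - x0)) (x - x0))" for x
  have dir: "((\<lambda>s. f (y + s *\<^sub>R v)) has_vector_derivative \<beta> y v) (at 0)" if y: "y \<in> ?B" for y v
  proof -
    define w where "w s = y + s *\<^sub>R v - x0" for s :: real
    define p where "p s t = x0 + t *\<^sub>R w s" for s t :: real
    define G where "G s t = \<beta> (p s t) (w s)" for s t :: real
    \<comment> \<open>\<open>H s t\<close> is the derivative in \<open>t\<close> of
      \<open>t *\<^sub>R \<beta> (p s t) v\<close>. Compared with the derivative of \<open>G\<close>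
      in \<open>s\<close> computed directly, closedness has exchanged the roles of \<open>v\<close>
      and \<open>w s\<close>.\<close>
    define H where "H s t = t *\<^sub>R FD (\<lambda>x. \<beta> x v) (p s t) (w s) + \<beta> (p s t) v" for s t :: real
    have "open ((\<lambda>s. w s) -` ball 0 r)" unfolding w_def
      by (intro open_vimage continuous_intros open_ball)
    moreover have "0 \<in> (\<lambda>s. w s) -` ball 0 r"
      using y by (simp add: w_def dist_norm norm_minus_commute)
    ultimately obtain d where d: "d > 0" "ball 0 d \<subseteq> (\<lambda>s. w s) -` ball 0 r" by (meson openE)
    let ?U = "ball (0::real) d"
    have pB: "p s t \<in> ?B" if "s \<in> ?U" "t \<in> {0..1}" for s t
    proof -
      have "norm (t *\<^sub>R w s) \<le> norm (w s)" using that by (simp add: mult_left_le_one_le)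
      also have "\<dots> < r" using d(2) that(1) by (auto simp: subset_iff)
      finally show ?thesis by (simp add: p_def dist_norm)
    qed
    have p1: "((\<lambda>s. p s t) has_derivative (\<lambda>h. h *\<^sub>R (t *\<^sub>R v))) (at s)" for s t
      unfolding p_def w_def by (auto intro!: derivative_eq_intros simp: algebra_simps)
    have p2: "((\<lambda>t. p s t) has_derivative (\<lambda>h. h *\<^sub>R w s)) (at t)" for s t
      unfolding p_def by (auto intro!: derivative_eq_intros)
    have w1: "(w has_derivative (\<lambda>h. h *\<^sub>R v)) (at s)" for s
      unfolding w_def by (auto intro!: derivative_eq_intros)
    have \<beta>1: "((\<lambda>x. \<beta> x u) has_derivative FD (\<lambda>x. \<beta> x u) (p s t)) (at (p s t))"
      if "s \<in> ?U" "t \<in> {0..1}" for s t u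
      by (rule Cinf_on_has_derivative[OF \<beta> pB[OF that]])
    have 1: "((\<lambda>s. G s t) has_vector_derivative H s t) (at s within ?U)"
      if st: "s \<in> ?U" "t \<in> cbox 0 1" for s t
    proof -
      have t: "t \<in> {0..1}" using st by simp
      have c: "((\<lambda>s. \<beta> (p s t) u) has_derivative (\<lambda>h. FD (\<lambda>x. \<beta> x u) (p s t) (h *\<^sub>R (t *\<^sub>R v)))) (at s)" for u
        by (rule has_derivative_compose[OF p1 \<beta>1[OF st(1) t]])
      have "((\<lambda>s. \<beta> (p s t) (w s)) has_derivative
          (\<lambda>a. FD (\<lambda>s. \<beta> (p s t) (w s')) s a + \<beta> (p s t) (a *\<^sub>R v))) (at s)" if "s' = s" for s'
        unfolding that
        by (rule has_derivative_linear_family[OF open_ball st(1) lin[OF pB[OF _ t]] _ w1])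
          (use c in \<open>auto simp: differentiable_def\<close>)
      from this[OF refl] have "((\<lambda>s. G s t) has_derivative
          (\<lambda>a. FD (\<lambda>x. \<beta> x (w s)) (p s t) (a *\<^sub>R (t *\<^sub>R v)) + \<beta> (p s t) (a *\<^sub>R v))) (at s)"
        unfolding G_def FD_eq[OF c] .
      moreover have "FD (\<lambda>x. \<beta> x (w s)) (p s t) (a *\<^sub>R (t *\<^sub>R v)) + \<beta> (p s t) (a *\<^sub>R v) = a *\<^sub>R H s t" for a
        unfolding H_def closed[OF pB[OF st(1) t], of v "w s"]
        using linear_scale[OF Cinf_on_linear_FD[OF \<beta> pB[OF st(1) t]]] linear_scale[OF lin[OF pB[OF st(1) t]]]
        by (simp add: scaleR_add_right)
      ultimately show ?thesis by (simp add: has_vector_derivative_def has_derivative_at_withinI)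
    qed
    have pc: "Cinf_on S (\<lambda>z. p (fst z) (snd z))" if "open S" for S unfolding p_def w_def using that
      by (intro Cinf_on_add Cinf_on_diff Cinf_on_scaleR Cinf_on_const Cinf_on_fst Cinf_on_snd)
    have wc: "Cinf_on S (\<lambda>z. w (fst z))" if "open S" for S :: "(real \<times> real) set" unfolding w_def using that
      by (intro Cinf_on_add Cinf_on_diff Cinf_on_scaleR Cinf_on_const Cinf_on_fst)
    define O' where "O' = (\<lambda>z. p (fst z) (snd z)) -` ?B"
    have O': "open O'" unfolding O'_def
      by (intro open_vimage Cinf_on_continuous pc open_UNIV open_ball)
    have "Cinf_on O' (\<lambda>z. snd z *\<^sub>R FD (\<lambda>x. \<beta> x v) (p (fst z) (snd z)) (w (fst z)) + \<beta> (p (fst z) (snd z)) v)"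
      by (intro Cinf_on_add Cinf_on_scaleR Cinf_on_snd O' Cinf_on_FD_apply[OF open_ball O' \<beta> pc wc]
         Cinf_on_compose[OF O' open_ball _ pc \<beta>]) (auto simp: O'_def)
    from Cinf_on_continuous[OF this] have 2: "continuous_on (?U \<times> cbox 0 1) (\<lambda>(s, t). H s t)"
      unfolding H_def split_beta
      by (rule continuous_on_subset) (use pB in \<open>auto simp: O'_def\<close>)
    have 3: "G s integrable_on cbox 0 1" if "s \<in> ?U" for s
      unfolding G_def
    proof (rule integrable_continuous)
      have "continuous_on (cbox 0 1) (p s)"
        unfolding p_def by (intro continuous_intros)
      then show "continuous_on (cbox 0 1) (\<lambda>t. \<beta> (p s t) (w s))"
        by (rule continuous_on_compose2[OF Cinf_on_continuous[OF \<beta>]]) (use pB that in auto)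
    qed
    have "((\<lambda>s. integral (cbox 0 1) (G s)) has_vector_derivative integral (cbox 0 1) (H 0)) (at 0 within ?U)"
      by (rule leibniz_rule_vector_derivative[OF 1 3 2]) (use d in auto)
    moreover have "integral (cbox 0 1) (H 0) = \<beta> y v"
    proof -
      have "(H 0 has_integral 1 *\<^sub>R \<beta> (p 0 1) v - 0 *\<^sub>R \<beta> (p 0 0) v) {0..1}"
      proof (rule fundamental_theorem_of_calculus)
        fix t :: real assume t: "t \<in> {0..1}"
        have 0: "0 \<in> ?U" using d by simp
        have "((\<lambda>t. \<beta> (p 0 t) v) has_derivative (\<lambda>h. FD (\<lambda>x. \<beta> x v) (p 0 t) (h *\<^sub>R w 0))) (at t)"
          by (rule has_derivative_compose[OF p2 \<beta>1[OF 0 t]])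
        from has_derivative_scaleR[OF has_derivative_ident this]
        have "((\<lambda>t. t *\<^sub>R \<beta> (p 0 t) v) has_derivative
            (\<lambda>h. t *\<^sub>R FD (\<lambda>x. \<beta> x v) (p 0 t) (h *\<^sub>R w 0) + h *\<^sub>R \<beta> (p 0 t) v)) (at t)" by simp
        then show "((\<lambda>t. t *\<^sub>R \<beta> (p 0 t) v) has_vector_derivative H 0 t) (at t within {0..1})"
          unfolding has_vector_derivative_def H_def
          using linear_scale[OF Cinf_on_linear_FD[OF \<beta> pB[OF 0 t]]]
          by (simp add: scaleR_add_right mult.commute has_derivative_at_withinI)
      qed simp
      then show ?thesis by (simp add: integral_unique p_def w_def)
    qed
    moreover have "(\<lambda>s. integral (cbox 0 1) (G s)) = (\<lambda>s. f (y + s *\<^sub>R v))"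
      unfolding f_def G_def[abs_def] p_def w_def ..
    ultimately show ?thesis using d at_within_open[of 0 ?U] by simp
  qed
  have "(f has_derivative \<beta> x) (at x)" if "x \<in> ?B" for x
    by (rule has_derivative_from_directional[OF open_ball that dir lin Cinf_on_continuous[OF \<beta>]])
  moreover from this have "Cinf_on ?B f" by (rule Cinf_onI[OF open_ball _ \<beta>])
  \<comment> \<open>For \<open>r \<le> 0\<close> the ball is empty and \<open>lin\<close> says
    nothing about \<open>\<beta> x0\<close>, so the zero function replaces the integral.\<close>
  moreover have "\<exists>f :: 'a \<Rightarrow> 'b. Cinf_on ?B f \<and> f x0 = 0" if "\<not> 0 < r"
  proof -
    have "?B = {}" using that by simp
    then have "Cinf_on ?B (\<lambda>_. 0::'b)" by (simp add: Cinf_on_const)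
    then show ?thesis by (intro exI[of _ "\<lambda>_. 0"]) simp
  qed
  moreover have "f x0 = 0" if "0 < r"
    unfolding f_def using linear_0[OF lin[of x0]] that by simp
  ultimately show ?thesis by (metis ball_eq_empty empty_iff not_le)
qed

text \<open>Near \<open>z0\<close> the map \<open>f\<close> minus the identity has derivative of
  norm at most 1/2, hence contracts by this factor. So \<open>f\<close> is injective with inverse of
  Lipschitz constant 2, and \<open>f x = y\<close> is solved by Banach's fixed point
  theorem.\<close>

lemma local_inverse:
  fixes f :: "'a::fin_dim_inner \<Rightarrow> 'a"
  assumes S: "open S" "z0 \<in> S" and f: "Cinf_on S f" and D: "FD f z0 = (\<lambda>v. v)"
  obtains r e where "r > 0" "cball z0 r \<subseteq> S"
    "\<And>x y. x \<in> cball z0 r \<Longrightarrow> y \<in> cball z0 r \<Longrightarrow> norm (x - y) \<le> 2 * norm (f x - f y)"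
    "\<And>y. y \<in> ball (f z0) (r / 2) \<Longrightarrow> e y \<in> ball z0 r \<and> f (e y) = y"
proof -
  obtain d where d: "d > 0" "\<And>y. dist y z0 < d \<Longrightarrow> y \<in> S"
    "\<And>y v. dist y z0 < d \<Longrightarrow> norm (FD f y v - FD f z0 v) \<le> norm v * (1 / 2)"
    using linear_family_near[OF S Cinf_on_linear_FD[OF f] Cinf_on_continuous[OF Cinf_on_FD[OF f]], of "1 / 2"]
    by (metis half_gt_zero zero_less_one)
  define r where "r = d / 2"
  have r: "r > 0" "\<And>x. x \<in> cball z0 r \<Longrightarrow> dist x z0 < d" using d(1) by (auto simp: r_def dist_commute)
  have lip: "norm ((f x - x) - (f y - y)) \<le> 1 / 2 * norm (x - y)" if "x \<in> cball z0 r" "y \<in> cball z0 r" for x y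
  proof (rule differentiable_bound[OF convex_cball _ _ that])
    fix x assume x: "x \<in> cball z0 r"
    show "((\<lambda>x. f x - x) has_derivative (\<lambda>v. FD f x v - v)) (at x within cball z0 r)"
      using Cinf_on_has_derivative[OF f d(2)[OF r(2)[OF x]]]
      by (intro has_derivative_diff has_derivative_ident) (rule has_derivative_at_withinI)
    show "onorm (\<lambda>v. FD f x v - v) \<le> 1 / 2"
      using d(3)[OF r(2)[OF x]] by (intro onorm_bound) (auto simp: D)
  qed
  have fp: "\<exists>x\<in>ball z0 r. f x = y" if y: "y \<in> ball (f z0) (r / 2)" for y
  proof -
    \<comment> \<open>Fixed points of \<open>T\<close> solve \<open>f x = y\<close>. Half of the
      radius is used up by the contraction, the other half is left for the distance of
      \<open>y\<close> from \<open>f z0\<close>; hence the radius \<open>r / 2\<close> in the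
      statement.\<close>
    define T where "T x = y - (f x - x)" for x
    have inb: "T x \<in> ball z0 r" if "x \<in> cball z0 r" for x
    proof -
      have "T x - z0 = (y - f z0) - ((f x - x) - (f z0 - z0))" by (simp add: T_def)
      then have "norm (T x - z0) \<le> norm (y - f z0) + norm ((f x - x) - (f z0 - z0))"
        by (simp only: norm_triangle_ineq4)
      also have "\<dots> \<le> norm (y - f z0) + 1 / 2 * norm (x - z0)" using lip[OF that, of z0] r(1) by simp
      also have "\<dots> < r / 2 + 1 / 2 * r"
      proof (rule add_less_le_mono)
        show "norm (y - f z0) < r / 2" using y by (simp add: dist_norm norm_minus_commute)
        show "1 / 2 * norm (x - z0) \<le> 1 / 2 * r" using that by (simp add: dist_norm norm_minus_commute)
      qed
      finally show ?thesis by (simp add: dist_norm norm_minus_commute)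
    qed
    have "\<exists>!x\<in>cball z0 r. T x = x"
    proof (rule Banach_fix[where c = "1 / 2"])
      show "complete (cball z0 r)" by (simp add: complete_eq_closed)
      show "cball z0 r \<noteq> {}" using r by simp
      show "T ` cball z0 r \<subseteq> cball z0 r" using inb ball_subset_cball by fast
      show "dist (T x) (T x') \<le> 1 / 2 * dist x x'" if "x \<in> cball z0 r" "x' \<in> cball z0 r" for x x'
      proof -
        have "T x - T x' = - ((f x - x) - (f x' - x'))" by (simp add: T_def)
        then show ?thesis using lip[OF that] unfolding dist_norm by (simp only: norm_minus_cancel)
      qed
    qed auto
    then obtain x where x: "x \<in> cball z0 r" "T x = x" by blast
    then have "x \<in> ball z0 r" using inb by force
    moreover have "f x = y" using x(2) by (simp add: T_def algebra_simps)
    ultimately show ?thesis by blast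
  qed
  define e where "e y = (SOME x. x \<in> ball z0 r \<and> f x = y)" for y
  show thesis
  proof (rule that[of r e])
    show "r > 0" by (rule r)
    show "cball z0 r \<subseteq> S" by (rule subsetI) (rule d(2)[OF r(2)])
    show "e y \<in> ball z0 r \<and> f (e y) = y" if "y \<in> ball (f z0) (r / 2)" for y
      unfolding e_def by (rule someI_ex[OF fp[OF that, unfolded Bex_def]])
    show "norm (x - y) \<le> 2 * norm (f x - f y)" if "x \<in> cball z0 r" "y \<in> cball z0 r" for x y
    proof -
      have "norm (x - y) = norm ((f x - f y) - ((f x - x) - (f y - y)))" by simp
      also have "\<dots> \<le> norm (f x - f y) + norm ((f x - x) - (f y - y))" by (rule norm_triangle_ineq4)
      also have "\<dots> \<le> norm (f x - f y) + 1 / 2 * norm (x - y)" using lip[OF that] by simp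
      finally show ?thesis by simp
    qed
  qed
qed

section \<open>Flat functions and bump functions\<close>

text \<open>The functions \<open>p(1/x) exp(-1/x)\<close>, extended by zero, are closed under differentiation.\<close>

definition flat_exp :: "real poly \<Rightarrow> real \<Rightarrow> real" where
  "flat_exp p x = (if x > 0 then poly p (1 / x) * exp (- (1 / x)) else 0)"

lemma poly_mult_exp_minus_tendsto_0: "((\<lambda>y::real. poly p y * exp (- y)) \<longlongrightarrow> 0) at_top"
proof -
  have "((\<lambda>y::real. \<Sum>i\<le>degree p. coeff p i * (y ^ i / exp y)) \<longlongrightarrow> 0) at_top"
    by (intro tendsto_null_sum tendsto_mult_right_zero tendsto_power_div_exp_0)
  then show ?thesis by (simp add: poly_altdef sum_distrib_right exp_minus sum_divide_distrib divide_inverse mult.assoc)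
qed

text \<open>With \<open>y = 1 / x\<close>, differentiation in \<open>x\<close> is
  \<open>- (y ^ 2)\<close> times differentiation in \<open>y\<close>. It sends p(y) exp(-y) to y^2
  (p(y) - p'(y)) exp(-y), and the two \<open>pCons 0\<close> are the factor y^2. At zero the right
  difference quotient is a polynomial in \<open>y\<close> times exp(-y) for \<open>y\<close> tending
  to infinity.\<close>

lemma flat_exp_has_derivative:
  "(flat_exp p has_real_derivative flat_exp (pCons 0 (pCons 0 (p - pderiv p))) x) (at x)"
proof -
  consider "x > 0" | "x < 0" | "x = 0" by linarith
  then show ?thesis
  proof cases
    case 1
    have "((\<lambda>x. poly p (1 / x) * exp (- (1 / x))) has_real_derivative
        flat_exp (pCons 0 (pCons 0 (p - pderiv p))) x) (at x)"
      using 1 by (auto intro!: derivative_eq_intros DERIV_chain2[OF poly_DERIV]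
          simp: flat_exp_def field_simps power2_eq_square)
    then show ?thesis
      by (rule has_field_derivative_transform_within_open[of _ _ _ "{0<..}"]) (use 1 in \<open>auto simp: flat_exp_def\<close>)
  next
    case 2
    have "((\<lambda>_. 0) has_real_derivative flat_exp (pCons 0 (pCons 0 (p - pderiv p))) x) (at x)"
      using 2 by (simp add: flat_exp_def)
    then show ?thesis
      by (rule has_field_derivative_transform_within_open[of _ _ _ "{..<0}"]) (use 2 in \<open>auto simp: flat_exp_def\<close>)
  next
    case 3
    have "((\<lambda>h. flat_exp p h / h) \<longlongrightarrow> 0) (at_left 0)"
      by (rule tendsto_eventually)
        (auto simp: eventually_at_left_field flat_exp_def intro: exI[of _ "-1"])
    moreover have "((\<lambda>h. flat_exp p h / h) \<longlongrightarrow> 0) (at_right 0)"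
    proof (rule Lim_transform_eventually)
      \<comment> \<open>Division by \<open>h\<close> multiplies the polynomial by its variable,
        hence \<open>pCons 0 p\<close>.\<close>
      show "((\<lambda>h. poly (pCons 0 p) (inverse h) * exp (- inverse h)) \<longlongrightarrow> 0) (at_right (0::real))"
        by (rule filterlim_compose[OF poly_mult_exp_minus_tendsto_0 filterlim_inverse_at_top_right])
      show "\<forall>\<^sub>F h in at_right 0. poly (pCons 0 p) (inverse h) * exp (- inverse h) = flat_exp p h / h"
        using eventually_at_right_less[of "0::real"]
        by eventually_elim (simp add: flat_exp_def inverse_eq_divide)
    qed
    ultimately have "((\<lambda>h. flat_exp p h / h) \<longlongrightarrow> 0) (at 0)" by (rule filterlim_split_at)
    then show ?thesis using 3 by (simp add: DERIV_def flat_exp_def)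
  qed
qed

lemma flat_exp_Cinf: "Cinf_on UNIV (flat_exp p)"
  unfolding Cinf_on_def
proof
  fix k show "Ck_on k UNIV (flat_exp p)"
  proof (induction k arbitrary: p)
    case 0
    show ?case unfolding Ck_on.simps
      by (intro DERIV_continuous_on) (rule has_field_derivative_at_within[OF flat_exp_has_derivative])
  next
    case (Suc k)
    let ?q = "pCons 0 (pCons 0 (p - pderiv p))"
    show ?case
    proof (rule Ck_on_SucI[where f' = "\<lambda>x v. v *\<^sub>R flat_exp ?q x"])
      show "(flat_exp p has_derivative (\<lambda>v. v *\<^sub>R flat_exp ?q x)) (at x)" for x
        using flat_exp_has_derivative[of p x] by (simp add: has_field_derivative_def mult_commute_abs)
      show "Ck_on k UNIV (\<lambda>x. v *\<^sub>R flat_exp ?q x)" for v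
        by (intro Ck_on_bilinear[OF open_UNIV bounded_bilinear_scaleR] Ck_on_const Suc open_UNIV)
    qed simp
  qed
qed

text \<open>The smooth function \<open>r ^ 2 - inner (x - x0) (x - x0)\<close> is nonpositive off
  the ball, where \<open>flat_exp\<close> vanishes. The purpose is to extend tangent vectors to
  global vector fields.\<close>

lemma bump_function_exists:
  fixes x0 :: "'a::fin_dim_inner"
  assumes "r > 0"
  shows "\<exists>\<rho>::'a \<Rightarrow> real. Cinf_on UNIV \<rho> \<and> \<rho> x0 = 1 \<and> (\<forall>x. x \<notin> ball x0 r \<longrightarrow> \<rho> x = 0)"
proof -
  define c where "c = flat_exp 1 (r ^ 2)"
  have c: "c \<noteq> 0" using assms by (simp add: c_def flat_exp_def)
  define \<rho> where "\<rho> x = (1 / c) *\<^sub>R flat_exp 1 (r ^ 2 - inner (x - x0) (x - x0))" for x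
  have "Cinf_on UNIV \<rho>" unfolding \<rho>_def
    by (intro Cinf_on_scaleR Cinf_on_const open_UNIV Cinf_on_compose[OF open_UNIV open_UNIV UNIV_I _ flat_exp_Cinf]
        Cinf_on_diff Cinf_on_inner Cinf_on_ident)
  moreover have "\<rho> x0 = 1" using c by (simp add: \<rho>_def c_def)
  moreover have "\<rho> x = 0" if "x \<notin> ball x0 r" for x
  proof -
    have "r ^ 2 \<le> norm (x - x0) ^ 2"
      using that assms by (intro power_mono) (auto simp: dist_norm norm_minus_commute)
    then show ?thesis by (simp add: \<rho>_def flat_exp_def power2_norm_eq_inner)
  qed
  ultimately show ?thesis by blast
qed

section \<open>Gluing local potentials near the diagonal\<close>

text \<open>Differences \<open>h i y - h i x\<close> may depend on \<open>i\<close> once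
  \<open>y\<close> is far from \<open>x\<close>, and the cocycle identity asks for one index that
  serves three points. The cover is therefore refined to closed sets \<open>K n\<close> inside open
  sets \<open>I n\<close> inside closed sets \<open>L n\<close>. The sets \<open>K n\<close> choose
  the index at the first point, \<open>I n\<close> confines the second point, and \<open>L n\<close>
  is locally finite, so that only finitely many potentials must agree near a point.\<close>

lemma glue_local_potentials:
  fixes B :: "'m::second_countable_topology \<Rightarrow> 'm set" and h :: "'m \<Rightarrow> 'm \<Rightarrow> 'k::ab_group_add"
  assumes reg: "\<And>(p::'m) S. open S \<Longrightarrow> p \<in> S \<Longrightarrow> \<exists>N. open N \<and> p \<in> N \<and> closure N \<subseteq> S"
    and B: "\<And>p. open (B p)" "\<And>p. p \<in> B p"
    and const: "\<And>i j x. x \<in> B i \<Longrightarrow> x \<in> B j \<Longrightarrow>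
      \<exists>N. open N \<and> x \<in> N \<and> N \<subseteq> B i \<inter> B j \<and> (\<forall>y\<in>N. h i y - h j y = h i x - h j x)"
  shows "\<exists>W F. open W \<and> (\<forall>x. (x, x) \<in> W) \<and>
    (\<forall>x y. (x, y) \<in> W \<longrightarrow> (\<exists>i N N'. open N \<and> open N' \<and> x \<in> N \<and> y \<in> N' \<and> N \<subseteq> B i \<and> N' \<subseteq> B i \<and>
       (\<forall>x'\<in>N. \<forall>y'\<in>N'. (x', y') \<in> W \<and> F x' y' = h i y' - h i x'))) \<and>
    (\<forall>x y z. (x, y) \<in> W \<longrightarrow> (y, z) \<in> W \<longrightarrow> (x, z) \<in> W \<longrightarrow> F x y + F y z = F x z)"
proof -
  have "\<exists>N3. open N3 \<and> p \<in> N3 \<and> closure N3 \<subseteq> B p" for p using reg[OF B] .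
  then obtain N3 where N3: "\<And>p. open (N3 p)" "\<And>p. p \<in> N3 p" "\<And>p. closure (N3 p) \<subseteq> B p" by metis
  have "\<exists>N2. open N2 \<and> p \<in> N2 \<and> closure N2 \<subseteq> N3 p" for p using reg[OF N3(1,2)] .
  then obtain N2 where N2: "\<And>p. open (N2 p)" "\<And>p. p \<in> N2 p" "\<And>p. closure (N2 p) \<subseteq> N3 p" by metis
  have "\<exists>N1. open N1 \<and> p \<in> N1 \<and> closure N1 \<subseteq> N2 p" for p using reg[OF N2(1,2)] .
  then obtain N1 where N1: "\<And>p. open (N1 p)" "\<And>p. p \<in> N1 p" "\<And>p. closure (N1 p) \<subseteq> N2 p" by metis
  obtain \<F> where \<F>: "\<F> \<subseteq> range N1" "countable \<F>" "\<Union>\<F> = \<Union>(range N1)"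
    using Lindelof[of "range N1"] N1(1) by blast
  have UF: "\<Union>\<F> = UNIV" using N1(2) \<F>(3) by blast
  then have "\<F> \<noteq> {}" by auto
  then have "range (from_nat_into \<F>) = \<F>" by (rule range_from_nat_into[OF _ \<F>(2)])
  then have "\<forall>n. \<exists>p. from_nat_into \<F> n = N1 p" using \<F>(1) by blast
  then obtain a where a: "\<And>n. from_nat_into \<F> n = N1 (a n)" by metis
  have cov: "\<exists>n. x \<in> N1 (a n)" for x
    using UF \<open>range (from_nat_into \<F>) = \<F>\<close> a by (metis UNIV_I UnionE imageE)
  \<comment> \<open>Removing earlier sets makes \<open>L\<close> locally finite: a point of
    \<open>N1 (a k)\<close> lies in no \<open>L n\<close> with \<open>n > k\<close>. Three nested
    neighbourhoods keep the chain
    \<open>K n \<subseteq> I n \<subseteq> L n \<subseteq> B (a n)\<close> valid after the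
    removals.\<close>
  define K where "K n = closure (N2 (a n)) - (\<Union>j<n. N2 (a j))" for n
  define L where "L n = closure (N3 (a n)) - (\<Union>j<n. N1 (a j))" for n
  define I where "I n = N3 (a n) - (\<Union>j<n. closure (N1 (a j)))" for n
  have clK: "closed (K n)" and clL: "closed (L n)" and opI: "open (I n)" for n
    unfolding K_def L_def I_def using N1(1) N2(1) N3(1) by (auto intro!: closed_Diff open_Diff closed_UN)
  have KI: "K n \<subseteq> I n" for n
    using N2(3)[of "a n"] N1(3) by (auto simp: K_def I_def)
  have IL: "I n \<subseteq> L n" for n
    using closure_subset by (fastforce simp: I_def L_def)
  have KL: "x \<in> L n" if "x \<in> K n" for x n using that KI IL by blast
  have LB: "L n \<subseteq> B (a n)" for n using N3(3)[of "a n"] by (auto simp: L_def)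
  have Kcov: "\<exists>n. x \<in> K n" for x
  proof -
    have "\<exists>n. x \<in> N2 (a n)" using cov[of x] N1(3) closure_subset by blast
    then obtain n where n: "x \<in> N2 (a n)" "\<And>j. j < n \<Longrightarrow> x \<notin> N2 (a j)"
      unfolding exists_least_iff[of "\<lambda>n. x \<in> N2 (a n)"] by blast
    then have "x \<in> closure (N2 (a n))" using closure_subset by blast
    with n(2) have "x \<in> K n" by (auto simp: K_def)
    then show ?thesis ..
  qed
  have fin: "n \<le> k" if "x \<in> N1 (a k)" "x \<in> L n" for x n k
    using that by (intro leI notI) (auto simp: L_def)
  \<comment> \<open>The second condition makes \<open>h (a i) y - h (a i) x\<close> the same for all
    \<open>i\<close> with \<open>x \<in> L i\<close>. The first puts \<open>y\<close> into
    \<open>I i\<close>, hence into \<open>L i\<close>, whenever \<open>x \<in> K i\<close>.\<close>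
  define W where "W = {(x, y). (\<forall>i. x \<in> K i \<longrightarrow> y \<in> I i) \<and> (\<forall>i j. x \<in> L i \<longrightarrow> x \<in> L j \<longrightarrow>
      y \<in> B (a i) \<and> y \<in> B (a j) \<and> h (a i) y - h (a j) y = h (a i) x - h (a j) x)}"
  define F where "F x y = (let i = SOME i. x \<in> K i in h (a i) y - h (a i) x)" for x y
  have sw: "a - c = b - d" if "a - b = c - d" for a b c d :: 'k
  proof -
    have "a - c = (a - b) - (c - d) + (b - d)" by simp
    then show ?thesis using that by simp
  qed
  have F: "F x y = h (a i) y - h (a i) x" if "(x, y) \<in> W" "x \<in> L i" for x y i
  proof -
    define j where "j = (SOME i. x \<in> K i)"
    have "x \<in> K j" unfolding j_def by (rule someI_ex[OF Kcov])
    then have "x \<in> L j" using KI IL by blast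
    with that have "h (a i) y - h (a j) y = h (a i) x - h (a j) x" by (simp add: W_def)
    from sw[OF this] show ?thesis by (simp add: F_def Let_def j_def[symmetric])
  qed
  have loc: "\<exists>i N N'. open N \<and> open N' \<and> x \<in> N \<and> y \<in> N' \<and> N \<subseteq> B i \<and> N' \<subseteq> B i \<and>
       (\<forall>x'\<in>N. \<forall>y'\<in>N'. (x', y') \<in> W \<and> F x' y' = h i y' - h i x')" if xy: "(x, y) \<in> W" for x y
  proof -
    obtain k where k: "x \<in> N1 (a k)" using cov by blast
    \<comment> \<open>The indices that can be active near \<open>x\<close>. The bound
      \<open>fin\<close> makes them finitely many, so that neighbourhoods of agreement may be
      intersected over all pairs.\<close>
    define J where "J = {i. i \<le> k \<and> x \<in> L i}"
    have J: "finite J" by (simp add: J_def)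
    have xB: "x \<in> B (a i)" "y \<in> B (a i)" if "i \<in> J" for i
      using that LB xy by (auto simp: J_def W_def)
    have "\<exists>N. open N \<and> x \<in> N \<and> N \<subseteq> B (a i) \<inter> B (a j) \<and> (\<forall>z\<in>N. h (a i) z - h (a j) z = h (a i) x - h (a j) x)"
      if "i \<in> J" "j \<in> J" for i j using const[OF xB(1)[OF that(1)] xB(1)[OF that(2)]] .
    then obtain P where P: "\<And>i j. i \<in> J \<Longrightarrow> j \<in> J \<Longrightarrow> open (P i j) \<and> x \<in> P i j \<and> P i j \<subseteq> B (a i) \<inter> B (a j)"
      "\<And>i j z. i \<in> J \<Longrightarrow> j \<in> J \<Longrightarrow> z \<in> P i j \<Longrightarrow> h (a i) z - h (a j) z = h (a i) x - h (a j) x" by metis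
    have "\<exists>N. open N \<and> y \<in> N \<and> N \<subseteq> B (a i) \<inter> B (a j) \<and> (\<forall>z\<in>N. h (a i) z - h (a j) z = h (a i) y - h (a j) y)"
      if "i \<in> J" "j \<in> J" for i j using const[OF xB(2)[OF that(1)] xB(2)[OF that(2)]] .
    then obtain Q where Q: "\<And>i j. i \<in> J \<Longrightarrow> j \<in> J \<Longrightarrow> open (Q i j) \<and> y \<in> Q i j \<and> Q i j \<subseteq> B (a i) \<inter> B (a j)"
      "\<And>i j z. i \<in> J \<Longrightarrow> j \<in> J \<Longrightarrow> z \<in> Q i j \<Longrightarrow> h (a i) z - h (a j) z = h (a i) y - h (a j) y" by metis
    \<comment> \<open>As \<open>K\<close> and \<open>L\<close> are closed, \<open>N\<close> can
      avoid those members of index at most \<open>k\<close> that miss \<open>x\<close>, and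
      \<open>N1 (a k)\<close> excludes all larger indices. Moving inside \<open>N\<close> thus adds
      no condition to those that hold at \<open>x\<close>.\<close>
    define N where "N = N1 (a k) \<inter> (\<Inter>i\<in>{i. i \<le> k \<and> x \<notin> L i}. - L i) \<inter>
      (\<Inter>i\<in>{i. i \<le> k \<and> x \<notin> K i}. - K i) \<inter> (\<Inter>i\<in>J. \<Inter>j\<in>J. P i j)"
    define N' where "N' = (\<Inter>i\<in>{i. i \<le> k \<and> x \<in> K i}. I i) \<inter> (\<Inter>i\<in>J. \<Inter>j\<in>J. Q i j)"
    have "open (\<Inter>i\<in>{i. i \<le> k \<and> x \<notin> L i}. - L i)" "open (\<Inter>i\<in>{i. i \<le> k \<and> x \<notin> K i}. - K i)"
      by (intro open_INT ballI open_Compl clL clK; simp)+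
    moreover have "open (\<Inter>i\<in>J. \<Inter>j\<in>J. P i j)" "open (\<Inter>i\<in>J. \<Inter>j\<in>J. Q i j)"
      using P(1) Q(1) by (intro open_INT ballI J; blast)+
    moreover have "open (\<Inter>i\<in>{i. i \<le> k \<and> x \<in> K i}. I i)"
      by (intro open_INT ballI opI) simp
    ultimately have "open N" "open N'" unfolding N_def N'_def using N1(1)[of "a k"] by (simp_all add: open_Int)
    moreover have "x \<in> N" using k P(1) by (auto simp: N_def)
    moreover have "y \<in> N'" using Q(1) xy by (auto simp: N'_def W_def)
    moreover obtain i0 where i0: "x \<in> K i0" using Kcov by blast
    then have i0J: "i0 \<in> J" using KL fin[OF k KL] by (simp add: J_def)
    moreover have "N \<subseteq> B (a i0)" "N' \<subseteq> B (a i0)"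
      using i0J P(1)[OF i0J i0J] Q(1)[OF i0J i0J] by (auto simp: N_def N'_def)
    moreover have "(x', y') \<in> W \<and> F x' y' = h (a i0) y' - h (a i0) x'" if x': "x' \<in> N" and y': "y' \<in> N'" for x' y'
    proof -
      have L': "i \<in> J" if "x' \<in> L i" for i
      proof -
        have "i \<le> k" using fin[of x' k i] x' that by (simp add: N_def)
        then show ?thesis using x' that by (auto simp: N_def J_def)
      qed
      have K': "x \<in> K i \<and> i \<le> k" if "x' \<in> K i" for i
      proof -
        have "i \<le> k" using fin[of x' k i] x' KL[OF that] by (simp add: N_def)
        then show ?thesis using x' that by (auto simp: N_def)
      qed
      have e: "h (a i) y' - h (a j) y' = h (a i) x' - h (a j) x'" if ij: "i \<in> J" "j \<in> J" for i j
      proof -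
        have "x' \<in> P i j" "y' \<in> Q i j" using x' y' ij by (auto simp: N_def N'_def)
        then have "h (a i) y' - h (a j) y' = h (a i) y - h (a j) y"
          "h (a i) x' - h (a j) x' = h (a i) x - h (a j) x" using P(2) Q(2) ij by blast+
        moreover have "h (a i) y - h (a j) y = h (a i) x - h (a j) x"
          using xy ij by (simp add: W_def J_def)
        ultimately show ?thesis by simp
      qed
      have "y' \<in> I i" if "x' \<in> K i" for i using y' K'[OF that] by (auto simp: N'_def)
      moreover have "y' \<in> B (a i)" if "i \<in> J" for i
        using y' Q(1)[OF that that] that by (auto simp: N'_def)
      ultimately have W': "(x', y') \<in> W" using L' e by (simp add: W_def)
      obtain i1 where "x' \<in> K i1" using Kcov by blast
      then have i1: "x' \<in> L i1" by (rule KL)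
      then have "F x' y' = h (a i1) y' - h (a i1) x'" by (rule F[OF W'])
      also have "\<dots> = h (a i0) y' - h (a i0) x'" by (rule sw[OF e[OF L'[OF i1] i0J]])
      finally show ?thesis using W' by simp
    qed
    ultimately show ?thesis
      by (intro exI[of _ "a i0"] exI[of _ N] exI[of _ N'] conjI ballI) simp_all
  qed
  have "open W"
    unfolding open_prod_def
  proof (rule ballI)
    fix z assume "z \<in> W"
    then have "(fst z, snd z) \<in> W" by simp
    from loc[OF this] obtain N N' where "open N" "open N'" "fst z \<in> N" "snd z \<in> N'"
      "\<forall>x'\<in>N. \<forall>y'\<in>N'. (x', y') \<in> W" by blast
    then show "\<exists>A B. open A \<and> open B \<and> z \<in> A \<times> B \<and> A \<times> B \<subseteq> W"
      by (intro exI[of _ N] exI[of _ N']) (auto simp: mem_Times_iff)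
  qed
  moreover have "(x, x) \<in> W" for x using KI LB by (auto simp: W_def subset_iff)
  moreover have "F x y + F y z = F x z" if "(x, y) \<in> W" "(y, z) \<in> W" "(x, z) \<in> W" for x y z
  proof -
    \<comment> \<open>An index with \<open>x \<in> K i\<close> belongs to \<open>L\<close> at both
      \<open>x\<close> and \<open>y\<close>, so all three values of \<open>F\<close> are computed
      from the same potential.\<close>
    obtain i where ij: "x \<in> K i" using Kcov by blast
    have "y \<in> I i" using ij that(1) by (simp add: W_def)
    then have "y \<in> L i" "x \<in> L i" using IL KL[OF ij] by auto
    from F[OF that(1) \<open>x \<in> L i\<close>] F[OF that(2) \<open>y \<in> L i\<close>] F[OF that(3) \<open>x \<in> L i\<close>]
    show ?thesis by simp
  qed
  ultimately show ?thesis using loc by (intro exI[of _ W] exI[of _ F] conjI allI impI) simp_all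
qed

section \<open>Smooth atlases and smooth maps\<close>

text \<open>Model spaces themselves occur as manifolds below, but are not known to belong to the class
  of second countable spaces; hence this variant of \<^const>\<open>smooth_manifold\<close>.\<close>

definition smooth_atlas :: "('m::topological_space, 'e::fin_dim_inner) chart set \<Rightarrow> bool" where
  "smooth_atlas A \<longleftrightarrow>
     (\<forall>p. charts_at A p \<noteq> {}) \<and>
     (\<forall>c\<in>A. open (chart_dom c) \<and> open (chart_img c) \<and>
        homeomorphism (chart_dom c) (chart_img c) (chart_map c) (chart_inv c)) \<and>
     (\<forall>c\<in>A. \<forall>d\<in>A. Cinf_on (chart_map c ` (chart_dom c \<inter> chart_dom d)) (chart_map d \<circ> chart_inv c))"

lemma smooth_manifold_imp_smooth_atlas: "smooth_manifold A \<Longrightarrow> smooth_atlas A"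
  unfolding smooth_manifold_def smooth_atlas_def .

lemma charts_at_iff: "c \<in> charts_at A p \<longleftrightarrow> c \<in> A \<and> p \<in> chart_dom c"
  by (simp add: charts_at_def)

lemma smooth_atlas_obtain_chart:
  assumes "smooth_atlas A"
  obtains c where "c \<in> A" "p \<in> chart_dom c"
  using assms unfolding smooth_atlas_def charts_at_def by fast

lemma chart_props:
  assumes "smooth_atlas A" "c \<in> A"
  shows open_chart_dom: "open (chart_dom c)" and open_chart_img: "open (chart_img c)"
    and chart_inv_map: "p \<in> chart_dom c \<Longrightarrow> chart_inv c (chart_map c p) = p"
    and chart_map_inv: "x \<in> chart_img c \<Longrightarrow> chart_map c (chart_inv c x) = x"
    and chart_inv_in: "x \<in> chart_img c \<Longrightarrow> chart_inv c x \<in> chart_dom c"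
    and continuous_chart_map: "continuous_on (chart_dom c) (chart_map c)"
    and continuous_chart_inv: "continuous_on (chart_img c) (chart_inv c)"
proof -
  have h: "homeomorphism (chart_dom c) (chart_img c) (chart_map c) (chart_inv c)"
    and "open (chart_dom c)" "open (chart_img c)"
    using assms unfolding smooth_atlas_def by auto
  then show "open (chart_dom c)" "open (chart_img c)" by auto
  show "p \<in> chart_dom c \<Longrightarrow> chart_inv c (chart_map c p) = p"
    "x \<in> chart_img c \<Longrightarrow> chart_map c (chart_inv c x) = x"
    "continuous_on (chart_dom c) (chart_map c)" "continuous_on (chart_img c) (chart_inv c)"
    using h by (auto simp: homeomorphism_def)
  show "x \<in> chart_img c \<Longrightarrow> chart_inv c x \<in> chart_dom c"
    using h unfolding homeomorphism_def by blast
qed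

lemma chart_image_iff:
  assumes "smooth_atlas A" "c \<in> A"
  shows "x \<in> chart_map c ` (T \<inter> chart_dom c) \<longleftrightarrow> x \<in> chart_img c \<and> chart_inv c x \<in> T"
proof
  assume "x \<in> chart_map c ` (T \<inter> chart_dom c)"
  then obtain p where "x = chart_map c p" "p \<in> T" "p \<in> chart_dom c" by blast
  then show "x \<in> chart_img c \<and> chart_inv c x \<in> T" using chart_inv_map[OF assms] by simp
next
  assume x: "x \<in> chart_img c \<and> chart_inv c x \<in> T"
  then have "x = chart_map c (chart_inv c x)" "chart_inv c x \<in> T \<inter> chart_dom c"
    using chart_map_inv[OF assms] chart_inv_in[OF assms] by auto
  then show "x \<in> chart_map c ` (T \<inter> chart_dom c)" by (rule image_eqI)
qed

lemma open_chart_image: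
  assumes "smooth_atlas A" "c \<in> A" "open T"
  shows "open (chart_map c ` (T \<inter> chart_dom c))"
proof -
  have "chart_map c ` (T \<inter> chart_dom c) = chart_img c \<inter> chart_inv c -` T"
    using chart_image_iff[OF assms(1,2)] by blast
  then show ?thesis
    using continuous_open_preimage[OF continuous_chart_inv open_chart_img assms(3)] assms(1,2) by simp
qed

lemma open_chart_vimage:
  assumes "smooth_atlas A" "c \<in> A" "open N"
  shows "open (chart_dom c \<inter> chart_map c -` N)"
  by (rule continuous_open_preimage[OF continuous_chart_map open_chart_dom assms(3)]) (rule assms)+

lemma Cinf_on_transition:
  assumes "smooth_atlas A" "c \<in> A" "d \<in> A"
  shows "Cinf_on (chart_map c ` (chart_dom d \<inter> chart_dom c)) (\<lambda>x. chart_map d (chart_inv c x))"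
  using assms unfolding smooth_atlas_def o_def by (metis inf_commute)

lemma smooth_on_continuous: "smooth_on A B S f \<Longrightarrow> continuous_on S f"
  by (simp add: smooth_on_def)

lemma smooth_onD:
  assumes "smooth_on A B S f" "c \<in> A" "d \<in> B" "\<And>p. p \<in> T \<Longrightarrow> p \<in> S \<and> f p \<in> chart_dom d"
  shows "Cinf_on (chart_map c ` (T \<inter> chart_dom c)) (\<lambda>x. chart_map d (f (chart_inv c x)))"
proof -
  have "Cinf_on (chart_map c ` (S \<inter> chart_dom c \<inter> f -` chart_dom d)) (\<lambda>x. chart_map d (f (chart_inv c x)))"
    using assms(1-3) unfolding smooth_on_def o_def by blast
  then show ?thesis by (rule Cinf_on_subset) (use assms(4) in blast)
qed

text \<open>One pair of charts at each point is enough: in any other pair the local representative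
  differs by transition maps on both sides, and these are smooth.\<close>

lemma smooth_onI:
  assumes A: "smooth_atlas A" and B: "smooth_atlas B" and S: "open S" and f: "continuous_on S f"
    and loc: "\<And>p. p \<in> S \<Longrightarrow> \<exists>c\<in>A. \<exists>d\<in>B. \<exists>N. p \<in> chart_dom c \<and> f p \<in> chart_dom d \<and>
      open N \<and> chart_map c p \<in> N \<and> Cinf_on N (\<lambda>x. chart_map d (f (chart_inv c x)))"
  shows "smooth_on A B S f"
  unfolding smooth_on_def o_def
proof (intro conjI f ballI)
  fix c' d' assume c': "c' \<in> A" and d': "d' \<in> B"
  show "Cinf_on (chart_map c' ` (S \<inter> chart_dom c' \<inter> f -` chart_dom d')) (\<lambda>x. chart_map d' (f (chart_inv c' x)))"
  proof (rule Cinf_on_local)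
    fix x assume "x \<in> chart_map c' ` (S \<inter> chart_dom c' \<inter> f -` chart_dom d')"
    then obtain p where p: "x = chart_map c' p" "p \<in> S" "p \<in> chart_dom c'" "f p \<in> chart_dom d'" by blast
    obtain c d N where c: "c \<in> A" "d \<in> B" "p \<in> chart_dom c" "f p \<in> chart_dom d" and N: "open N" "chart_map c p \<in> N"
      "Cinf_on N (\<lambda>x. chart_map d (f (chart_inv c x)))"
      using loc[OF p(2)] by blast
    define T where "T = (S \<inter> f -` (chart_dom d \<inter> chart_dom d')) \<inter> (chart_dom c \<inter> chart_map c -` N)"
    have "open T" unfolding T_def using c(1,2) d'
      by (intro open_Int[OF continuous_open_preimage[OF f S open_Int] open_chart_vimage[OF A _ N(1)]]
          open_chart_dom[OF B])
    then have O: "open (chart_map c' ` (T \<inter> chart_dom c'))" by (rule open_chart_image[OF A c'])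
    let ?O = "chart_map c' ` (T \<inter> chart_dom c')"
    let ?g = "\<lambda>x. chart_map d (f (chart_inv c (chart_map c (chart_inv c' x))))"
    have xT: "chart_inv c' y \<in> T" if "y \<in> ?O" for y
      using that chart_image_iff[OF A c'] by blast
    have e: "?g y = chart_map d (f (chart_inv c' y))" "chart_inv d (?g y) = f (chart_inv c' y)" if "y \<in> ?O" for y
      using xT[OF that] chart_inv_map[OF A c(1)] chart_inv_map[OF B c(2)] by (simp_all add: T_def)
    have 1: "Cinf_on ?O (\<lambda>x. chart_map c (chart_inv c' x))"
      by (rule Cinf_on_subset[OF Cinf_on_transition[OF A c' c(1)]]) (auto simp: T_def)
    have 2: "Cinf_on ?O ?g"
      by (rule Cinf_on_compose[OF O N(1) _ 1 N(3)]) (use xT in \<open>simp add: T_def\<close>)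
    have "Cinf_on ?O (\<lambda>x. chart_map d' (chart_inv d (?g x)))"
    proof (rule Cinf_on_compose[OF O open_chart_image[OF B c(2) open_chart_dom[OF B d']] _ 2 Cinf_on_transition[OF B c(2) d']])
      fix y assume y: "y \<in> ?O"
      show "?g y \<in> chart_map d ` (chart_dom d' \<inter> chart_dom d)"
        unfolding e(1)[OF y] using xT[OF y] by (simp add: T_def)
    qed
    then have "Cinf_on ?O (\<lambda>x. chart_map d' (f (chart_inv c' x)))"
      by (rule Cinf_on_congD[OF O]) (simp only: e(2))
    moreover have "x \<in> ?O" unfolding p(1) using p c N by (intro imageI) (simp add: T_def)
    ultimately show "\<exists>N. open N \<and> x \<in> N \<and> Cinf_on N (\<lambda>x. chart_map d' (f (chart_inv c' x)))" using O by blast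
  qed
qed

lemma smooth_on_subset: "smooth_on A B S f \<Longrightarrow> T \<subseteq> S \<Longrightarrow> smooth_on A B T f"
  unfolding smooth_on_def
proof (elim conjE, intro conjI ballI)
  assume T: "T \<subseteq> S" and "continuous_on S f"
  then show "continuous_on T f" by (metis continuous_on_subset)
  fix c d assume "\<forall>c\<in>A. \<forall>d\<in>B. Cinf_on (chart_map c ` (S \<inter> chart_dom c \<inter> f -` chart_dom d))
      (chart_map d \<circ> f \<circ> chart_inv c)" "c \<in> A" "d \<in> B"
  then have "Cinf_on (chart_map c ` (S \<inter> chart_dom c \<inter> f -` chart_dom d)) (chart_map d \<circ> f \<circ> chart_inv c)"
    by blast
  then show "Cinf_on (chart_map c ` (T \<inter> chart_dom c \<inter> f -` chart_dom d)) (chart_map d \<circ> f \<circ> chart_inv c)"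
    by (rule Cinf_on_subset) (use T in blast)
qed

lemma smooth_on_local:
  assumes A: "smooth_atlas A" and B: "smooth_atlas B" and S: "open S"
    and loc: "\<And>p. p \<in> S \<Longrightarrow> \<exists>N. open N \<and> p \<in> N \<and> smooth_on A B N f"
  shows "smooth_on A B S f"
proof (rule smooth_onI[OF A B S])
  from loc obtain N where N: "\<And>p. p \<in> S \<Longrightarrow> open (N p)" "\<And>p. p \<in> S \<Longrightarrow> p \<in> N p"
    "\<And>p. p \<in> S \<Longrightarrow> smooth_on A B (N p) f" by metis
  have "continuous_on (\<Union>p\<in>S. N p) f"
    by (rule continuous_on_open_UN[OF N(1) smooth_on_continuous[OF N(3)]])
  then show "continuous_on S f" by (rule continuous_on_subset) (use N(2) in blast)
  fix p assume "p \<in> S"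
  then obtain N where N: "open N" "p \<in> N" "smooth_on A B N f" using loc by blast
  obtain c where c: "c \<in> A" "p \<in> chart_dom c" using smooth_atlas_obtain_chart[OF A] .
  obtain d where d: "d \<in> B" "f p \<in> chart_dom d" using smooth_atlas_obtain_chart[OF B] .
  let ?T = "N \<inter> f -` chart_dom d"
  have "open (chart_map c ` (?T \<inter> chart_dom c))"
    by (rule open_chart_image[OF A c(1) continuous_open_preimage[OF smooth_on_continuous[OF N(3)] N(1) open_chart_dom[OF B d(1)]]])
  moreover have "Cinf_on (chart_map c ` (?T \<inter> chart_dom c)) (\<lambda>x. chart_map d (f (chart_inv c x)))"
    by (rule smooth_onD[OF N(3) c(1) d(1)]) simp
  moreover have "chart_map c p \<in> chart_map c ` (?T \<inter> chart_dom c)" using N c d by simp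
  ultimately show "\<exists>c\<in>A. \<exists>d\<in>B. \<exists>N. p \<in> chart_dom c \<and> f p \<in> chart_dom d \<and>
      open N \<and> chart_map c p \<in> N \<and> Cinf_on N (\<lambda>x. chart_map d (f (chart_inv c x)))"
    using c d by (intro bexI[OF _ c(1)] bexI[OF _ d(1)] exI conjI)
qed

lemma smooth_on_cong:
  assumes A: "smooth_atlas A" and B: "smooth_atlas B" and S: "open S"
    and f: "smooth_on A B S f" and e: "\<And>p. p \<in> S \<Longrightarrow> f p = g p"
  shows "smooth_on A B S g"
  unfolding smooth_on_def o_def
proof (intro conjI ballI)
  show g: "continuous_on S g" using smooth_on_continuous[OF f] e by (simp cong: continuous_on_cong)
  fix c d assume c: "c \<in> A" and d: "d \<in> B"
  let ?T = "S \<inter> g -` chart_dom d"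
  have T: "open (chart_map c ` (?T \<inter> chart_dom c))"
    by (rule open_chart_image[OF A c continuous_open_preimage[OF g S open_chart_dom[OF B d]]])
  have "Cinf_on (chart_map c ` (?T \<inter> chart_dom c)) (\<lambda>x. chart_map d (f (chart_inv c x)))"
    by (rule smooth_onD[OF f c d]) (simp add: e)
  then have "Cinf_on (chart_map c ` (?T \<inter> chart_dom c)) (\<lambda>x. chart_map d (g (chart_inv c x)))"
    by (subst Cinf_on_cong[OF T]) (use chart_image_iff[OF A c] e in auto)
  moreover have "?T \<inter> chart_dom c = S \<inter> chart_dom c \<inter> g -` chart_dom d" by blast
  ultimately show "Cinf_on (chart_map c ` (S \<inter> chart_dom c \<inter> g -` chart_dom d)) (\<lambda>x. chart_map d (g (chart_inv c x)))"
    by simp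
qed

lemma smooth_on_compose:
  assumes A: "smooth_atlas A" and B: "smooth_atlas B" and C: "smooth_atlas C"
    and S: "open S" and T: "open T" and f: "smooth_on A B S f" and g: "smooth_on B C T g"
    and fS: "\<And>p. p \<in> S \<Longrightarrow> f p \<in> T"
  shows "smooth_on A C S (\<lambda>p. g (f p))"
proof (rule smooth_onI[OF A C S])
  have fc: "continuous_on S f" and gc: "continuous_on T g" using f g by (auto simp: smooth_on_def)
  show "continuous_on S (\<lambda>p. g (f p))"
    by (rule continuous_on_compose2[OF gc fc]) (use fS in auto)
  fix p assume p: "p \<in> S"
  obtain c where c: "c \<in> A" "p \<in> chart_dom c" using smooth_atlas_obtain_chart[OF A] .
  obtain d where d: "d \<in> B" "f p \<in> chart_dom d" using smooth_atlas_obtain_chart[OF B] .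
  obtain e where e: "e \<in> C" "g (f p) \<in> chart_dom e" using smooth_atlas_obtain_chart[OF C] .
  define T' where "T' = T \<inter> g -` chart_dom e"
  have T': "open T'" unfolding T'_def by (rule continuous_open_preimage[OF gc T open_chart_dom[OF C e(1)]])
  define S' where "S' = S \<inter> f -` (T' \<inter> chart_dom d)"
  have S': "open S'" unfolding S'_def
    by (rule continuous_open_preimage[OF fc S open_Int[OF T' open_chart_dom[OF B d(1)]]])
  let ?O = "chart_map c ` (S' \<inter> chart_dom c)"
  have O: "open ?O" by (rule open_chart_image[OF A c(1) S'])
  have S'x: "chart_inv c x \<in> S'" if "x \<in> ?O" for x using that chart_image_iff[OF A c(1)] by blast
  have 1: "Cinf_on ?O (\<lambda>x. chart_map d (f (chart_inv c x)))"
    by (rule smooth_onD[OF f c(1) d(1)]) (simp add: S'_def)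
  have 2: "Cinf_on (chart_map d ` (T' \<inter> chart_dom d)) (\<lambda>x. chart_map e (g (chart_inv d x)))"
    by (rule smooth_onD[OF g d(1) e(1)]) (simp add: T'_def)
  have "Cinf_on ?O (\<lambda>x. chart_map e (g (chart_inv d (chart_map d (f (chart_inv c x))))))"
    by (rule Cinf_on_compose[OF O open_chart_image[OF B d(1) T'] _ 1 2])
      (use S'x in \<open>simp add: S'_def\<close>)
  moreover have "chart_inv d (chart_map d (f (chart_inv c x))) = f (chart_inv c x)" if "x \<in> ?O" for x
    using S'x[OF that] chart_inv_map[OF B d(1)] by (simp add: S'_def)
  ultimately have "Cinf_on ?O (\<lambda>x. chart_map e (g (f (chart_inv c x))))"
    by (subst Cinf_on_cong[OF O, symmetric, where f = "\<lambda>x. chart_map e (g (chart_inv d (chart_map d (f (chart_inv c x)))))"]) simp_all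
  moreover have "chart_map c p \<in> ?O" using p c d e fS by (simp add: S'_def T'_def)
  ultimately show "\<exists>c\<in>A. \<exists>d\<in>C. \<exists>N. p \<in> chart_dom c \<and> g (f p) \<in> chart_dom d \<and>
      open N \<and> chart_map c p \<in> N \<and> Cinf_on N (\<lambda>x. chart_map d (g (f (chart_inv c x))))"
    using c e O by (intro bexI[OF _ c(1)] bexI[OF _ e(1)] exI conjI)
qed

lemma smooth_on_const:
  assumes A: "smooth_atlas A" and B: "smooth_atlas B" and S: "open S"
  shows "smooth_on A B S (\<lambda>_. q)"
proof (rule smooth_onI[OF A B S])
  fix p assume p: "p \<in> S"
  obtain c where c: "c \<in> A" "p \<in> chart_dom c" using smooth_atlas_obtain_chart[OF A] .
  obtain d where d: "d \<in> B" "q \<in> chart_dom d" using smooth_atlas_obtain_chart[OF B] .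
  show "\<exists>c\<in>A. \<exists>d\<in>B. \<exists>N. p \<in> chart_dom c \<and> q \<in> chart_dom d \<and>
      open N \<and> chart_map c p \<in> N \<and> Cinf_on N (\<lambda>x. chart_map d q)"
    using c d by (intro bexI[OF _ c(1)] bexI[OF _ d(1)] exI[of _ UNIV] conjI) (simp_all add: Cinf_on_const)
qed simp

subsection \<open>Model spaces, charts and products\<close>

lemma chart_inv_model [simp]: "chart_inv (UNIV, \<lambda>x. x) = (\<lambda>x. x)"
  using inv_into_f_f[of "\<lambda>x. x" UNIV] by (auto simp: chart_inv_def fun_eq_iff)

lemma charts_at_model [simp]: "charts_at model_atlas p = {(UNIV, \<lambda>x. x)}"
  by (auto simp: charts_at_def model_atlas_def)

lemma smooth_atlas_model: "smooth_atlas model_atlas"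
  unfolding smooth_atlas_def
  by (simp add: model_atlas_def o_def homeomorphism_def Cinf_on_ident
      charts_at_model[unfolded model_atlas_def])

lemma smooth_on_model: "smooth_on model_atlas model_atlas S f \<longleftrightarrow> Cinf_on S f"
  by (auto simp: smooth_on_def model_atlas_def o_def Cinf_on_continuous)

lemma smooth_on_chart_map:
  assumes "smooth_atlas A" "c \<in> A"
  shows "smooth_on A model_atlas (chart_dom c) (chart_map c)"
proof (rule smooth_onI[OF assms(1) smooth_atlas_model open_chart_dom[OF assms] continuous_chart_map[OF assms]])
  fix p assume p: "p \<in> chart_dom c"
  have "Cinf_on (chart_img c) (\<lambda>x. chart_map c (chart_inv c x))"
    using Cinf_on_ident[OF open_chart_img[OF assms]] chart_map_inv[OF assms]
    by (subst Cinf_on_cong[OF open_chart_img[OF assms]]) auto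
  then show "\<exists>ca\<in>A. \<exists>d\<in>model_atlas. \<exists>N. p \<in> chart_dom ca \<and> chart_map c p \<in> chart_dom d \<and>
      open N \<and> chart_map ca p \<in> N \<and> Cinf_on N (\<lambda>x. chart_map d (chart_map c (chart_inv ca x)))"
    using p open_chart_img[OF assms]
    by (intro bexI[OF _ assms(2)] bexI[of _ "(UNIV, \<lambda>x. x)"] exI[of _ "chart_img c"]) (auto simp: model_atlas_def)
qed

lemma smooth_on_chart_inv:
  assumes "smooth_atlas A" "c \<in> A"
  shows "smooth_on model_atlas A (chart_img c) (chart_inv c)"
proof (rule smooth_onI[OF smooth_atlas_model assms(1) open_chart_img[OF assms] continuous_chart_inv[OF assms]])
  fix x assume x: "x \<in> chart_img c"
  have "Cinf_on (chart_img c) (\<lambda>x. chart_map c (chart_inv c x))"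
    using Cinf_on_ident[OF open_chart_img[OF assms]] chart_map_inv[OF assms]
    by (subst Cinf_on_cong[OF open_chart_img[OF assms]]) auto
  then show "\<exists>ca\<in>model_atlas. \<exists>d\<in>A. \<exists>N. x \<in> chart_dom ca \<and> chart_inv c x \<in> chart_dom d \<and>
      open N \<and> chart_map ca x \<in> N \<and> Cinf_on N (\<lambda>x. chart_map d (chart_inv c (chart_inv ca x)))"
    using x open_chart_img[OF assms] chart_inv_in[OF assms]
    by (intro bexI[of _ "(UNIV, \<lambda>x. x)"] bexI[OF _ assms(2)] exI[of _ "chart_img c"]) (auto simp: model_atlas_def)
qed

text \<open>Names the members of \<open>prod_atlas\<close>, whose form as an image of pairs hides
  the two factors.\<close>

definition prod_chart :: "('m, 'e) chart \<Rightarrow> ('n, 'f) chart \<Rightarrow> ('m \<times> 'n, 'e \<times> 'f) chart" where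
  "prod_chart c d = (chart_dom c \<times> chart_dom d, map_prod (chart_map c) (chart_map d))"

lemma prod_chart_in: "c \<in> A \<Longrightarrow> d \<in> B \<Longrightarrow> prod_chart c d \<in> prod_atlas A B"
  unfolding prod_atlas_def prod_chart_def by (rule image_eqI[of _ _ "(c, d)"]) simp_all

lemma prod_atlasE:
  assumes "cd \<in> prod_atlas A B"
  obtains c d where "cd = prod_chart c d" "c \<in> A" "d \<in> B"
  using assms unfolding prod_atlas_def prod_chart_def by (fastforce simp: split_beta)

lemma prod_chart_simps [simp]:
  "chart_dom (prod_chart c d) = chart_dom c \<times> chart_dom d"
  "chart_map (prod_chart c d) z = (chart_map c (fst z), chart_map d (snd z))"
  "chart_img (prod_chart c d) = chart_img c \<times> chart_img d"
  by (auto simp: prod_chart_def map_prod_def split_beta image_iff)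

lemma chart_inv_prod_chart:
  assumes "smooth_atlas A" "smooth_atlas B" "c \<in> A" "d \<in> B" "x \<in> chart_img c" "y \<in> chart_img d"
  shows "chart_inv (prod_chart c d) (x, y) = (chart_inv c x, chart_inv d y)"
proof -
  have "inj_on (chart_map c) (chart_dom c)" "inj_on (chart_map d) (chart_dom d)"
    using chart_inv_map[OF assms(1,3)] chart_inv_map[OF assms(2,4)] by (metis inj_on_inverseI)+
  then have "inj_on (chart_map (prod_chart c d)) (chart_dom (prod_chart c d))"
    by (auto simp: prod_chart_def intro: map_prod_inj_on)
  moreover have "(chart_inv c x, chart_inv d y) \<in> chart_dom (prod_chart c d)"
    using chart_inv_in[OF assms(1,3,5)] chart_inv_in[OF assms(2,4,6)] by simp
  moreover have "chart_map (prod_chart c d) (chart_inv c x, chart_inv d y) = (x, y)"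
    using chart_map_inv[OF assms(1,3,5)] chart_map_inv[OF assms(2,4,6)] by simp
  ultimately show ?thesis unfolding chart_inv_def by (metis inv_into_f_f)
qed

lemma smooth_atlas_prod:
  assumes A: "smooth_atlas A" and B: "smooth_atlas B"
  shows "smooth_atlas (prod_atlas A B)"
  unfolding smooth_atlas_def
proof (intro conjI allI ballI)
  fix z :: "'a \<times> 'c"
  obtain c where c: "c \<in> A" "fst z \<in> chart_dom c" using smooth_atlas_obtain_chart[OF A] .
  obtain d where d: "d \<in> B" "snd z \<in> chart_dom d" using smooth_atlas_obtain_chart[OF B] .
  have "prod_chart c d \<in> charts_at (prod_atlas A B) z"
    using c d by (simp add: charts_at_iff prod_chart_in mem_Times_iff)
  then show "charts_at (prod_atlas A B) z \<noteq> {}" by blast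
next
  fix cd assume "cd \<in> prod_atlas A B"
  then obtain c d where cd: "cd = prod_chart c d" "c \<in> A" "d \<in> B" by (elim prod_atlasE)
  note a = A cd(2) and b = B cd(3)
  have dom: "chart_dom cd = chart_dom c \<times> chart_dom d" unfolding cd(1) by (rule prod_chart_simps(1))
  have img: "chart_img cd = chart_img c \<times> chart_img d" unfolding cd(1) by (rule prod_chart_simps(3))
  have map: "chart_map cd z = (chart_map c (fst z), chart_map d (snd z))" for z
    by (simp add: cd(1))
  show "open (chart_dom cd)" unfolding dom by (rule open_Times[OF open_chart_dom[OF a] open_chart_dom[OF b]])
  show "open (chart_img cd)" unfolding img by (rule open_Times[OF open_chart_img[OF a] open_chart_img[OF b]])
  note inv = chart_inv_prod_chart[OF A B cd(2,3)]
  show "homeomorphism (chart_dom cd) (chart_img cd) (chart_map cd) (chart_inv cd)"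
  proof (rule homeomorphismI)
    have "continuous_on (chart_dom c \<times> chart_dom d) (\<lambda>z. (chart_map c (fst z), chart_map d (snd z)))"
      by (intro continuous_on_Pair continuous_on_compose2[OF continuous_chart_map[OF a] continuous_on_fst]
          continuous_on_compose2[OF continuous_chart_map[OF b] continuous_on_snd] continuous_on_id) auto
    then show "continuous_on (chart_dom cd) (chart_map cd)" unfolding dom map .
    have cont: "continuous_on (chart_img cd) (\<lambda>z. (chart_inv c (fst z), chart_inv d (snd z)))" unfolding img
      by (intro continuous_on_Pair continuous_on_compose2[OF continuous_chart_inv[OF a] continuous_on_fst]
          continuous_on_compose2[OF continuous_chart_inv[OF b] continuous_on_snd] continuous_on_id) auto
    have inv': "chart_inv cd z = (chart_inv c (fst z), chart_inv d (snd z))" if "z \<in> chart_img cd" for z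
    proof -
      have "fst z \<in> chart_img c" "snd z \<in> chart_img d" using that unfolding img by auto
      from inv[OF this] show ?thesis by (simp add: cd(1))
    qed
    show "continuous_on (chart_img cd) (chart_inv cd)"
      by (rule continuous_on_eq[OF cont]) (rule inv'[symmetric])
    show "chart_map cd ` chart_dom cd \<subseteq> chart_img cd" by simp
    show "chart_inv cd ` chart_img cd \<subseteq> chart_dom cd"
    proof (rule image_subsetI)
      fix z assume z: "z \<in> chart_img cd"
      then have "fst z \<in> chart_img c" "snd z \<in> chart_img d" unfolding img by auto
      then show "chart_inv cd z \<in> chart_dom cd"
        unfolding inv'[OF z] dom using chart_inv_in[OF a] chart_inv_in[OF b] by simp
    qed
    show "chart_inv cd (chart_map cd z) = z" if z: "z \<in> chart_dom cd" for z
    proof -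
      have "chart_map cd z \<in> chart_img cd" using z by (rule imageI)
      from inv'[OF this] show ?thesis
        using z chart_inv_map[OF a] chart_inv_map[OF b] by (simp add: map dom mem_Times_iff prod_eq_iff)
    qed
    show "chart_map cd (chart_inv cd z) = z" if z: "z \<in> chart_img cd" for z
    proof -
      have "fst z \<in> chart_img c" "snd z \<in> chart_img d" using z unfolding img by auto
      then show ?thesis using chart_map_inv[OF a] chart_map_inv[OF b] by (simp add: inv'[OF z] map)
    qed
  qed
next
  fix cd cd' assume "cd \<in> prod_atlas A B" "cd' \<in> prod_atlas A B"
  then obtain c d c' d' where cd: "cd = prod_chart c d" "c \<in> A" "d \<in> B"
    and cd': "cd' = prod_chart c' d'" "c' \<in> A" "d' \<in> B" by (elim prod_atlasE)
  let ?S = "chart_map c ` (chart_dom c' \<inter> chart_dom c)" and ?T = "chart_map d ` (chart_dom d' \<inter> chart_dom d)"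
  have S: "open ?S" and T: "open ?T"
    using open_chart_image[OF A cd(2) open_chart_dom[OF A cd'(2)]]
      open_chart_image[OF B cd(3) open_chart_dom[OF B cd'(3)]] by auto
  have ST: "chart_map cd ` (chart_dom cd \<inter> chart_dom cd') = ?S \<times> ?T"
  proof -
    have "chart_dom cd \<inter> chart_dom cd' = (chart_dom c' \<inter> chart_dom c) \<times> (chart_dom d' \<inter> chart_dom d)"
      unfolding cd(1) cd'(1) prod_chart_simps(1) by blast
    then show ?thesis by (simp add: cd(1) prod_chart_def map_prod_def image_paired_Times)
  qed
  have "Cinf_on (?S \<times> ?T) (\<lambda>z. (chart_map c' (chart_inv c (fst z)), chart_map d' (chart_inv d (snd z))))"
    using S T by (intro Cinf_on_Pair open_Times Cinf_on_fst Cinf_on_snd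
        Cinf_on_compose[OF _ S _ _ Cinf_on_transition[OF A cd(2) cd'(2)]]
        Cinf_on_compose[OF _ T _ _ Cinf_on_transition[OF B cd(3) cd'(3)]]) auto
  moreover have "(chart_map cd' \<circ> chart_inv cd) z = (chart_map c' (chart_inv c (fst z)), chart_map d' (chart_inv d (snd z)))"
    if "z \<in> ?S \<times> ?T" for z
  proof -
    have "fst z \<in> chart_img c" "snd z \<in> chart_img d" using that by auto
    from chart_inv_prod_chart[OF A B cd(2,3) this] show ?thesis by (simp add: cd cd')
  qed
  ultimately show "Cinf_on (chart_map cd ` (chart_dom cd \<inter> chart_dom cd')) (chart_map cd' \<circ> chart_inv cd)"
    unfolding ST by (subst Cinf_on_cong[OF open_Times[OF S T]]) auto
qed

text \<open>Lets a pair of vector-valued maps be treated as one map into a model space.\<close>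

lemma prod_atlas_model [simp]: "prod_atlas model_atlas model_atlas = model_atlas"
  by (simp add: prod_atlas_def model_atlas_def map_prod_def split_beta id_def)

lemma smooth_on_Pair:
  assumes A: "smooth_atlas A" and B: "smooth_atlas B" and C: "smooth_atlas C" and S: "open S"
    and f: "smooth_on A B S f" and g: "smooth_on A C S g"
  shows "smooth_on A (prod_atlas B C) S (\<lambda>p. (f p, g p))"
proof (rule smooth_onI[OF A smooth_atlas_prod[OF B C] S])
  show "continuous_on S (\<lambda>p. (f p, g p))"
    using f g by (intro continuous_on_Pair smooth_on_continuous)
  fix p assume p: "p \<in> S"
  obtain c where c: "c \<in> A" "p \<in> chart_dom c" using smooth_atlas_obtain_chart[OF A] .
  obtain d where d: "d \<in> B" "f p \<in> chart_dom d" using smooth_atlas_obtain_chart[OF B] .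
  obtain e where e: "e \<in> C" "g p \<in> chart_dom e" using smooth_atlas_obtain_chart[OF C] .
  let ?T = "(S \<inter> f -` chart_dom d) \<inter> (S \<inter> g -` chart_dom e)"
  have T: "open ?T"
    by (intro open_Int continuous_open_preimage S smooth_on_continuous[OF f] smooth_on_continuous[OF g]
        open_chart_dom[OF B d(1)] open_chart_dom[OF C e(1)])
  let ?O = "chart_map c ` (?T \<inter> chart_dom c)"
  have O: "open ?O" by (rule open_chart_image[OF A c(1) T])
  have "Cinf_on ?O (\<lambda>x. (chart_map d (f (chart_inv c x)), chart_map e (g (chart_inv c x))))"
    by (intro Cinf_on_Pair O smooth_onD[OF f c(1) d(1)] smooth_onD[OF g c(1) e(1)]) auto
  then show "\<exists>c\<in>A. \<exists>d\<in>prod_atlas B C. \<exists>N. p \<in> chart_dom c \<and> (f p, g p) \<in> chart_dom d \<and>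
      open N \<and> chart_map c p \<in> N \<and> Cinf_on N (\<lambda>x. chart_map d (f (chart_inv c x), g (chart_inv c x)))"
    using c d e p O
    by (intro bexI[OF _ c(1)] bexI[of _ "prod_chart d e"] exI[of _ ?O]) (simp_all add: prod_chart_in)
qed

lemma smooth_on_fst:
  assumes A: "smooth_atlas A" and B: "smooth_atlas B"
  shows "smooth_on (prod_atlas A B) A UNIV fst"
proof (rule smooth_onI[OF smooth_atlas_prod[OF A B] A open_UNIV])
  show "continuous_on UNIV (fst :: 'a \<times> 'c \<Rightarrow> 'a)" by (intro continuous_intros)
  fix p :: "'a \<times> 'c"
  obtain c where c: "c \<in> A" "fst p \<in> chart_dom c" using smooth_atlas_obtain_chart[OF A] .
  obtain d where d: "d \<in> B" "snd p \<in> chart_dom d" using smooth_atlas_obtain_chart[OF B] .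
  have O: "open (chart_img c \<times> chart_img d)"
    by (intro open_Times open_chart_img[OF A c(1)] open_chart_img[OF B d(1)])
  have e: "fst z = chart_map c (fst (chart_inv (prod_chart c d) z))" if "z \<in> chart_img c \<times> chart_img d" for z
    using that chart_inv_prod_chart[OF A B c(1) d(1)] chart_map_inv[OF A c(1)] by (auto simp del: prod_chart_simps)
  have "Cinf_on (chart_img c \<times> chart_img d) (\<lambda>z. chart_map c (fst (chart_inv (prod_chart c d) z)))"
    using Cinf_on_fst[OF O] by (subst Cinf_on_cong[OF O e[symmetric]])
  then show "\<exists>ca\<in>prod_atlas A B. \<exists>d\<in>A. \<exists>N. p \<in> chart_dom ca \<and> fst p \<in> chart_dom d \<and>
      open N \<and> chart_map ca p \<in> N \<and> Cinf_on N (\<lambda>x. chart_map d (fst (chart_inv ca x)))"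
    using c d O by (intro bexI[of _ "prod_chart c d"] bexI[OF _ c(1)] exI[of _ "chart_img c \<times> chart_img d"])
      (simp_all add: prod_chart_in mem_Times_iff)
qed

lemma smooth_on_snd:
  assumes A: "smooth_atlas A" and B: "smooth_atlas B"
  shows "smooth_on (prod_atlas A B) B UNIV snd"
proof (rule smooth_onI[OF smooth_atlas_prod[OF A B] B open_UNIV])
  show "continuous_on UNIV (snd :: 'a \<times> 'c \<Rightarrow> 'c)" by (intro continuous_intros)
  fix p :: "'a \<times> 'c"
  obtain c where c: "c \<in> A" "fst p \<in> chart_dom c" using smooth_atlas_obtain_chart[OF A] .
  obtain d where d: "d \<in> B" "snd p \<in> chart_dom d" using smooth_atlas_obtain_chart[OF B] .
  have O: "open (chart_img c \<times> chart_img d)"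
    by (intro open_Times open_chart_img[OF A c(1)] open_chart_img[OF B d(1)])
  have e: "snd z = chart_map d (snd (chart_inv (prod_chart c d) z))" if "z \<in> chart_img c \<times> chart_img d" for z
    using that chart_inv_prod_chart[OF A B c(1) d(1)] chart_map_inv[OF B d(1)] by (auto simp del: prod_chart_simps)
  have "Cinf_on (chart_img c \<times> chart_img d) (\<lambda>z. chart_map d (snd (chart_inv (prod_chart c d) z)))"
    using Cinf_on_snd[OF O] by (subst Cinf_on_cong[OF O e[symmetric]])
  then show "\<exists>ca\<in>prod_atlas A B. \<exists>d\<in>B. \<exists>N. p \<in> chart_dom ca \<and> snd p \<in> chart_dom d \<and>
      open N \<and> chart_map ca p \<in> N \<and> Cinf_on N (\<lambda>x. chart_map d (snd (chart_inv ca x)))"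
    using c d O by (intro bexI[of _ "prod_chart c d"] bexI[OF _ d(1)] exI[of _ "chart_img c \<times> chart_img d"])
      (simp_all add: prod_chart_in mem_Times_iff)
qed

section \<open>Tangent maps\<close>

lemma smooth_on_ident:
  assumes A: "smooth_atlas A" and S: "open S"
  shows "smooth_on A A S (\<lambda>p. p)"
  unfolding smooth_on_def o_def
proof (intro conjI ballI continuous_on_id)
  fix c d assume c: "c \<in> A" and d: "d \<in> A"
  have "S \<inter> chart_dom c \<inter> (\<lambda>p. p) -` chart_dom d \<subseteq> chart_dom d \<inter> chart_dom c" by blast
  then show "Cinf_on (chart_map c ` (S \<inter> chart_dom c \<inter> (\<lambda>p. p) -` chart_dom d)) (\<lambda>x. chart_map d (chart_inv c x))"
    using Cinf_on_transition[OF A c d] Cinf_on_subset image_mono by metis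
qed

lemma smooth_on_chart_nbhd:
  assumes A: "smooth_atlas A" and B: "smooth_atlas B" and S: "open S" and f: "smooth_on A B S f"
    and p: "p \<in> S" and c: "c \<in> charts_at A p" and d: "d \<in> charts_at B (f p)"
  obtains N where "open N" "chart_map c p \<in> N" "N \<subseteq> chart_img c"
    "Cinf_on N (\<lambda>x. chart_map d (f (chart_inv c x)))"
    "\<And>x. x \<in> N \<Longrightarrow> chart_inv c x \<in> S \<and> f (chart_inv c x) \<in> chart_dom d"
proof -
  have c': "c \<in> A" "p \<in> chart_dom c" and d': "d \<in> B" "f p \<in> chart_dom d" using c d by (simp_all add: charts_at_iff)
  let ?T = "S \<inter> f -` chart_dom d"
  let ?N = "chart_map c ` (?T \<inter> chart_dom c)"
  have x: "chart_inv c x \<in> ?T" if "x \<in> ?N" for x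
    by (rule conjunct2[OF iffD1[OF chart_image_iff[OF A c'(1)] that]])
  show thesis
  proof (rule that[of ?N])
    show "open ?N" by (rule open_chart_image[OF A c'(1)
          continuous_open_preimage[OF smooth_on_continuous[OF f] S open_chart_dom[OF B d'(1)]]])
    show "chart_map c p \<in> ?N" using p c' d' by (intro imageI) simp
    show "?N \<subseteq> chart_img c" by blast
    show "Cinf_on ?N (\<lambda>x. chart_map d (f (chart_inv c x)))"
      by (rule smooth_onD[OF f c'(1) d'(1)]) simp
    show "chart_inv c x \<in> S \<and> f (chart_inv c x) \<in> chart_dom d" if "x \<in> ?N" for x
      using x[OF that] by simp
  qed
qed

lemma chart_rep_has_derivative:
  assumes A: "smooth_atlas A" and B: "smooth_atlas B" and S: "open S" and f: "smooth_on A B S f"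
    and p: "p \<in> S" and c: "c \<in> charts_at A p" and d: "d \<in> charts_at B (f p)"
  shows "((\<lambda>x. chart_map d (f (chart_inv c x))) has_derivative
    FD (\<lambda>x. chart_map d (f (chart_inv c x))) (chart_map c p)) (at (chart_map c p))"
  using smooth_on_chart_nbhd[OF assms] Cinf_on_has_derivative by metis

text \<open>The common source of the facts about tangent maps: with \<open>f\<close> or
  \<open>g\<close> the identity it gives change of charts on either side, and in general it gives
  functoriality.\<close>

lemma chart_chain:
  assumes A: "smooth_atlas A" and B: "smooth_atlas B" and C: "smooth_atlas C"
    and S: "open S" and T: "open T" and f: "smooth_on A B S f" and g: "smooth_on B C T g"
    and p: "p \<in> S" "f p \<in> T"
    and c: "c \<in> charts_at A p" and d: "d \<in> charts_at B (f p)" and e: "e \<in> charts_at C (g (f p))"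
  shows "FD (\<lambda>x. chart_map e (g (f (chart_inv c x)))) (chart_map c p) v =
    FD (\<lambda>y. chart_map e (g (chart_inv d y))) (chart_map d (f p))
      (FD (\<lambda>x. chart_map d (f (chart_inv c x))) (chart_map c p) v)"
proof -
  obtain N where N: "open N" "chart_map c p \<in> N"
    "\<And>x. x \<in> N \<Longrightarrow> chart_inv c x \<in> S \<and> f (chart_inv c x) \<in> chart_dom d"
    using smooth_on_chart_nbhd[OF A B S f p(1) c d] by metis
  have pc: "chart_inv c (chart_map c p) = p" using c chart_inv_map[OF A] by (simp add: charts_at_iff)
  have d': "d \<in> B" using d by (simp add: charts_at_iff)
  have e1: "chart_map e (g (f (chart_inv c x))) = chart_map e (g (chart_inv d (chart_map d (f (chart_inv c x)))))"
    if "x \<in> N" for x using N(3)[OF that] chart_inv_map[OF B d'] by simp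
  have "FD (\<lambda>x. chart_map e (g (f (chart_inv c x)))) (chart_map c p) v =
    FD (\<lambda>x. chart_map e (g (chart_inv d (chart_map d (f (chart_inv c x)))))) (chart_map c p) v"
    by (simp add: FD_cong[OF N(1,2) e1])
  also have "\<dots> = FD (\<lambda>y. chart_map e (g (chart_inv d y))) (chart_map d (f p))
      (FD (\<lambda>x. chart_map d (f (chart_inv c x))) (chart_map c p) v)"
    by (rule FD_compose[OF chart_rep_has_derivative[OF A B S f p(1) c d], where g = "\<lambda>y. chart_map e (g (chart_inv d y))"])
      (simp add: pc chart_rep_has_derivative[OF B C T g p(2) d e])
  finally show ?thesis .
qed

lemma transition_chain:
  assumes A: "smooth_atlas A" and c: "c \<in> charts_at A p" "d \<in> charts_at A p" "e \<in> charts_at A p"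
  shows "FD (\<lambda>x. chart_map e (chart_inv c x)) (chart_map c p) v =
    FD (\<lambda>y. chart_map e (chart_inv d y)) (chart_map d p) (FD (\<lambda>x. chart_map d (chart_inv c x)) (chart_map c p) v)"
  by (rule chart_chain[OF A A A open_UNIV open_UNIV smooth_on_ident[OF A open_UNIV] smooth_on_ident[OF A open_UNIV] UNIV_I UNIV_I c])

lemma FD_transition_self:
  assumes A: "smooth_atlas A" and c: "c \<in> charts_at A p"
  shows "FD (\<lambda>x. chart_map c (chart_inv c x)) (chart_map c p) v = v"
proof -
  have c': "c \<in> A" "p \<in> chart_dom c" using c by (simp_all add: charts_at_iff)
  have "FD (\<lambda>x. chart_map c (chart_inv c x)) (chart_map c p) = FD (\<lambda>x. x) (chart_map c p)"
    by (rule FD_cong[OF open_chart_img[OF A c'(1)]]) (use c' chart_map_inv[OF A c'(1)] in auto)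
  then show ?thesis by simp
qed

lemma tangent_spaceD:
  assumes "v \<in> tangent_space A p" "c \<in> charts_at A p" "d \<in> charts_at A p"
  shows "v d = FD (\<lambda>x. chart_map d (chart_inv c x)) (chart_map c p) (v c)"
  using assms unfolding tangent_space_def o_def by blast

lemma tangent_space_outside: "v \<in> tangent_space A p \<Longrightarrow> c \<notin> charts_at A p \<Longrightarrow> v c = 0"
  unfolding tangent_space_def by blast

lemma tangent_spaceI:
  assumes "\<And>c. c \<notin> charts_at A p \<Longrightarrow> v c = 0"
    "\<And>c d. c \<in> charts_at A p \<Longrightarrow> d \<in> charts_at A p \<Longrightarrow>
      v d = FD (\<lambda>x. chart_map d (chart_inv c x)) (chart_map c p) (v c)"
  shows "v \<in> tangent_space A p"
  using assms unfolding tangent_space_def o_def by blast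

text \<open>Transition maps recover all coordinates from those in one chart, so an equality of
  tangent vectors becomes a single equation in the model space.\<close>

lemma tangent_eqI:
  assumes "v \<in> tangent_space A p" "w \<in> tangent_space A p" "c \<in> charts_at A p" "v c = w c"
  shows "v = w"
proof
  fix d show "v d = w d"
    using tangent_spaceD[OF assms(1,3), of d] tangent_spaceD[OF assms(2,3), of d] assms(4)
      tangent_space_outside[OF assms(1), of d] tangent_space_outside[OF assms(2), of d]
    by (cases "d \<in> charts_at A p") simp_all
qed

lemma tvec_of_app: "d \<in> charts_at A p \<Longrightarrow>
    tvec_of A p c x d = FD (\<lambda>x. chart_map d (chart_inv c x)) (chart_map c p) x"
  by (simp add: tvec_of_def o_def)

lemma tvec_of_self: "smooth_atlas A \<Longrightarrow> c \<in> charts_at A p \<Longrightarrow> tvec_of A p c x c = x"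
  by (simp add: tvec_of_app FD_transition_self)

lemma tvec_of_in:
  assumes A: "smooth_atlas A" and c: "c \<in> charts_at A p"
  shows "tvec_of A p c x \<in> tangent_space A p"
proof (rule tangent_spaceI)
  show "tvec_of A p c x d = 0" if "d \<notin> charts_at A p" for d using that by (simp add: tvec_of_def)
  show "tvec_of A p c x e = FD (\<lambda>x. chart_map e (chart_inv d x)) (chart_map d p) (tvec_of A p c x d)"
    if "d \<in> charts_at A p" "e \<in> charts_at A p" for d e
    unfolding tvec_of_app[OF that(1)] tvec_of_app[OF that(2)] by (rule transition_chain[OF A c that])
qed

lemma tangent_eq_tvec_of:
  assumes A: "smooth_atlas A" and v: "v \<in> tangent_space A p" and c: "c \<in> charts_at A p"
  shows "v = tvec_of A p c (v c)"
  by (rule tangent_eqI[OF v tvec_of_in[OF A c] c]) (simp add: tvec_of_self[OF A c])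

lemma FD_transition_linear:
  assumes A: "smooth_atlas A" and c: "c \<in> charts_at A p" "d \<in> charts_at A p"
  shows "linear (FD (\<lambda>x. chart_map d (chart_inv c x)) (chart_map c p))"
  by (rule has_derivative_linear[OF chart_rep_has_derivative[OF A A open_UNIV smooth_on_ident[OF A open_UNIV] UNIV_I c]])

lemma tadd_in:
  assumes A: "smooth_atlas A" and v: "v \<in> tangent_space A p" "w \<in> tangent_space A p"
  shows "tadd v w \<in> tangent_space A p"
proof (rule tangent_spaceI)
  show "tadd v w c = 0" if "c \<notin> charts_at A p" for c
    using tangent_space_outside[OF v(1) that] tangent_space_outside[OF v(2) that] by (simp add: tadd_def)
  show "tadd v w d = FD (\<lambda>x. chart_map d (chart_inv c x)) (chart_map c p) (tadd v w c)"
    if "c \<in> charts_at A p" "d \<in> charts_at A p" for c d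
    using tangent_spaceD[OF v(1) that] tangent_spaceD[OF v(2) that] linear_add[OF FD_transition_linear[OF A that]]
    by (simp add: tadd_def)
qed

lemma tscale_in:
  assumes A: "smooth_atlas A" and v: "v \<in> tangent_space A p"
  shows "tscale r v \<in> tangent_space A p"
proof (rule tangent_spaceI)
  show "tscale r v c = 0" if "c \<notin> charts_at A p" for c
    using tangent_space_outside[OF v(1) that] by (simp add: tscale_def)
  show "tscale r v d = FD (\<lambda>x. chart_map d (chart_inv c x)) (chart_map c p) (tscale r v c)"
    if "c \<in> charts_at A p" "d \<in> charts_at A p" for c d
    using tangent_spaceD[OF v(1) that] linear_scale[OF FD_transition_linear[OF A that]]
    by (simp add: tscale_def)
qed

text \<open>Any chart around \<open>p\<close> may replace the one selected by \<open>SOME\<close> in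
  \<open>tangent_map\<close>: the transition map that changes the representative of \<open>f\<close>
  also changes the coordinates of \<open>v\<close>, and the two effects compensate.\<close>

lemma tangent_map_app:
  assumes A: "smooth_atlas A" and B: "smooth_atlas B" and S: "open S" and f: "smooth_on A B S f"
    and p: "p \<in> S" and v: "v \<in> tangent_space A p" and c: "c \<in> charts_at A p" and d: "d \<in> charts_at B (f p)"
  shows "tangent_map A B f p v d = FD (\<lambda>x. chart_map d (f (chart_inv c x))) (chart_map c p) (v c)"
proof -
  define c0 where "c0 = (SOME c. c \<in> charts_at A p)"
  have c0: "c0 \<in> charts_at A p" unfolding c0_def by (rule someI[of "\<lambda>c. c \<in> charts_at A p", OF c])
  have "tangent_map A B f p v d = FD (\<lambda>x. chart_map d (f (chart_inv c0 x))) (chart_map c0 p) (v c0)"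
    using d by (simp add: tangent_map_def Let_def c0_def[symmetric] o_def)
  also have "v c0 = FD (\<lambda>x. chart_map c0 (chart_inv c x)) (chart_map c p) (v c)"
    by (rule tangent_spaceD[OF v c c0])
  also have "FD (\<lambda>x. chart_map d (f (chart_inv c0 x))) (chart_map c0 p) \<dots> =
      FD (\<lambda>x. chart_map d (f (chart_inv c x))) (chart_map c p) (v c)"
    by (rule chart_chain[OF A A B S S smooth_on_ident[OF A S] f p p c c0 d, symmetric])
  finally show ?thesis .
qed

lemma tangent_map_outside: "d \<notin> charts_at B (f p) \<Longrightarrow> tangent_map A B f p v d = 0"
  by (simp add: tangent_map_def Let_def)

lemma tangent_map_in:
  assumes A: "smooth_atlas A" and B: "smooth_atlas B" and S: "open S" and f: "smooth_on A B S f"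
    and p: "p \<in> S" and v: "v \<in> tangent_space A p"
  shows "tangent_map A B f p v \<in> tangent_space B (f p)"
proof (rule tangent_spaceI)
  show "tangent_map A B f p v d = 0" if "d \<notin> charts_at B (f p)" for d using that by (rule tangent_map_outside)
  obtain c where "c \<in> A" "p \<in> chart_dom c" using smooth_atlas_obtain_chart[OF A] .
  then have c: "c \<in> charts_at A p" by (simp add: charts_at_iff)
  fix d e assume d: "d \<in> charts_at B (f p)" and e: "e \<in> charts_at B (f p)"
  show "tangent_map A B f p v e = FD (\<lambda>x. chart_map e (chart_inv d x)) (chart_map d (f p)) (tangent_map A B f p v d)"
    unfolding tangent_map_app[OF A B S f p v c d] tangent_map_app[OF A B S f p v c e]
    by (rule chart_chain[OF A B B S open_UNIV f smooth_on_ident[OF B open_UNIV] p UNIV_I c d e])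
qed

lemma tangent_map_compose:
  assumes A: "smooth_atlas A" and B: "smooth_atlas B" and C: "smooth_atlas C"
    and S: "open S" and T: "open T" and f: "smooth_on A B S f" and g: "smooth_on B C T g"
    and fS: "\<And>p. p \<in> S \<Longrightarrow> f p \<in> T" and p: "p \<in> S" and v: "v \<in> tangent_space A p"
  shows "tangent_map A C (\<lambda>p. g (f p)) p v = tangent_map B C g (f p) (tangent_map A B f p v)"
proof
  fix e
  obtain c where "c \<in> A" "p \<in> chart_dom c" using smooth_atlas_obtain_chart[OF A] .
  then have c: "c \<in> charts_at A p" by (simp add: charts_at_iff)
  obtain d where "d \<in> B" "f p \<in> chart_dom d" using smooth_atlas_obtain_chart[OF B] .
  then have d: "d \<in> charts_at B (f p)" by (simp add: charts_at_iff)
  show "tangent_map A C (\<lambda>p. g (f p)) p v e = tangent_map B C g (f p) (tangent_map A B f p v) e"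
  proof (cases "e \<in> charts_at C (g (f p))")
    case e: True
    have gf: "smooth_on A C S (\<lambda>p. g (f p))" by (rule smooth_on_compose[OF A B C S T f g]) (rule fS)
    show ?thesis
      unfolding tangent_map_app[OF A C S gf p v c e]
        tangent_map_app[OF B C T g fS[OF p] tangent_map_in[OF A B S f p v] d e] tangent_map_app[OF A B S f p v c d]
      by (rule chart_chain[OF A B C S T f g p fS[OF p] c d e])
  qed (simp add: tangent_map_outside)
qed

lemma tangent_map_linear:
  assumes A: "smooth_atlas A" and B: "smooth_atlas B" and S: "open S" and f: "smooth_on A B S f" and p: "p \<in> S"
  shows tangent_map_tadd: "v \<in> tangent_space A p \<Longrightarrow> w \<in> tangent_space A p \<Longrightarrow>
      tangent_map A B f p (tadd v w) = tadd (tangent_map A B f p v) (tangent_map A B f p w)"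
    and tangent_map_tscale: "v \<in> tangent_space A p \<Longrightarrow>
      tangent_map A B f p (tscale r v) = tscale r (tangent_map A B f p v)"
proof -
  obtain c where "c \<in> A" "p \<in> chart_dom c" using smooth_atlas_obtain_chart[OF A] .
  then have c: "c \<in> charts_at A p" by (simp add: charts_at_iff)
  note app = tangent_map_app[OF A B S f p _ c]
  note lin = has_derivative_linear[OF chart_rep_has_derivative[OF A B S f p c]]
  show "tangent_map A B f p (tadd v w) = tadd (tangent_map A B f p v) (tangent_map A B f p w)"
    if v: "v \<in> tangent_space A p" and w: "w \<in> tangent_space A p"
  proof
    fix d show "tangent_map A B f p (tadd v w) d = tadd (tangent_map A B f p v) (tangent_map A B f p w) d"
      using app[OF tadd_in[OF A v w], of d] app[OF v, of d] app[OF w, of d] linear_add[OF lin, of d]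
        tangent_map_outside[of d B f p A]
      by (cases "d \<in> charts_at B (f p)") (simp_all add: tadd_def)
  qed
  show "tangent_map A B f p (tscale r v) = tscale r (tangent_map A B f p v)" if v: "v \<in> tangent_space A p"
  proof
    fix d show "tangent_map A B f p (tscale r v) d = tscale r (tangent_map A B f p v) d"
      using app[OF tscale_in[OF A v], of d r] app[OF v, of d] linear_scale[OF lin, of d]
        tangent_map_outside[of d B f p A]
      by (cases "d \<in> charts_at B (f p)") (simp_all add: tscale_def)
  qed
qed

subsection \<open>Images of vectors under maps from a model space\<close>

text \<open>The tangent map of a parametrisation \<open>P\<close>, with plain vectors in place of
  the families that encode tangent vectors of the model space. Computations on manifolds are carried
  out on such vectors.\<close>

definition pushv :: "('m, 'e::real_normed_vector) chart set \<Rightarrow> ('a::real_normed_vector \<Rightarrow> 'm) \<Rightarrow>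
    'a \<Rightarrow> 'a \<Rightarrow> ('m, 'e) tvec" where
  "pushv B P y w = (\<lambda>d. if d \<in> charts_at B (P y) then FD (\<lambda>x. chart_map d (P x)) y w else 0)"

lemma model_chart_at: "(UNIV, \<lambda>x. x) \<in> charts_at model_atlas p"
  by simp

lemma pushv_has_derivative:
  fixes P :: "'a::fin_dim_inner \<Rightarrow> 'm::topological_space"
  assumes B: "smooth_atlas B" and S: "open S" and P: "smooth_on model_atlas B S P" and y: "y \<in> S"
    and d: "d \<in> charts_at B (P y)"
  shows "((\<lambda>x. chart_map d (P x)) has_derivative FD (\<lambda>x. chart_map d (P x)) y) (at y)"
  using chart_rep_has_derivative[OF smooth_atlas_model B S P y model_chart_at d] by simp

lemma pushv_Cinf:
  assumes B: "smooth_atlas B" and P: "smooth_on model_atlas B S P" and d: "d \<in> B"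
    and T: "T \<subseteq> S" "\<And>y. y \<in> T \<Longrightarrow> P y \<in> chart_dom d"
  shows "Cinf_on T (\<lambda>x. chart_map d (P x))"
  using smooth_onD[OF P, of "(UNIV, \<lambda>x. x)" d T] d T by (auto simp: model_atlas_def)

lemma pushv_in:
  fixes P :: "'a::fin_dim_inner \<Rightarrow> 'm::topological_space"
  assumes B: "smooth_atlas B" and S: "open S" and P: "smooth_on model_atlas B S P" and y: "y \<in> S"
  shows "pushv B P y w \<in> tangent_space B (P y)"
proof (rule tangent_spaceI)
  show "pushv B P y w d = 0" if "d \<notin> charts_at B (P y)" for d using that by (simp add: pushv_def)
  fix d e assume d: "d \<in> charts_at B (P y)" and e: "e \<in> charts_at B (P y)"
  show "pushv B P y w e = FD (\<lambda>x. chart_map e (chart_inv d x)) (chart_map d (P y)) (pushv B P y w d)"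
    using chart_chain[OF smooth_atlas_model B B S open_UNIV P smooth_on_ident[OF B open_UNIV] y UNIV_I model_chart_at d e] d e
    by (simp add: pushv_def)
qed

lemma tangent_map_pushv:
  fixes P :: "'a::fin_dim_inner \<Rightarrow> 'm::topological_space"
  assumes B: "smooth_atlas B" and C: "smooth_atlas C" and S: "open S" and P: "smooth_on model_atlas B S P"
    and y: "y \<in> S" and T: "open T" and g: "smooth_on B C T g" and Py: "P y \<in> T"
  shows "tangent_map B C g (P y) (pushv B P y w) = pushv C (\<lambda>x. g (P x)) y w"
proof
  fix e
  obtain d where "d \<in> B" "P y \<in> chart_dom d" using smooth_atlas_obtain_chart[OF B] .
  then have d: "d \<in> charts_at B (P y)" by (simp add: charts_at_iff)
  show "tangent_map B C g (P y) (pushv B P y w) e = pushv C (\<lambda>x. g (P x)) y w e"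
  proof (cases "e \<in> charts_at C (g (P y))")
    case e: True
    show ?thesis
      unfolding tangent_map_app[OF B C T g Py pushv_in[OF B S P y] d e]
      using chart_chain[OF smooth_atlas_model B C S T P g y Py model_chart_at d e] d e
      by (simp add: pushv_def)
  qed (simp add: tangent_map_outside pushv_def)
qed

lemma pushv_chain:
  fixes P :: "'a::fin_dim_inner \<Rightarrow> 'm::topological_space"
  assumes B: "smooth_atlas B" and S: "open S" and P: "smooth_on model_atlas B S P" and y: "h z \<in> S"
    and h: "(h has_derivative h') (at z)"
  shows "pushv B (\<lambda>z. P (h z)) z u = pushv B P (h z) (h' u)"
proof
  fix d show "pushv B (\<lambda>z. P (h z)) z u d = pushv B P (h z) (h' u) d"
    using FD_compose[OF h pushv_has_derivative[OF B S P y, of d]]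
    by (cases "d \<in> charts_at B (P (h z))") (simp_all add: pushv_def)
qed

lemma velocity_eq_pushv:
  fixes P :: "'a::fin_dim_inner \<Rightarrow> 'm::topological_space"
  assumes B: "smooth_atlas B" and S: "open S" and P: "smooth_on model_atlas B S P" and y: "h t \<in> S"
    and h: "(h has_vector_derivative h') (at t)"
  shows "velocity B (\<lambda>t. P (h t)) t = pushv B P (h t) h'"
proof
  fix d show "velocity B (\<lambda>t. P (h t)) t d = pushv B P (h t) h' d"
  proof (cases "d \<in> charts_at B (P (h t))")
    case d: True
    note D = pushv_has_derivative[OF B S P y d]
    have "((\<lambda>t. chart_map d (P (h t))) has_derivative (\<lambda>s. FD (\<lambda>x. chart_map d (P x)) (h t) (s *\<^sub>R h'))) (at t)"
      by (rule has_derivative_compose[OF h[unfolded has_vector_derivative_def] D])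
    then have "((\<lambda>t. chart_map d (P (h t))) has_vector_derivative FD (\<lambda>x. chart_map d (P x)) (h t) h') (at t)"
      unfolding has_vector_derivative_def by (simp add: linear_scale[OF has_derivative_linear[OF D]])
    from vector_derivative_at[OF this] show ?thesis using d by (simp add: velocity_def pushv_def o_def)
  qed (simp add: velocity_def pushv_def)
qed

lemma pushv_linear:
  fixes P :: "'a::fin_dim_inner \<Rightarrow> 'm::topological_space"
  assumes B: "smooth_atlas B" and S: "open S" and P: "smooth_on model_atlas B S P" and y: "y \<in> S"
  shows pushv_add: "pushv B P y (v + w) = tadd (pushv B P y v) (pushv B P y w)"
    and pushv_diff: "pushv B P y (v - w) = tdiff (pushv B P y v) (pushv B P y w)"
    and pushv_scale: "pushv B P y (r *\<^sub>R v) = tscale r (pushv B P y v)"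
proof -
  note lin = has_derivative_linear[OF pushv_has_derivative[OF B S P y]]
  show "pushv B P y (v + w) = tadd (pushv B P y v) (pushv B P y w)"
  proof
    fix d show "(pushv B P y (v + w)) d = (tadd (pushv B P y v) (pushv B P y w)) d" by (simp add: pushv_def tadd_def linear_add[OF lin])
  qed
  show "pushv B P y (v - w) = tdiff (pushv B P y v) (pushv B P y w)"
  proof
    fix d show "(pushv B P y (v - w)) d = (tdiff (pushv B P y v) (pushv B P y w)) d" by (simp add: pushv_def tdiff_def linear_diff[OF lin])
  qed
  show "pushv B P y (r *\<^sub>R v) = tscale r (pushv B P y v)"
  proof
    fix d show "(pushv B P y (r *\<^sub>R v)) d = (tscale r (pushv B P y v)) d" by (simp add: pushv_def tscale_def linear_scale[OF lin])
  qed
qed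

lemma pushv_cong:
  fixes B :: "('m, 'e::real_normed_vector) chart set"
  assumes "open N" "y \<in> N" "\<And>x. x \<in> N \<Longrightarrow> P x = P' x"
  shows "pushv B P y w = pushv B P' y w"
proof
  fix d :: "('m, 'e) chart"
  have "FD (\<lambda>x. chart_map d (P x)) y = FD (\<lambda>x. chart_map d (P' x)) y"
    by (rule FD_cong[OF assms(1,2)]) (simp add: assms(3))
  then show "pushv B P y w d = pushv B P' y w d" using assms(2,3) by (simp add: pushv_def)
qed

lemma tvec_of_eq_pushv:
  assumes A: "smooth_atlas A" and c: "c \<in> charts_at A p"
  shows "tvec_of A p c x = pushv A (chart_inv c) (chart_map c p) x"
  using c chart_inv_map[OF A] by (auto simp: tvec_of_def pushv_def charts_at_iff o_def)

lemma tangent_eq_pushv: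
  assumes A: "smooth_atlas A" and v: "v \<in> tangent_space A p" and c: "c \<in> charts_at A p"
  shows "v = pushv A (chart_inv c) (chart_map c p) (v c)"
  using tangent_eq_tvec_of[OF A v c] tvec_of_eq_pushv[OF A c] by simp

lemma pushv_model: "pushv model_atlas f y w = (\<lambda>d. if d = (UNIV, \<lambda>x. x) then FD f y w else 0)"
  by (auto simp: pushv_def)

text \<open>An application of \<open>bracket_related\<close> to \<open>P\<close> read in each chart.
  \<open>P\<close> is any smooth map, not a chart, as is required for the fibre coordinates
  introduced later. Differentiability of the fields in charts is demanded because
  \<open>frechet_derivative\<close> is otherwise meaningless.\<close>

lemma lie_bracket_pushv:
  fixes P :: "'a::fin_dim_inner \<Rightarrow> 'm::topological_space"
  assumes A: "smooth_atlas A" and S: "open S" and P: "smooth_on model_atlas A S P" and y: "y \<in> S"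
    and XY: "X differentiable (at y)" "Y differentiable (at y)"
    and ZW: "\<And>c. c \<in> charts_at A (P y) \<Longrightarrow> (\<lambda>x. Z (chart_inv c x) c) differentiable (at (chart_map c (P y)))"
      "\<And>c. c \<in> charts_at A (P y) \<Longrightarrow> (\<lambda>x. W (chart_inv c x) c) differentiable (at (chart_map c (P y)))"
    and rel: "\<And>z. z \<in> S \<Longrightarrow> Z (P z) = pushv A P z (X z)" "\<And>z. z \<in> S \<Longrightarrow> W (P z) = pushv A P z (Y z)"
  shows "lie_bracket A Z W (P y) = pushv A P y (FD Y y (X y) - FD X y (Y y))"
proof
  fix c show "lie_bracket A Z W (P y) c = pushv A P y (FD Y y (X y) - FD X y (Y y)) c"
  proof (cases "c \<in> charts_at A (P y)")
    case c: True
    then have c': "c \<in> A" "P y \<in> chart_dom c" by (simp_all add: charts_at_iff)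
    let ?f = "\<lambda>x. chart_map c (P x)"
    let ?N = "S \<inter> P -` chart_dom c"
    have N: "open ?N" "y \<in> ?N"
      using continuous_open_preimage[OF smooth_on_continuous[OF P] S open_chart_dom[OF A c'(1)]] y c' by auto
    have f: "Cinf_on ?N ?f" by (rule pushv_Cinf[OF A P c'(1)]) auto
    have r: "Z (chart_inv c (?f z)) c = FD ?f z (X z)" "W (chart_inv c (?f z)) c = FD ?f z (Y z)" if z: "z \<in> ?N" for z
    proof -
      have "z \<in> S" "c \<in> charts_at A (P z)" "chart_inv c (?f z) = P z"
        using z c' chart_inv_map[OF A c'(1)] by (auto simp: charts_at_iff)
      then show "Z (chart_inv c (?f z)) c = FD ?f z (X z)" "W (chart_inv c (?f z)) c = FD ?f z (Y z)"
        using rel by (simp_all add: pushv_def)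
    qed
    have "FD (\<lambda>x. W (chart_inv c x) c) (?f y) (Z (chart_inv c (?f y)) c) - FD (\<lambda>x. Z (chart_inv c x) c) (?f y) (W (chart_inv c (?f y)) c)
      = FD ?f y (FD Y y (X y) - FD X y (Y y))"
      by (rule bracket_related[OF N f XY ZW(1)[OF c] ZW(2)[OF c], OF r])
    then show ?thesis using c chart_inv_map[OF A c'] by (simp add: lie_bracket_def pushv_def)
  qed (simp add: lie_bracket_def pushv_def)
qed

lemma vector_field_eq_pushv:
  assumes A: "smooth_atlas A" and X: "smooth_vector_field A X" and c: "c \<in> A" "x \<in> chart_img c"
  shows "X (chart_inv c x) = pushv A (chart_inv c) x (X (chart_inv c x) c)"
proof -
  have "c \<in> charts_at A (chart_inv c x)" using chart_inv_in[OF A c] c by (simp add: charts_at_iff)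
  moreover have "X (chart_inv c x) \<in> tangent_space A (chart_inv c x)"
    using X by (simp add: smooth_vector_field_def)
  ultimately show ?thesis using tangent_eq_pushv[OF A] chart_map_inv[OF A c] by metis
qed

lemma vector_field_Cinf: "smooth_vector_field A X \<Longrightarrow> c \<in> A \<Longrightarrow> Cinf_on (chart_img c) (\<lambda>x. X (chart_inv c x) c)"
  by (simp add: smooth_vector_field_def)

lemma lie_bracket_chart:
  assumes A: "smooth_atlas A" and X: "smooth_vector_field A X" and Y: "smooth_vector_field A Y"
    and c: "c \<in> charts_at A p"
  shows "lie_bracket A X Y p = pushv A (chart_inv c) (chart_map c p)
    (FD (\<lambda>x. Y (chart_inv c x) c) (chart_map c p) (X p c) - FD (\<lambda>x. X (chart_inv c x) c) (chart_map c p) (Y p c))"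
proof -
  have c': "c \<in> A" "p \<in> chart_dom c" using c by (simp_all add: charts_at_iff)
  have p: "chart_inv c (chart_map c p) = p" by (rule chart_inv_map[OF A c'])
  have d: "(\<lambda>x. X (chart_inv d x) d) differentiable (at (chart_map d p))"
    if "smooth_vector_field A X" "d \<in> charts_at A p" for X d
    using that by (intro differentiableI[OF Cinf_on_has_derivative[OF vector_field_Cinf]]) (auto simp: charts_at_iff)
  show ?thesis
    using lie_bracket_pushv[OF A open_chart_img[OF A c'(1)] smooth_on_chart_inv[OF A c'(1)] _ d[OF X c] d[OF Y c],
        of X Y] vector_field_eq_pushv[OF A X c'(1)] vector_field_eq_pushv[OF A Y c'(1)] d[OF X] d[OF Y] c'
    unfolding p by blast
qed

section \<open>The exponential map of an abelian Lie group\<close>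

lemma funpow_double_add: "((\<lambda>g::'g::ab_group_add. g + g) ^^ n) (a + b) = ((\<lambda>g. g + g) ^^ n) a + ((\<lambda>g. g + g) ^^ n) b"
  by (induction n) (simp_all add: ac_simps)

text \<open>Iterated doubling stands for multiplication by \<open>2 ^ n\<close>. The values near the
  origin thus determine an additive map everywhere.\<close>

lemma additive_halving:
  fixes f :: "'k::real_vector \<Rightarrow> 'g::ab_group_add"
  assumes "\<And>v w. f (v + w) = f v + f w"
  shows "f v = ((\<lambda>g. g + g) ^^ n) (f ((1 / 2 ^ n) *\<^sub>R v))"
proof (induction n)
  case (Suc n)
  have "(1 / 2 ^ n) *\<^sub>R v = (1 / 2 ^ Suc n) *\<^sub>R v + (1 / 2 ^ Suc n) *\<^sub>R v"
    by (simp flip: scaleR_add_left)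
  then have "f ((1 / 2 ^ n) *\<^sub>R v) = f ((1 / 2 ^ Suc n) *\<^sub>R v) + f ((1 / 2 ^ Suc n) *\<^sub>R v)"
    using assms by metis
  with Suc show ?case by (simp add: funpow_Suc_right del: funpow.simps)
qed simp

lemma additive_eq_if_near:
  fixes f g :: "'k::real_normed_vector \<Rightarrow> 'g::ab_group_add"
  assumes f: "\<And>v w. f (v + w) = f v + f w" and g: "\<And>v w. g (v + w) = g v + g w"
    and d: "d > 0" "\<And>v. norm v < d \<Longrightarrow> f v = g v"
  shows "f = g"
proof
  fix v :: 'k
  obtain n where n: "norm v / d < 2 ^ n" using real_arch_pow[of 2] by auto
  then have "norm ((1 / 2 ^ n) *\<^sub>R v) < d" using d(1) by (simp add: field_simps)
  from d(2)[OF this] show "f v = g v"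
    using additive_halving[of f, OF f] additive_halving[of g, OF g] by metis
qed

text \<open>The extension is \<open>2 ^ n\<close> times the value at \<open>v\<close> divided by
  \<open>2 ^ n\<close>; local additivity makes this independent of \<open>n\<close> as soon as the
  quotient lies in the ball.\<close>

lemma local_additive_extend:
  fixes f :: "'k::real_normed_vector \<Rightarrow> 'g::ab_group_add"
  assumes d: "d > 0"
    and f: "\<And>v w. norm v < d \<Longrightarrow> norm w < d \<Longrightarrow> norm (v + w) < d \<Longrightarrow> f (v + w) = f v + f w"
  obtains F where "\<And>v w. F (v + w) = F v + F w" "\<And>v. norm v < d \<Longrightarrow> F v = f v"
proof -
  define s where "s n v = ((\<lambda>g. g + g) ^^ n) (f ((1 / 2 ^ n) *\<^sub>R v))" for n :: nat and v
  have stp: "s (Suc n) v = s n v" if "norm v < d * 2 ^ n" for n v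
  proof -
    have e: "(1 / 2 ^ n) *\<^sub>R v = (1 / 2 ^ Suc n) *\<^sub>R v + (1 / 2 ^ Suc n) *\<^sub>R v"
      by (simp flip: scaleR_add_left)
    have n1: "norm ((1 / 2 ^ n) *\<^sub>R v) < d" using that by (simp add: field_simps)
    have "norm ((1 / 2 ^ Suc n) *\<^sub>R v) = norm ((1 / 2 ^ n) *\<^sub>R v) / 2" by simp
    with n1 have n2: "norm ((1 / 2 ^ Suc n) *\<^sub>R v) < d" using norm_ge_zero[of "(1 / 2 ^ n) *\<^sub>R v"] by linarith
    have "f ((1 / 2 ^ n) *\<^sub>R v) = f ((1 / 2 ^ Suc n) *\<^sub>R v) + f ((1 / 2 ^ Suc n) *\<^sub>R v)"
      unfolding e by (rule f[OF n2 n2]) (use n1 e in simp)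
    then show ?thesis by (simp add: s_def funpow_Suc_right del: funpow.simps)
  qed
  have const: "s m v = s n v" if "n \<le> m" "norm v < d * 2 ^ n" for m n v
    using that(1)
  proof (induction m rule: dec_induct)
    case (step m)
    have "d * 2 ^ n \<le> d * 2 ^ m" using step(1) d by simp
    then show ?case using stp[of v m] that(2) step(3) by simp
  qed simp
  have ex: "\<exists>n. norm v < d * 2 ^ n" for v :: 'k
  proof -
    obtain n where "norm v / d < 2 ^ n" using real_arch_pow[of 2] by auto
    then show ?thesis using d by (intro exI[of _ n]) (simp add: field_simps)
  qed
  define N where "N v = (SOME n. norm v < d * 2 ^ n)" for v :: 'k
  have N: "norm v < d * 2 ^ N v" for v unfolding N_def by (rule someI_ex[OF ex])
  define F where "F v = s (N v) v" for v
  have F: "F v = s n v" if "norm v < d * 2 ^ n" for v n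
    using const[of "N v" "max n (N v)" v] const[of n "max n (N v)" v] N[of v] that by (simp add: F_def)
  show thesis
  proof (rule that[of F])
    show "F v = f v" if "norm v < d" for v using F[of v 0] that by (simp add: s_def)
    fix v w :: 'k
    \<comment> \<open>One exponent has to serve \<open>v\<close>, \<open>w\<close> and
      \<open>v + w\<close> before additivity on the ball can be used.\<close>
    define n where "n = max (N v) (max (N w) (N (v + w)))"
    have le: "norm u < d * 2 ^ n" if "N u \<le> n" for u :: 'k
    proof -
      have "d * 2 ^ N u \<le> d * 2 ^ n" using that d by simp
      then show ?thesis using N[of u] by simp
    qed
    have v: "norm v < d * 2 ^ n" and w: "norm w < d * 2 ^ n" and vw: "norm (v + w) < d * 2 ^ n"
      using le by (simp_all add: n_def)
    have small: "norm ((1 / 2 ^ n) *\<^sub>R u) < d" if "norm u < d * 2 ^ n" for u :: 'k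
      using that by (simp add: field_simps)
    have "f ((1 / 2 ^ n) *\<^sub>R (v + w)) = f ((1 / 2 ^ n) *\<^sub>R v) + f ((1 / 2 ^ n) *\<^sub>R w)"
      unfolding scaleR_add_right using small[OF vw] by (intro f small v w) (simp add: scaleR_add_right)
    then have "s n (v + w) = s n v + s n w" by (simp add: s_def funpow_double_add)
    then show "F (v + w) = F v + F w" using F[OF v] F[OF w] F[OF vw] by simp
  qed
qed

lemma FD_Pair_right:
  assumes "(F has_derivative F') (at (a, b))"
  shows "FD (\<lambda>y. F (a, y)) b w = F' (0, w)"
proof -
  have "((\<lambda>y. (a, y)) has_derivative (\<lambda>h. (0, h))) (at b)" by (auto intro!: derivative_eq_intros)
  from FD_compose[OF this assms] show ?thesis .
qed

lemma FD_Pair_left: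
  assumes "(F has_derivative F') (at (a, b))"
  shows "FD (\<lambda>y. F (y, b)) a w = F' (w, 0)"
proof -
  have "((\<lambda>y. (y, b)) has_derivative (\<lambda>h. (h, 0))) (at a)" by (auto intro!: derivative_eq_intros)
  from FD_compose[OF this assms] show ?thesis .
qed

section \<open>The invariant frame and the Maurer-Cartan form\<close>

locale abelian_lie =
  fixes AG :: "('g::{t2_space,second_countable_topology,ab_group_add}, 'k::fin_dim_inner) chart set"
  assumes lie: "abelian_lie_group AG"
begin

lemma AG: "smooth_atlas AG"
  using lie by (simp add: abelian_lie_group_def smooth_manifold_imp_smooth_atlas)

lemma smooth_on_plus:
  assumes A: "smooth_atlas A" and S: "open S" and f: "smooth_on A AG S f" and g: "smooth_on A AG S g"
  shows "smooth_on A AG S (\<lambda>p. f p + g p)"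
proof -
  have "smooth_on (prod_atlas AG AG) AG UNIV (\<lambda>(g, h). g + h)" using lie by (simp add: abelian_lie_group_def)
  from smooth_on_compose[OF A smooth_atlas_prod[OF AG AG] AG S open_UNIV smooth_on_Pair[OF A AG AG S f g] this]
  show ?thesis by simp
qed

lemma smooth_on_uminus:
  assumes A: "smooth_atlas A" and S: "open S" and f: "smooth_on A AG S f"
  shows "smooth_on A AG S (\<lambda>p. - f p)"
proof -
  have "smooth_on AG AG UNIV uminus" using lie by (simp add: abelian_lie_group_def)
  from smooth_on_compose[OF A AG AG S open_UNIV f this] show ?thesis by simp
qed

lemma smooth_on_minus:
  assumes A: "smooth_atlas A" and S: "open S" and f: "smooth_on A AG S f" and g: "smooth_on A AG S g"
  shows "smooth_on A AG S (\<lambda>p. f p - g p)"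
  using smooth_on_plus[OF A S f smooth_on_uminus[OF A S g]] by simp

lemma smooth_on_translate: "open S \<Longrightarrow> smooth_on AG AG S (\<lambda>h. a + h)"
  by (rule smooth_on_plus[OF AG _ smooth_on_const[OF AG AG] smooth_on_ident[OF AG]])

lemma continuous_translate: "continuous_on S (\<lambda>h. a + h)" for a :: 'g
  using smooth_on_continuous[OF smooth_on_translate[OF open_UNIV]] continuous_on_subset by blast

text \<open>A chart around the identity, fixed once; its coordinates identify the Lie algebra with
  \<open>'k\<close>.\<close>

definition gc :: "('g, 'k) chart" where "gc = (SOME c. c \<in> charts_at AG 0)"

lemma gc_at: "gc \<in> charts_at AG 0"
proof -
  have "charts_at AG 0 \<noteq> {}" using AG by (simp add: smooth_atlas_def)
  then show ?thesis unfolding gc_def by (rule some_in_eq[THEN iffD2])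
qed

lemma gc_in: "gc \<in> AG" and gc_0: "0 \<in> chart_dom gc"
  using gc_at by (simp_all add: charts_at_iff)

abbreviation gm :: "'g \<Rightarrow> 'k" where "gm \<equiv> chart_map gc"
abbreviation gi :: "'k \<Rightarrow> 'g" where "gi \<equiv> chart_inv gc"
abbreviation z0 :: 'k where "z0 \<equiv> gm 0"
abbreviation GD :: "'g set" where "GD \<equiv> chart_dom gc"
abbreviation GI :: "'k set" where "GI \<equiv> chart_img gc"

lemma gi_gm: "g \<in> GD \<Longrightarrow> gi (gm g) = g" and gm_gi: "x \<in> GI \<Longrightarrow> gm (gi x) = x"
  and gi_in: "x \<in> GI \<Longrightarrow> gi x \<in> GD" and gi_z0: "gi z0 = 0" and z0_in: "z0 \<in> GI"
  and open_GI: "open GI" and open_GD: "open GD"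
  using chart_inv_map[OF AG gc_in] chart_map_inv[OF AG gc_in] chart_inv_in[OF AG gc_in] gc_0
    open_chart_img[OF AG gc_in] open_chart_dom[OF AG gc_in] by auto

lemma charts_at_gc: "p \<in> GD \<Longrightarrow> gc \<in> charts_at AG p"
  by (simp add: charts_at_iff gc_in)

text \<open>The differential at \<open>p\<close> of the translation by \<open>a\<close>, read in the
  chart \<open>gc\<close> at both ends; meaningful if \<open>p\<close> and \<open>a + p\<close> lie
  in \<open>GD\<close>.\<close>

definition dT :: "'g \<Rightarrow> 'g \<Rightarrow> 'k \<Rightarrow> 'k" where
  "dT a p = FD (\<lambda>x. gm (a + gi x)) (gm p)"

lemma dT_has_derivative:
  assumes "p \<in> GD" "a + p \<in> GD"
  shows "((\<lambda>x. gm (a + gi x)) has_derivative dT a p) (at (gm p))"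
  unfolding dT_def
  by (rule chart_rep_has_derivative[OF AG AG open_UNIV smooth_on_translate[OF open_UNIV] UNIV_I
        charts_at_gc[OF assms(1)] charts_at_gc[OF assms(2)]])

lemma dT_compose:
  assumes "p \<in> GD" "b + p \<in> GD" "a + (b + p) \<in> GD"
  shows "dT (a + b) p v = dT a (b + p) (dT b p v)"
  using chart_chain[OF AG AG AG open_UNIV open_UNIV smooth_on_translate[OF open_UNIV] smooth_on_translate[OF open_UNIV]
      UNIV_I UNIV_I charts_at_gc[OF assms(1)] charts_at_gc[OF assms(2)] charts_at_gc[OF assms(3)], of v]
  unfolding dT_def by (simp add: add.assoc)

lemma dT_0: "p \<in> GD \<Longrightarrow> dT 0 p v = v"
  using FD_transition_self[OF AG charts_at_gc] by (simp add: dT_def)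

text \<open>The frame carries vectors at the identity to the point with coordinates \<open>x\<close>
  by translation. The Maurer-Cartan form carries vectors at that point back and is the inverse of
  the frame.\<close>

definition invariant_frame :: "'k \<Rightarrow> 'k \<Rightarrow> 'k" where "invariant_frame x = dT (gi x) 0"
definition maurer_cartan :: "'k \<Rightarrow> 'k \<Rightarrow> 'k" where "maurer_cartan x = dT (- gi x) (gi x)"

lemma mc_frame: "x \<in> GI \<Longrightarrow> maurer_cartan x (invariant_frame x v) = v"
  using dT_compose[of 0 "gi x" "- gi x" v] gc_0 gi_in[of x] by (simp add: maurer_cartan_def invariant_frame_def dT_0)

lemma frame_mc: "x \<in> GI \<Longrightarrow> invariant_frame x (maurer_cartan x v) = v"
  using dT_compose[of "gi x" "- gi x" "gi x" v] gc_0 gi_in[of x] by (simp add: maurer_cartan_def invariant_frame_def dT_0)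

lemma mc_invariant:
  assumes "p \<in> GD" "a + p \<in> GD"
  shows "maurer_cartan (gm (a + p)) (dT a p v) = maurer_cartan (gm p) v"
  using dT_compose[of p a "- (a + p)" v] assms gc_0 by (simp add: maurer_cartan_def gi_gm)

lemma linear_frame: "x \<in> GI \<Longrightarrow> linear (invariant_frame x)"
  unfolding invariant_frame_def
  by (rule has_derivative_linear[OF dT_has_derivative]) (simp_all add: gc_0 gi_in)

lemma linear_mc: "x \<in> GI \<Longrightarrow> linear (maurer_cartan x)"
  unfolding maurer_cartan_def
  by (rule has_derivative_linear[OF dT_has_derivative]) (simp_all add: gc_0 gi_in)

lemma smooth_on_gi: "smooth_on model_atlas AG GI gi"
  by (rule smooth_on_chart_inv[OF AG gc_in])

lemma smooth_on_gi_compose: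
  fixes h :: "'a::fin_dim_inner \<Rightarrow> 'k"
  assumes "open S" "Cinf_on S h" "\<And>x. x \<in> S \<Longrightarrow> h x \<in> GI"
  shows "smooth_on model_atlas AG S (\<lambda>x. gi (h x))"
  using assms smooth_on_compose[OF smooth_atlas_model smooth_atlas_model AG _ open_GI _ smooth_on_gi, of S h]
  by (simp add: smooth_on_model)

lemma Cinf_on_gm:
  assumes "smooth_on model_atlas AG S f" "open S"
  shows "open {x \<in> S. f x \<in> GD}" "Cinf_on {x \<in> S. f x \<in> GD} (\<lambda>x. gm (f x))"
proof -
  show "open {x \<in> S. f x \<in> GD}"
    using continuous_open_preimage[OF smooth_on_continuous[OF assms(1)] assms(2) open_GD]
    by (simp add: vimage_def Int_def)
  show "Cinf_on {x \<in> S. f x \<in> GD} (\<lambda>x. gm (f x))"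
    by (rule pushv_Cinf[OF AG assms(1) gc_in]) auto
qed

text \<open>A partial derivative is the total derivative on vectors \<open>(0, w)\<close>, hence
  smooth along any smooth family of base points.\<close>

lemma Cinf_on_partial_snd:
  fixes F :: "'a::fin_dim_inner \<times> 'b::fin_dim_inner \<Rightarrow> 'c::real_normed_vector"
  assumes O: "open O'" "Cinf_on O' F" and S: "open S" "Cinf_on S a" "Cinf_on S b" "\<And>x. x \<in> S \<Longrightarrow> (a x, b x) \<in> O'"
  shows "Cinf_on S (\<lambda>x. FD (\<lambda>y. F (a x, y)) (b x) w)"
proof -
  have "FD (\<lambda>y. F (a x, y)) (b x) w = FD F (a x, b x) (0, w)" if "x \<in> S" for x
    by (rule FD_Pair_right[OF Cinf_on_has_derivative[OF O(2) S(4)[OF that]]])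
  moreover have "Cinf_on S (\<lambda>x. FD F (a x, b x) (0, w))"
    by (intro Cinf_on_FD_apply[OF O(1) S(1) O(2)] Cinf_on_Pair Cinf_on_const S)
  ultimately show ?thesis by (subst Cinf_on_cong[OF S(1)]) auto
qed

lemma Cinf_frame: "Cinf_on GI (\<lambda>x. invariant_frame x w)"
proof -
  have s: "smooth_on model_atlas AG (GI \<times> GI) (\<lambda>z. gi (fst z) + gi (snd z))"
    by (intro smooth_on_plus smooth_atlas_model smooth_on_gi_compose open_Times open_GI Cinf_on_fst Cinf_on_snd) auto
  note O = Cinf_on_gm[OF s open_Times[OF open_GI open_GI]]
  have "Cinf_on GI (\<lambda>x. FD (\<lambda>y. (\<lambda>z. gm (gi (fst z) + gi (snd z))) (x, y)) z0 w)"
    by (rule Cinf_on_partial_snd[OF O open_GI Cinf_on_ident[OF open_GI] Cinf_on_const[OF open_GI]])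
      (simp add: z0_in gi_z0 gi_in)
  then show ?thesis by (simp add: invariant_frame_def dT_def)
qed

lemma Cinf_mc: "Cinf_on GI (\<lambda>x. maurer_cartan x w)"
proof -
  have s: "smooth_on model_atlas AG (GI \<times> GI) (\<lambda>z. - gi (fst z) + gi (snd z))"
    by (intro smooth_on_plus smooth_on_uminus smooth_atlas_model smooth_on_gi_compose open_Times open_GI Cinf_on_fst Cinf_on_snd) auto
  note O = Cinf_on_gm[OF s open_Times[OF open_GI open_GI]]
  have "Cinf_on GI (\<lambda>x. FD (\<lambda>y. (\<lambda>z. gm (- gi (fst z) + gi (snd z))) (x, y)) x w)"
    by (rule Cinf_on_partial_snd[OF O open_GI Cinf_on_ident[OF open_GI] Cinf_on_ident[OF open_GI]])
      (simp add: gc_0)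
  then show ?thesis by (subst Cinf_on_cong[OF open_GI]) (auto simp: maurer_cartan_def dT_def gm_gi)
qed

text \<open>The invariant vector fields commute: both sides are mixed second derivatives of the
  symmetric function \<open>(y, z) \<mapsto> g + y + z\<close>.\<close>

lemma frame_commute:
  assumes x: "x \<in> GI"
  shows "FD (\<lambda>x. invariant_frame x v) x (invariant_frame x w) = FD (\<lambda>x. invariant_frame x w) x (invariant_frame x v)"
proof -
  define g where "g = gi x"
  have g: "g \<in> GD" "gm g = x" using x by (simp_all add: g_def gi_in gm_gi)
  define T where "T z = gm ((g + gi (fst z)) + gi (snd z))" for z
  have s: "smooth_on model_atlas AG (GI \<times> GI) (\<lambda>z. (g + gi (fst z)) + gi (snd z))"
    by (intro smooth_on_plus smooth_on_const AG smooth_atlas_model smooth_on_gi_compose open_Times open_GI Cinf_on_fst Cinf_on_snd) auto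
  define D where "D = {z \<in> GI \<times> GI. (g + gi (fst z)) + gi (snd z) \<in> GD}"
  have D: "open D" "Cinf_on D T"
    using Cinf_on_gm[OF s open_Times[OF open_GI open_GI]] unfolding D_def T_def by auto
  have zD: "(z0, z0) \<in> D" using g by (simp add: D_def z0_in gi_z0)
  have key: "FD (\<lambda>x. invariant_frame x v) x (invariant_frame x w) = FD (\<lambda>u. FD T u (0, v)) (z0, z0) (w, 0)" for v w
  proof -
    have oN: "open ((\<lambda>y. (y, z0)) -` D)" by (intro open_vimage D continuous_intros)
    have zN: "z0 \<in> (\<lambda>y. (y, z0)) -` D" using zD by simp
    have "invariant_frame (gm (g + gi y)) v = FD T (y, z0) (0, v)" if "y \<in> (\<lambda>y. (y, z0)) -` D" for y
    proof -
      have y: "(y, z0) \<in> D" using that by simp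
      then have "g + gi y \<in> GD" by (simp add: D_def gi_z0)
      then have "invariant_frame (gm (g + gi y)) v = FD (\<lambda>z. T (y, z)) z0 v"
        by (simp add: invariant_frame_def dT_def gi_gm T_def)
      also have "\<dots> = FD T (y, z0) (0, v)"
        by (rule FD_Pair_right[OF Cinf_on_has_derivative[OF D(2) y]])
      finally show ?thesis .
    qed
    then have "FD (\<lambda>y. invariant_frame (gm (g + gi y)) v) z0 = FD (\<lambda>y. FD T (y, z0) (0, v)) z0"
      by (rule FD_cong[OF oN zN])
    then have "FD (\<lambda>y. invariant_frame (gm (g + gi y)) v) z0 w = FD (\<lambda>y. FD T (y, z0) (0, v)) z0 w"
      by simp
    also have "\<dots> = FD (\<lambda>u. FD T u (0, v)) (z0, z0) (w, 0)"
      by (rule FD_Pair_left[OF Cinf_on_has_derivative[OF Cinf_on_FD[OF D(2)] zD]])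
    finally have 1: "FD (\<lambda>y. invariant_frame (gm (g + gi y)) v) z0 w = FD (\<lambda>u. FD T u (0, v)) (z0, z0) (w, 0)" .
    have 2: "FD (\<lambda>y. invariant_frame (gm (g + gi y)) v) z0 w = FD (\<lambda>x. invariant_frame x v) x (invariant_frame x w)"
    proof (rule FD_compose[where f = "\<lambda>y. gm (g + gi y)" and g = "\<lambda>x. invariant_frame x v"
          and f' = "invariant_frame x" and g' = "FD (\<lambda>x. invariant_frame x v) x"])
      show "((\<lambda>y. gm (g + gi y)) has_derivative invariant_frame x) (at z0)"
        unfolding invariant_frame_def g_def[symmetric] by (rule dT_has_derivative) (simp_all add: gc_0 g)
      show "((\<lambda>x. invariant_frame x v) has_derivative FD (\<lambda>x. invariant_frame x v) x) (at (gm (g + gi z0)))"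
        using Cinf_on_has_derivative[OF Cinf_frame x] g by (simp add: gi_z0)
    qed
    from 2[symmetric] 1 show ?thesis by (rule trans)
  qed
  have swap: "FD (\<lambda>u. FD T u (w, 0)) (z0, z0) (0, v) = FD (\<lambda>u. FD T u (0, w)) (z0, z0) (v, 0)"
  proof -
    have swap1: "((\<lambda>u. (snd u, fst u)) has_derivative (\<lambda>u. (snd u, fst u))) (at u)" for u :: "'k \<times> 'k"
      by (auto intro!: derivative_eq_intros)
    have T: "T (snd u, fst u) = T u" for u by (simp add: T_def ac_simps)
    have sD: "(snd u, fst u) \<in> D" if "u \<in> D" for u using that by (auto simp: D_def ac_simps)
    have "FD T u (w, 0) = FD T (snd u, fst u) (0, w)" if "u \<in> D" for u
      using FD_compose[OF swap1 Cinf_on_has_derivative[OF D(2) sD[OF that]], of "(w, 0)"] by (simp add: T)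
    then have "FD (\<lambda>u. FD T u (w, 0)) (z0, z0) = FD (\<lambda>u. FD T (snd u, fst u) (0, w)) (z0, z0)"
      by (rule FD_cong[OF D(1) zD])
    then have "FD (\<lambda>u. FD T u (w, 0)) (z0, z0) (0, v) = FD (\<lambda>u. FD T (snd u, fst u) (0, w)) (z0, z0) (0, v)"
      by (rule fun_cong)
    also have "\<dots> = FD (\<lambda>u. FD T u (0, w)) (z0, z0) (v, 0)"
      using FD_compose[OF swap1[of "(z0, z0)"], of "\<lambda>u. FD T u (0, w)" "FD (\<lambda>u. FD T u (0, w)) (z0, z0)" "(0, v)"]
        Cinf_on_has_derivative[OF Cinf_on_FD[OF D(2)] zD] by simp
    finally show ?thesis .
  qed
  have "FD (\<lambda>u. FD T u (0, v)) (z0, z0) (w, 0) = FD (\<lambda>u. FD T u (w, 0)) (z0, z0) (0, v)"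
    by (rule second_FD_symmetric[OF D(1) zD D(2)])
  then show ?thesis unfolding key swap .
qed

text \<open>Differentiating \<open>mc_frame\<close> writes the derivative of the form as minus
  \<open>maurer_cartan x\<close> applied to the derivative of one frame field along another. As the
  frame fields commute, the result is symmetric.\<close>

lemma mc_closed:
  assumes x: "x \<in> GI"
  shows "FD (\<lambda>x. maurer_cartan x u) x a = FD (\<lambda>x. maurer_cartan x a) x u"
proof -
  have key: "FD (\<lambda>x. maurer_cartan x (invariant_frame x' v)) x a = - maurer_cartan x (FD (\<lambda>x. invariant_frame x v) x a)" if "x' = x" for x' v a
  proof -
    have "((\<lambda>y. maurer_cartan y (invariant_frame y v)) has_derivative
        (\<lambda>a. FD (\<lambda>y. maurer_cartan y (invariant_frame x v)) x a + maurer_cartan x (FD (\<lambda>x. invariant_frame x v) x a))) (at x)"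
      by (rule has_derivative_linear_family[OF open_GI x linear_mc
            differentiableI[OF Cinf_on_has_derivative[OF Cinf_mc x]] Cinf_on_has_derivative[OF Cinf_frame x]])
    then have "((\<lambda>y. v) has_derivative
        (\<lambda>a. FD (\<lambda>y. maurer_cartan y (invariant_frame x v)) x a + maurer_cartan x (FD (\<lambda>x. invariant_frame x v) x a))) (at x)"
      by (rule has_derivative_transform_within_open[OF _ open_GI x]) (rule mc_frame)
    from fun_cong[OF has_derivative_unique[OF this has_derivative_const], of a] show ?thesis
      unfolding that by (rule eq_neg_iff_add_eq_0[THEN iffD2])
  qed
  show ?thesis
    using key[OF refl, of "maurer_cartan x u" a] key[OF refl, of "maurer_cartan x a" u] frame_commute[OF x, of "maurer_cartan x u" "maurer_cartan x a"]
    by (simp add: frame_mc[OF x])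
qed

section \<open>The exponential map and one-parameter subgroups\<close>

text \<open>The potential \<open>L\<close> of the Maurer-Cartan form is a logarithm: invariance of
  the form makes it additive near the identity. Its local inverse is therefore additive, extends to
  all of \<open>'k\<close> by doubling, and is smooth everywhere because near any point it is a
  translate of its germ at 0.\<close>

lemma exp_exists:
  "\<exists>F V Lg. (\<forall>v w. F (v + w) = F v + F w) \<and> smooth_on model_atlas AG UNIV F \<and>
    ((\<lambda>v. gm (F v)) has_derivative (\<lambda>v. v)) (at 0) \<and> open V \<and> 0 \<in> V \<and> smooth_on AG model_atlas V Lg \<and>
    (\<forall>g\<in>V. F (Lg g) = g) \<and> (\<exists>d>0. \<forall>v. norm v < d \<longrightarrow> F v \<in> V \<and> Lg (F v) = v)"
proof -
  obtain r0 where r0: "r0 > 0" "ball z0 r0 \<subseteq> GI" using open_GI z0_in openE by blast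
  have "\<exists>L. Cinf_on (ball z0 r0) L \<and> L z0 = 0 \<and> (\<forall>x\<in>ball z0 r0. (L has_derivative maurer_cartan x) (at x))"
    by (rule Poincare_ball[OF Cinf_on_subset[OF Cinf_mc r0(2)]]) (use r0 linear_mc mc_closed in blast)+
  then obtain L where L: "Cinf_on (ball z0 r0) L" "L z0 = 0" "\<And>x. x \<in> ball z0 r0 \<Longrightarrow> (L has_derivative maurer_cartan x) (at x)"
    by blast
  have mc0: "maurer_cartan z0 v = v" and frame0: "invariant_frame z0 v = v" for v using gc_0 by (simp_all add: maurer_cartan_def invariant_frame_def gi_z0 dT_0)
  have z0b: "z0 \<in> ball z0 r0" using r0 by simp
  have "FD L z0 = (\<lambda>v. v)" using FD_eq[OF L(3)[OF z0b]] mc0 by auto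
  then obtain r e where r: "r > 0" "cball z0 r \<subseteq> ball z0 r0"
    and inj: "\<And>x y. x \<in> cball z0 r \<Longrightarrow> y \<in> cball z0 r \<Longrightarrow> norm (x - y) \<le> 2 * norm (L x - L y)"
    and e: "\<And>y. y \<in> ball (L z0) (r / 2) \<Longrightarrow> e y \<in> ball z0 r \<and> L (e y) = y"
    using local_inverse[OF open_ball z0b L(1)] by metis
  have rI: "ball z0 r \<subseteq> GI" "ball z0 r \<subseteq> ball z0 r0" using r r0 ball_subset_cball by blast+
  \<comment> \<open>Sums of two points near the identity have to stay in this neighbourhood, on
    which \<open>L\<close> is injective in coordinates. The radius \<open>\<rho>\<close> below comes
    from continuity of addition at the identity.\<close>
  define V' where "V' = GD \<inter> gm -` ball z0 r"
  have V': "open V'" "0 \<in> V'" using open_chart_vimage[OF AG gc_in open_ball] gc_0 r by (auto simp: V'_def)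
  have s: "smooth_on model_atlas AG (GI \<times> GI) (\<lambda>z. gi (fst z) + gi (snd z))"
    by (intro smooth_on_plus smooth_atlas_model smooth_on_gi_compose open_Times open_GI Cinf_on_fst Cinf_on_snd) auto
  let ?O = "(GI \<times> GI) \<inter> (\<lambda>z. gi (fst z) + gi (snd z)) -` V'"
  have oO: "open ?O"
    by (rule continuous_open_preimage[OF smooth_on_continuous[OF s] open_Times[OF open_GI open_GI] V'(1)])
  have zO: "(z0, z0) \<in> ?O" using V' by (simp add: z0_in gi_z0)
  obtain P Q where "open P" "open Q" "(z0, z0) \<in> P \<times> Q" and PQ': "P \<times> Q \<subseteq> ?O"
    by (rule open_prod_elim[OF oO zO])
  then have PQ: "open P" "open Q" "z0 \<in> P" "z0 \<in> Q" by auto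
  have "open (P \<inter> Q)" "z0 \<in> P \<inter> Q" using PQ by auto
  then obtain \<rho>' where \<rho>': "\<rho>' > 0" "ball z0 \<rho>' \<subseteq> P \<inter> Q" by (meson openE)
  define \<rho> where "\<rho> = min \<rho>' r"
  have \<rho>: "\<rho> > 0" "\<rho> \<le> r" using \<rho>' r by (simp_all add: \<rho>_def)
  have sum_in: "gi x + gi y \<in> V'" if "x \<in> ball z0 \<rho>" "y \<in> ball z0 \<rho>" for x y
  proof -
    have "x \<in> P" "y \<in> Q" using that \<rho>'(2) by (auto simp: \<rho>_def)
    then have "(x, y) \<in> (GI \<times> GI) \<inter> (\<lambda>z. gi (fst z) + gi (snd z)) -` V'" using PQ' by blast
    then show ?thesis by simp
  qed
  have \<rho>I: "x \<in> GI" "x \<in> ball z0 r0" "x \<in> ball z0 r" if "x \<in> ball z0 \<rho>" for x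
  proof -
    show x: "x \<in> ball z0 r" using that \<rho>(2) by simp
    show "x \<in> GI" "x \<in> ball z0 r0" using x rI by blast+
  qed
  \<comment> \<open>As a function of \<open>y\<close>, the difference of
    \<open>L (gm (gi x + gi y))\<close> and \<open>L y\<close> has zero derivative, because the
    Maurer-Cartan form is invariant under translation by \<open>gi x\<close>.\<close>
  have hom: "L (gm (gi x + gi y)) = L x + L y" if x: "x \<in> ball z0 \<rho>" and y: "y \<in> ball z0 \<rho>" for x y
  proof -
    have "((\<lambda>y. L (gm (gi x + gi y)) - L y) has_derivative (\<lambda>_. 0)) (at y within ball z0 \<rho>)"
      if y: "y \<in> ball z0 \<rho>" for y
    proof -
      have v: "gi x + gi y \<in> GD" "gm (gi x + gi y) \<in> ball z0 r0" using sum_in[OF x y] rI by (auto simp: V'_def)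
      have "((\<lambda>y. L (gm (gi x + gi y))) has_derivative (\<lambda>u. maurer_cartan (gm (gi x + gi y)) (dT (gi x) (gi y) u))) (at y)"
        using dT_has_derivative[of "gi y" "gi x"] v gi_in[OF \<rho>I(1)[OF y]]
        by (intro has_derivative_compose[OF _ L(3)]) (simp_all add: gm_gi[OF \<rho>I(1)[OF y]])
      from has_derivative_diff[OF this L(3)[OF \<rho>I(2)[OF y]]] show ?thesis
        using mc_invariant[OF gi_in[OF \<rho>I(1)[OF y]] v(1)] gm_gi[OF \<rho>I(1)[OF y]]
        by (simp add: has_derivative_at_withinI)
    qed
    from has_derivative_zero_unique[OF convex_ball this y] \<rho>(1)
    have "L (gm (gi x + gi y)) - L y = L (gm (gi x + gi z0)) - L z0" by simp
    then show ?thesis using gm_gi[OF \<rho>I(1)[OF x]] by (simp add: gi_z0 L(2) algebra_simps)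
  qed
  \<comment> \<open>\<open>e\<close> at most doubles distances and sends 0 to \<open>z0\<close>, so
    vectors shorter than \<open>\<rho> / 2\<close> land in the ball of radius \<open>\<rho>\<close>,
    where sums are under control. Since \<open>\<rho> \<le> r\<close>, they also lie in the domain
    of \<open>e\<close>.\<close>
  define d where "d = \<rho> / 2"
  have d: "d > 0" "d \<le> r / 2" using \<rho> by (simp_all add: d_def)
  have e1: "e v \<in> ball z0 r" "L (e v) = v" "norm (e v - e w) \<le> 2 * norm (v - w)" "e v \<in> ball z0 \<rho>"
    if v: "norm v < d" and w: "norm w < d" for v w
  proof -
    have vw: "v \<in> ball (L z0) (r / 2)" "w \<in> ball (L z0) (r / 2)" using v w d by (simp_all add: L(2))
    show 1: "e v \<in> ball z0 r" "L (e v) = v" using e[OF vw(1)] by auto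
    have 2: "e w \<in> ball z0 r" "L (e w) = w" using e[OF vw(2)] by auto
    show "norm (e v - e w) \<le> 2 * norm (v - w)" using inj[of "e v" "e w"] 1 2 ball_subset_cball[of z0 r] by auto
    have "norm (e v - z0) \<le> 2 * norm v" using inj[of "e v" z0] 1 r L(2) ball_subset_cball[of z0 r] by auto
    also have "\<dots> < \<rho>" using v by (simp add: d_def)
    finally show "e v \<in> ball z0 \<rho>" by (simp add: dist_norm norm_minus_commute)
  qed
  have eL: "e (L x) = x" if "x \<in> ball z0 r" "norm (L x) < d" for x
  proof -
    have "norm (e (L x) - x) \<le> 2 * norm (L (e (L x)) - L x)"
      using inj[of "e (L x)" x] e1(1)[OF that(2,2)] that(1) ball_subset_cball[of z0 r] by blast
    then show ?thesis using e1(2)[OF that(2,2)] by simp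
  qed
  have e0: "e 0 = z0" using eL[of z0] r d L(2) by simp
  have eI: "e v \<in> GI" if "norm v < d" for v using e1(1)[OF that that] rI by blast
  have ed: "(e has_derivative invariant_frame (e v)) (at v)" if v: "v \<in> ball 0 d" for v
  proof (rule has_derivative_inverse_basic[of L "maurer_cartan (e v)" e v, OF L(3)])
    have v': "norm v < d" using v by simp
    show "e v \<in> ball z0 r0" using e1(1)[OF v' v'] rI by blast
    show "bounded_linear (invariant_frame (e v))" by (rule linear_imp_bounded_linear[OF linear_frame[OF eI[OF v']]])
    show "invariant_frame (e v) \<circ> maurer_cartan (e v) = id" using frame_mc[OF eI[OF v']] by auto
    show "L (e w) = w" if "w \<in> ball 0 d" for w using e1(2)[of w w] that by simp
    have "continuous_on (ball 0 d) e"
      unfolding continuous_on_iff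
    proof (intro ballI allI impI)
      fix v :: 'k and \<epsilon> :: real assume "v \<in> ball 0 d" "0 < \<epsilon>"
      then show "\<exists>da>0. \<forall>x'\<in>ball 0 d. dist x' v < da \<longrightarrow> dist (e x') (e v) < \<epsilon>"
        using e1(3) by (intro exI[of _ "\<epsilon> / 2"]) (fastforce simp: dist_norm)
    qed
    then show "continuous (at v) e" using v by (simp add: continuous_on_eq_continuous_at)
  qed (use v in auto)
  \<comment> \<open>The derivative of \<open>e\<close> is \<open>invariant_frame\<close> composed
    with \<open>e\<close> itself, so each degree of differentiability of \<open>e\<close> yields the
    next.\<close>
  have eC: "Cinf_on (ball 0 d) e"
    unfolding Cinf_on_def
  proof
    fix k show "Ck_on k (ball 0 d) e"
    proof (induction k)
      case 0
      have "isCont e v" if "v \<in> ball 0 d" for v by (rule has_derivative_continuous[OF ed[OF that]])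
      then show ?case by (simp add: continuous_at_imp_continuous_on)
    next
      case (Suc k)
      show ?case
      proof (rule Ck_on_SucI[OF open_ball ed])
        show "Ck_on k (ball 0 d) (\<lambda>v. invariant_frame (e v) w)" for w
        proof (rule Ck_on_compose[OF open_ball open_GI _ Suc, where g = "\<lambda>x. invariant_frame x w"])
          show "e ` ball 0 d \<subseteq> GI" using eI by auto
          show "Ck_on k GI (\<lambda>x. invariant_frame x w)" using Cinf_frame by (simp add: Cinf_on_def)
        qed
      qed
    qed
  qed
  define ex where "ex v = gi (e v)" for v
  have ex_smooth: "smooth_on model_atlas AG (ball 0 d) ex"
    unfolding ex_def by (rule smooth_on_gi_compose[OF open_ball eC]) (use eI in simp)
  have ex_add: "ex (v + w) = ex v + ex w" if vw: "norm v < d" "norm w < d" "norm (v + w) < d" for v w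
  proof -
    have s: "ex v + ex w \<in> V'" unfolding ex_def by (rule sum_in[OF e1(4)[OF vw(1,1)] e1(4)[OF vw(2,2)]])
    have "L (gm (ex v + ex w)) = v + w"
      unfolding ex_def hom[OF e1(4)[OF vw(1,1)] e1(4)[OF vw(2,2)]]
      using e1(2)[OF vw(1,1)] e1(2)[OF vw(2,2)] by simp
    then have "e (v + w) = gm (ex v + ex w)" using eL[of "gm (ex v + ex w)"] s vw(3) by (simp add: V'_def)
    then show ?thesis using s by (simp add: ex_def gi_gm V'_def)
  qed
  obtain F where F: "\<And>v w. F (v + w) = F v + F w" "\<And>v. norm v < d \<Longrightarrow> F v = ex v"
    using local_additive_extend[OF d(1) ex_add] by blast
  have F_smooth: "smooth_on model_atlas AG UNIV F"
  proof (rule smooth_on_local[OF smooth_atlas_model AG open_UNIV])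
    fix v0 :: 'k
    have "smooth_on model_atlas AG (ball v0 d) (\<lambda>v. ex (v - v0))"
      by (rule smooth_on_compose[OF smooth_atlas_model smooth_atlas_model AG open_ball open_ball _ ex_smooth])
        (auto simp: smooth_on_model dist_norm norm_minus_commute intro!: Cinf_on_diff Cinf_on_ident Cinf_on_const)
    then have "smooth_on model_atlas AG (ball v0 d) (\<lambda>v. F v0 + ex (v - v0))"
      by (intro smooth_on_plus smooth_on_const smooth_atlas_model AG open_ball)
    then have "smooth_on model_atlas AG (ball v0 d) F"
    proof (rule smooth_on_cong[OF smooth_atlas_model AG open_ball])
      fix v assume "v \<in> ball v0 d"
      then have "F (v - v0) = ex (v - v0)" by (intro F(2)) (simp add: dist_norm norm_minus_commute)
      then show "F v0 + ex (v - v0) = F v" using F(1)[of v0 "v - v0"] by simp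
    qed
    then show "\<exists>N. open N \<and> v0 \<in> N \<and> smooth_on model_atlas AG N F"
      using d(1) by (intro exI[of _ "ball v0 d"]) simp
  qed
  have gmF: "gm (F v) = e v" if "norm v < d" for v using F(2)[OF that] gm_gi[OF eI[OF that]] by (simp add: ex_def)
  have F_der: "((\<lambda>v. gm (F v)) has_derivative (\<lambda>v. v)) (at 0)"
  proof (rule has_derivative_transform_within_open[of e _ _ _ "ball 0 d"])
    have "invariant_frame (e 0) = (\<lambda>v. v)" using frame0 by (auto simp: e0)
    then show "(e has_derivative (\<lambda>v. v)) (at 0)" using ed[of 0] d(1) by simp
  qed (use d gmF in auto)
  define V where "V = GD \<inter> gm -` (ball z0 r \<inter> L -` ball 0 d)"
  have oN: "open (ball z0 r \<inter> L -` ball 0 d)"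
    by (rule continuous_open_preimage[OF continuous_on_subset[OF Cinf_on_continuous[OF L(1)] rI(2)] open_ball open_ball])
  have V: "open V" unfolding V_def by (rule open_chart_vimage[OF AG gc_in oN])
  have V0: "0 \<in> V" using gc_0 r d L(2) by (simp add: V_def)
  have gmV: "smooth_on AG model_atlas V gm"
    by (rule smooth_on_subset[OF smooth_on_chart_map[OF AG gc_in]]) (auto simp: V_def)
  have Ls: "smooth_on model_atlas model_atlas (ball z0 r0) L" using L(1) by (simp add: smooth_on_model)
  have Lg: "smooth_on AG model_atlas V (\<lambda>g. L (gm g))"
    by (rule smooth_on_compose[OF AG smooth_atlas_model smooth_atlas_model V open_ball gmV Ls])
      (use rI in \<open>auto simp: V_def\<close>)
  have FL: "F (L (gm g)) = g" if "g \<in> V" for g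
    using that F(2)[of "L (gm g)"] eL[of "gm g"] by (simp add: V_def ex_def gi_gm)
  have LF: "F v \<in> V \<and> L (gm (F v)) = v" if "norm v < d" for v
    using that F(2)[OF that] gmF[OF that] gi_in[OF eI[OF that]] e1(1,2)[OF that that] by (simp add: V_def ex_def)
  show ?thesis
    using F(1) F_smooth F_der V V0 Lg FL LF d(1)
    by (intro exI[of _ F] exI[of _ V] exI[of _ "\<lambda>g. L (gm g)"] conjI allI ballI exI[of _ d]) auto
qed

definition Exp :: "'k \<Rightarrow> 'g" where
  "Exp = (SOME F. \<exists>V Lg. (\<forall>v w. F (v + w) = F v + F w) \<and> smooth_on model_atlas AG UNIV F \<and>
    ((\<lambda>v. gm (F v)) has_derivative (\<lambda>v. v)) (at 0) \<and> open V \<and> 0 \<in> V \<and> smooth_on AG model_atlas V Lg \<and>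
    (\<forall>g\<in>V. F (Lg g) = g) \<and> (\<exists>d>0. \<forall>v. norm v < d \<longrightarrow> F v \<in> V \<and> Lg (F v) = v))"

lemmas Exp_props = someI_ex[OF exp_exists, folded Exp_def]

lemma Exp_add: "Exp (v + w) = Exp v + Exp w"
  and Exp_smooth: "smooth_on model_atlas AG UNIV Exp"
  and Exp_has_derivative: "((\<lambda>v. gm (Exp v)) has_derivative (\<lambda>v. v)) (at 0)"
  using Exp_props by blast+

lemma Exp_0 [simp]: "Exp 0 = 0"
  using Exp_add[of 0 0] by simp

lemma Exp_diff: "Exp (v - w) = Exp v - Exp w"
  using Exp_add[of "v - w" w] by (simp add: eq_diff_eq)

lemma Exp_local_inverse:
  obtains V Lg d where "open V" "0 \<in> V" "smooth_on AG model_atlas V Lg" "\<And>g. g \<in> V \<Longrightarrow> Exp (Lg g) = g"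
    "d > 0" "\<And>v. norm v < d \<Longrightarrow> Exp v \<in> V" "\<And>v. norm v < d \<Longrightarrow> Lg (Exp v) = v"
  using Exp_props by blast

lemma smooth_on_Exp_compose:
  assumes A: "smooth_atlas A" and S: "open S" and f: "smooth_on A model_atlas S f"
  shows "smooth_on A AG S (\<lambda>p. Exp (f p))"
  by (rule smooth_on_compose[OF A smooth_atlas_model AG S open_UNIV f Exp_smooth]) simp

text \<open>The image is a subgroup containing the neighbourhood \<open>V\<close> of 0, hence open;
  the other cosets make its complement open as well. Connectedness leaves the whole group.\<close>

lemma Exp_surj:
  assumes "connected (UNIV :: 'g set)"
  obtains v where "g = Exp v"
proof -
  obtain V Lg d where V: "open V" "0 \<in> V" "\<And>g. g \<in> V \<Longrightarrow> Exp (Lg g) = g"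
    using Exp_local_inverse by metis
  have tr: "open ((\<lambda>h. a + h) -` V)" for a by (rule open_vimage[OF V(1) continuous_translate])
  have 1: "\<exists>T. open T \<and> g \<in> T \<and> T \<subseteq> range Exp" if g: "g \<in> range Exp" for g
  proof (intro exI conjI)
    show "open ((\<lambda>h. - g + h) -` V)" by (rule tr)
    show "g \<in> (\<lambda>h. - g + h) -` V" using V(2) by simp
    show "(\<lambda>h. - g + h) -` V \<subseteq> range Exp"
    proof
      fix h assume "h \<in> (\<lambda>h. - g + h) -` V"
      then have "Exp (Lg (- g + h)) = - g + h" using V(3) by simp
      then have "h = g + Exp (Lg (- g + h))" by simp
      moreover obtain v where "g = Exp v" using g by blast
      ultimately have "h = Exp (v + Lg (- g + h))" by (simp add: Exp_add)
      then show "h \<in> range Exp" by (rule range_eqI)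
    qed
  qed
  have 2: "\<exists>T. open T \<and> g \<in> T \<and> T \<subseteq> - range Exp" if g: "g \<in> - range Exp" for g
  proof (intro exI conjI)
    show "open ((\<lambda>h. - g + h) -` V)" by (rule tr)
    show "g \<in> (\<lambda>h. - g + h) -` V" using V(2) by simp
    show "(\<lambda>h. - g + h) -` V \<subseteq> - range Exp"
    proof
      fix h assume "h \<in> (\<lambda>h. - g + h) -` V"
      then have "Exp (Lg (- g + h)) = - g + h" using V(3) by simp
      then have e: "g = h - Exp (Lg (- g + h))" by simp
      have "h \<notin> range Exp"
      proof
        assume "h \<in> range Exp"
        then obtain v where "h = Exp v" by blast
        then have "g = Exp (v - Lg (- g + h))" using e by (simp add: Exp_diff)
        then have "g \<in> range Exp" by (rule range_eqI)
        then show False using g by simp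
      qed
      then show "h \<in> - range Exp" by simp
    qed
  qed
  have o1: "open (range Exp)" by (subst open_subopen) (rule ballI, rule 1)
  have o2: "open (- range Exp)" by (subst open_subopen) (rule ballI, rule 2)
  have "range Exp \<inter> UNIV = {} \<or> - range Exp \<inter> UNIV = {}"
    by (rule connectedD[OF assms o1 o2]) auto
  then have "range Exp = UNIV" by auto
  then have "g \<in> range Exp" by simp
  then show thesis using that by (rule rangeE)
qed

text \<open>The isomorphism of \<open>'k\<close> with the Lie algebra that is inverse to evaluation
  in the chart \<open>gc\<close>.\<close>

definition lalg :: "'k \<Rightarrow> ('g, 'k) tvec" where "lalg k = pushv AG Exp 0 k"

lemma lalg_in: "lalg k \<in> lie_algebra AG"
  using pushv_in[OF AG open_UNIV Exp_smooth, of 0 k] by (simp add: lalg_def)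

lemma lalg_gc [simp]: "lalg k gc = k"
  using gc_at by (simp add: lalg_def pushv_def FD_eq[OF Exp_has_derivative])

lemma lie_algebra_eq_lalg: "\<xi> \<in> lie_algebra AG \<Longrightarrow> \<xi> = lalg (\<xi> gc)"
  by (rule tangent_eqI[OF _ lalg_in gc_at]) simp_all

lemma one_parameter_subgroup_Exp:
  assumes "\<xi> \<in> lie_algebra AG"
  shows "one_parameter_subgroup AG \<xi> (\<lambda>t. Exp (t *\<^sub>R \<xi> gc))"
  unfolding one_parameter_subgroup_def
proof (intro conjI allI)
  show "smooth_on model_atlas AG UNIV (\<lambda>t. Exp (t *\<^sub>R \<xi> gc))"
    by (intro smooth_on_Exp_compose smooth_atlas_model open_UNIV)
      (simp add: smooth_on_model Cinf_on_linear bounded_linear_scaleR_left)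
  show "Exp ((s + t) *\<^sub>R \<xi> gc) = Exp (s *\<^sub>R \<xi> gc) + Exp (t *\<^sub>R \<xi> gc)" for s t
    by (simp add: scaleR_add_left Exp_add)
  have "((\<lambda>t. t *\<^sub>R \<xi> gc) has_vector_derivative \<xi> gc) (at 0)"
    by (auto intro!: derivative_eq_intros)
  from velocity_eq_pushv[OF AG open_UNIV Exp_smooth UNIV_I this]
  show "velocity AG (\<lambda>t. Exp (t *\<^sub>R \<xi> gc)) 0 = \<xi>"
    using lie_algebra_eq_lalg[OF assms] by (simp add: lalg_def)
qed

text \<open>Near 0 the logarithm \<open>\<Lambda>\<close> of the subgroup is additive, so its
  derivative at every small parameter equals that at 0 and \<open>\<Lambda>\<close> is linear there.
  Doubling carries the resulting equality from small parameters to all.\<close>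

lemma one_parameter_subgroup_unique:
  assumes "one_parameter_subgroup AG \<xi> \<gamma>"
  shows "\<gamma> = (\<lambda>t. Exp (t *\<^sub>R \<xi> gc))"
proof -
  have sm: "smooth_on model_atlas AG UNIV \<gamma>" and add: "\<And>s t. \<gamma> (s + t) = \<gamma> s + \<gamma> t"
    and vel: "velocity AG \<gamma> 0 = \<xi>" using assms by (auto simp: one_parameter_subgroup_def)
  have \<gamma>0: "\<gamma> 0 = 0" using add[of 0 0] by simp
  obtain V Lg d where V: "open V" "0 \<in> V" "smooth_on AG model_atlas V Lg" "\<And>g. g \<in> V \<Longrightarrow> Exp (Lg g) = g"
    and d: "d > 0" "\<And>v. norm v < d \<Longrightarrow> Exp v \<in> V" "\<And>v. norm v < d \<Longrightarrow> Lg (Exp v) = v"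
    using Exp_local_inverse by metis
  define \<Lambda> where "\<Lambda> t = Lg (\<gamma> t)" for t
  have N: "open (\<gamma> -` V)" by (rule open_vimage[OF V(1) smooth_on_continuous[OF sm]])
  have "smooth_on model_atlas model_atlas (\<gamma> -` V) \<Lambda>"
    unfolding \<Lambda>_def
    by (rule smooth_on_compose[OF smooth_atlas_model AG smooth_atlas_model N V(1) smooth_on_subset[OF sm] V(3)]) auto
  then have C: "Cinf_on (\<gamma> -` V) \<Lambda>" by (simp add: smooth_on_model)
  have \<Lambda>0: "\<Lambda> 0 = 0" using d(3)[of 0] d(1) by (simp add: \<Lambda>_def \<gamma>0)
  \<comment> \<open>Two logarithms shorter than \<open>d / 2\<close> have a sum shorter than
    \<open>d\<close>, where \<open>Lg\<close> inverts \<open>Exp\<close>.\<close>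
  have "open (\<gamma> -` V \<inter> \<Lambda> -` ball 0 (d / 2))"
    by (rule continuous_open_preimage[OF Cinf_on_continuous[OF C] N open_ball])
  moreover have "0 \<in> \<gamma> -` V \<inter> \<Lambda> -` ball 0 (d / 2)" using \<Lambda>0 \<gamma>0 V(2) d(1) by simp
  ultimately obtain \<eta> where \<eta>: "\<eta> > 0" "ball 0 \<eta> \<subseteq> \<gamma> -` V \<inter> \<Lambda> -` ball 0 (d / 2)" by (meson openE)
  have in_V: "\<gamma> t \<in> V" "norm (\<Lambda> t) < d / 2" "Exp (\<Lambda> t) = \<gamma> t" if "t \<in> ball 0 \<eta>" for t
  proof -
    have "t \<in> \<gamma> -` V \<inter> \<Lambda> -` ball 0 (d / 2)" using that \<eta>(2) by blast
    then show "\<gamma> t \<in> V" "norm (\<Lambda> t) < d / 2" "Exp (\<Lambda> t) = \<gamma> t" using V(4) by (auto simp: \<Lambda>_def)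
  qed
  have \<Lambda>_add: "\<Lambda> (s + t) = \<Lambda> s + \<Lambda> t" if "s \<in> ball 0 \<eta>" "t \<in> ball 0 \<eta>" for s t
  proof -
    have "norm (\<Lambda> s + \<Lambda> t) < d"
      using norm_triangle_ineq[of "\<Lambda> s" "\<Lambda> t"] in_V(2)[OF that(1)] in_V(2)[OF that(2)] by linarith
    then have "Lg (Exp (\<Lambda> s + \<Lambda> t)) = \<Lambda> s + \<Lambda> t" by (rule d(3))
    then show ?thesis by (simp add: Exp_add in_V(3)[OF that(1)] in_V(3)[OF that(2)] \<Lambda>_def[of "s + t"] add)
  qed
  have D: "(\<Lambda> has_derivative FD \<Lambda> 0) (at 0)"
    by (rule Cinf_on_has_derivative[OF C]) (use V(2) \<gamma>0 in simp)
  have "((\<lambda>t. gm (Exp (\<Lambda> t))) has_derivative (\<lambda>s. FD \<Lambda> 0 s)) (at 0)"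
    by (rule has_derivative_compose[OF D, where g = "\<lambda>v. gm (Exp v)"]) (simp add: \<Lambda>0 Exp_has_derivative)
  then have gm\<gamma>: "((\<lambda>t. gm (\<gamma> t)) has_derivative FD \<Lambda> 0) (at 0)"
    by (rule has_derivative_transform_within_open[of _ _ _ _ "ball 0 \<eta>"]) (use \<eta> in_V in auto)
  define k' where "k' = FD \<Lambda> 0 1"
  have D1: "FD \<Lambda> 0 = (\<lambda>s. s *\<^sub>R k')"
  proof
    show "FD \<Lambda> 0 s = s *\<^sub>R k'" for s
      using linear_scale[OF has_derivative_linear[OF D], of s 1] by (simp add: k'_def)
  qed
  from gm\<gamma> have "((\<lambda>t. gm (\<gamma> t)) has_vector_derivative k') (at 0)"
    unfolding has_vector_derivative_def D1 .
  from vector_derivative_at[OF this] have "vector_derivative (gm \<circ> \<gamma>) (at 0) = k'" by (simp add: o_def)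
  moreover have "velocity AG \<gamma> 0 gc = vector_derivative (gm \<circ> \<gamma>) (at 0)"
    using gc_at by (simp add: velocity_def \<gamma>0)
  ultimately have k: "k' = \<xi> gc" by (simp add: vel)
  have lin: "\<Lambda> t = t *\<^sub>R \<xi> gc" if t: "t \<in> ball 0 \<eta>" for t
  proof -
    have der: "((\<lambda>t. \<Lambda> t - t *\<^sub>R \<xi> gc) has_derivative (\<lambda>_. 0)) (at t within ball 0 \<eta>)" if t: "t \<in> ball 0 \<eta>" for t
    proof -
      have D': "(\<Lambda> has_derivative (\<lambda>s. s *\<^sub>R \<xi> gc)) (at (t - t))"
        using D unfolding D1 k by simp
      have "((\<lambda>s. s - t) has_derivative (\<lambda>s. s)) (at t)" by (auto intro!: derivative_eq_intros)
      from has_derivative_compose[OF this D']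
      have "((\<lambda>s. \<Lambda> t + \<Lambda> (s - t)) has_derivative (\<lambda>s. s *\<^sub>R \<xi> gc)) (at t)"
        by (auto intro!: derivative_eq_intros)
      then have "(\<Lambda> has_derivative (\<lambda>s. s *\<^sub>R \<xi> gc)) (at t)"
      proof (rule has_derivative_transform_within_open[of _ _ _ _ "ball t \<eta>"])
        show "\<Lambda> t + \<Lambda> (s - t) = \<Lambda> s" if "s \<in> ball t \<eta>" for s
          using \<Lambda>_add[OF t, of "s - t"] that by (simp add: dist_norm norm_minus_commute)
      qed (use \<eta> in auto)
      then have "((\<lambda>t. \<Lambda> t - t *\<^sub>R \<xi> gc) has_derivative (\<lambda>s. s *\<^sub>R \<xi> gc - s *\<^sub>R \<xi> gc)) (at t)"
        by (intro has_derivative_diff bounded_linear_imp_has_derivative bounded_linear_scaleR_left)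
      then show ?thesis by (simp add: has_derivative_at_withinI)
    qed
    have "\<Lambda> t - t *\<^sub>R \<xi> gc = \<Lambda> 0 - 0 *\<^sub>R \<xi> gc"
      by (rule has_derivative_zero_unique[OF convex_ball der t]) (use \<eta>(1) in simp_all)
    then show ?thesis by (simp add: \<Lambda>0)
  qed
  show ?thesis
  proof (rule additive_eq_if_near[where f = \<gamma> and g = "\<lambda>t. Exp (t *\<^sub>R \<xi> gc)", OF add _ \<eta>(1)])
    show "Exp ((s + t) *\<^sub>R \<xi> gc) = Exp (s *\<^sub>R \<xi> gc) + Exp (t *\<^sub>R \<xi> gc)" for s t
      by (simp add: scaleR_add_left Exp_add)
    show "\<gamma> t = Exp (t *\<^sub>R \<xi> gc)" if "norm t < \<eta>" for t
      using in_V(3)[of t] lin[of t] that by simp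
  qed
qed

lemma lie_exp_eq: "\<xi> \<in> lie_algebra AG \<Longrightarrow> lie_exp AG \<xi> = Exp (\<xi> gc)"
proof -
  assume \<xi>: "\<xi> \<in> lie_algebra AG"
  have "(THE \<gamma>. one_parameter_subgroup AG \<xi> \<gamma>) = (\<lambda>t. Exp (t *\<^sub>R \<xi> gc))"
    by (rule the_equality) (rule one_parameter_subgroup_Exp[OF \<xi>], rule one_parameter_subgroup_unique)
  then show ?thesis by (simp add: lie_exp_def)
qed

lemma lie_exp_tscale_lalg: "lie_exp AG (tscale t (lalg k)) = Exp (t *\<^sub>R k)"
  using lie_exp_eq[OF tscale_in[OF AG lalg_in]] by (simp add: tscale_def)

end

section \<open>Local coordinates of an abelian principal bundle\<close>

lemma chart_imageD:
  assumes "smooth_atlas A" "c \<in> A" "x \<in> chart_map c ` (T \<inter> chart_dom c)"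
  shows "chart_inv c x \<in> T" "chart_inv c x \<in> chart_dom c" "x \<in> chart_img c"
proof -
  have "x \<in> chart_img c \<and> chart_inv c x \<in> T" by (rule iffD1[OF chart_image_iff[OF assms(1,2)] assms(3)])
  then show "chart_inv c x \<in> T" "chart_inv c x \<in> chart_dom c" "x \<in> chart_img c"
    using chart_inv_in[OF assms(1,2)] by auto
qed

lemma chart_imageI:
  assumes "smooth_atlas A" "c \<in> A" "x \<in> chart_img c" "chart_inv c x \<in> T"
  shows "x \<in> chart_map c ` (T \<inter> chart_dom c)"
  by (rule iffD2[OF chart_image_iff[OF assms(1,2)] conjI[OF assms(3,4)]])

text \<open>The coordinates of \<open>u\<close> in one chart are kept constant and cut off by a bump
  function. Curvature at a point is prescribed through global vector fields, so every tangent vector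
  has to extend to one.\<close>

lemma smooth_vector_field_extension:
  fixes A :: "('m::t2_space, 'e::fin_dim_inner) chart set"
  assumes A: "smooth_atlas A" and u: "u \<in> tangent_space A m"
  shows "\<exists>X. smooth_vector_field A X \<and> X m = u"
proof -
  obtain c where c: "c \<in> A" "m \<in> chart_dom c" using smooth_atlas_obtain_chart[OF A] .
  have cm: "c \<in> charts_at A m" using c by (simp add: charts_at_iff)
  have "chart_map c m \<in> chart_img c" using c by simp
  then obtain r where r: "r > 0" "cball (chart_map c m) r \<subseteq> chart_img c"
    using open_chart_img[OF A c(1)] open_contains_cball by blast
  obtain \<rho> :: "'e \<Rightarrow> real" where \<rho>: "Cinf_on UNIV \<rho>" "\<rho> (chart_map c m) = 1"
    "\<And>x. x \<notin> ball (chart_map c m) r \<Longrightarrow> \<rho> x = 0" using bump_function_exists[OF r(1)] by blast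
  define K where "K = chart_inv c ` cball (chart_map c m) r"
  have "compact K" unfolding K_def
    by (intro compact_continuous_image continuous_on_subset[OF continuous_chart_inv[OF A c(1)] r(2)] compact_cball)
  \<comment> \<open>Compact sets are closed in a Hausdorff space. The complement of
    \<open>K\<close>, on which the field vanishes, is thus open and covers all points outside the
    chart.\<close>
  then have K: "open (- K)" by (simp add: compact_imp_closed open_Compl)
  define X where "X p = (if p \<in> chart_dom c then tscale (\<rho> (chart_map c p)) (tvec_of A p c (u c)) else (\<lambda>_. 0))" for p
  have zero: "(\<lambda>_. 0) \<in> tangent_space A p" for p
    by (rule tangent_spaceI) (simp_all add: linear_0[OF FD_transition_linear[OF A]])
  have "smooth_vector_field A X"
    unfolding smooth_vector_field_def
  proof (intro conjI allI ballI)
    show "X p \<in> tangent_space A p" for p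
      using zero tscale_in[OF A tvec_of_in[OF A]] c by (auto simp: X_def charts_at_iff)
    fix d assume d: "d \<in> A"
    show "Cinf_on (chart_img d) (\<lambda>x. X (chart_inv d x) d)"
    proof (rule Cinf_on_local)
      fix x assume x: "x \<in> chart_img d"
      show "\<exists>N. open N \<and> x \<in> N \<and> Cinf_on N (\<lambda>x. X (chart_inv d x) d)"
      proof (cases "chart_inv d x \<in> chart_dom c")
        case True
        let ?N = "chart_map d ` (chart_dom c \<inter> chart_dom d)"
        have N: "open ?N" by (rule open_chart_image[OF A d open_chart_dom[OF A c(1)]])
        have xN: "x \<in> ?N" by (rule chart_imageI[OF A d x True])
        let ?M = "chart_map c ` (chart_dom d \<inter> chart_dom c)"
        have M: "open ?M" by (rule open_chart_image[OF A c(1) open_chart_dom[OF A d]])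
        have p: "chart_inv d y \<in> chart_dom c \<and> chart_inv d y \<in> chart_dom d" if "y \<in> ?N" for y
          using chart_imageD[OF A d that] by simp
        have tr: "Cinf_on ?N (\<lambda>y. chart_map c (chart_inv d y))" by (rule Cinf_on_transition[OF A d c(1)])
        have "Cinf_on ?N (\<lambda>y. \<rho> (chart_map c (chart_inv d y)) *\<^sub>R
            FD (\<lambda>z. chart_map d (chart_inv c z)) (chart_map c (chart_inv d y)) (u c))"
          by (intro Cinf_on_scaleR N Cinf_on_compose[OF N open_UNIV UNIV_I tr \<rho>(1)]
              Cinf_on_FD_apply[OF M N Cinf_on_transition[OF A c(1) d] tr Cinf_on_const[OF N]])
            (use p in \<open>blast intro: imageI\<close>)
        then have "Cinf_on ?N (\<lambda>y. X (chart_inv d y) d)"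
          by (rule Cinf_on_congD[OF N])
            (use p c d in \<open>simp add: X_def tscale_def tvec_of_app charts_at_iff\<close>)
        then show ?thesis using N xN by blast
      next
        case False
        let ?N = "chart_map d ` (- K \<inter> chart_dom d)"
        have N: "open ?N" by (rule open_chart_image[OF A d K])
        have "K \<subseteq> chart_dom c"
          unfolding K_def by (intro image_subsetI chart_inv_in[OF A c(1) subsetD[OF r(2)]])
        then have "chart_inv d x \<notin> K" using False by (rule contra_subsetD)
        then have xN: "x \<in> ?N" by (intro chart_imageI[OF A d x]) simp
        have "Cinf_on ?N (\<lambda>y. X (chart_inv d y) d)"
        proof (rule Cinf_on_congD[OF N Cinf_on_const[OF N, of 0]])
          fix y assume y: "y \<in> ?N"
          have nK: "chart_inv d y \<notin> K" using chart_imageD(1)[OF A d y] by simp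
          show "0 = X (chart_inv d y) d"
          proof (cases "chart_inv d y \<in> chart_dom c")
            case True
            have "chart_map c (chart_inv d y) \<notin> ball (chart_map c m) r"
            proof
              assume "chart_map c (chart_inv d y) \<in> ball (chart_map c m) r"
              then have "chart_map c (chart_inv d y) \<in> cball (chart_map c m) r" by simp
              then have "chart_inv c (chart_map c (chart_inv d y)) \<in> K" unfolding K_def by (rule imageI)
              then show False using nK chart_inv_map[OF A c(1) True] by simp
            qed
            then show ?thesis using \<rho>(3) by (simp add: X_def tscale_def)
          qed (simp add: X_def)
        qed
        then show ?thesis using N xN by blast
      qed
    qed
  qed
  moreover have "X m = u"
    using tangent_eq_tvec_of[OF A u cm] c(2) \<rho>(2) by (simp add: X_def tscale_def)
  ultimately show ?thesis by blast
qed

locale abelian_bundle = abelian_lie AG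
  for AG :: "('g::{t2_space,second_countable_topology,ab_group_add}, 'k::fin_dim_inner) chart set" +
  fixes AQ :: "('q::{t2_space,second_countable_topology}, 'e::fin_dim_inner) chart set"
    and AM :: "('m::{t2_space,second_countable_topology}, 'b::fin_dim_inner) chart set"
    and l :: "'g \<Rightarrow> 'q \<Rightarrow> 'q" and \<phi> :: "'q \<Rightarrow> 'm"
  assumes pb: "principal_bundle AG AQ AM l \<phi>" and connected_G: "connected (UNIV :: 'g set)"
begin

lemma AQ: "smooth_atlas AQ" and AM: "smooth_atlas AM"
  and act_0: "l 0 q = q"
  and act_smooth: "smooth_on (prod_atlas AG AQ) AQ UNIV (\<lambda>(g, q). l g q)"
  and phi_smooth: "smooth_on AQ AM UNIV \<phi>" and phi_act [simp]: "\<phi> (l g q) = \<phi> q"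
  using pb by (auto simp: principal_bundle_def smooth_action_def smooth_manifold_imp_smooth_atlas)

lemma act_smooth_right: "smooth_on AQ AQ UNIV (l g)"
  using smooth_on_compose[OF AQ smooth_atlas_prod[OF AG AQ] AQ open_UNIV open_UNIV
      smooth_on_Pair[OF AQ AG AQ open_UNIV smooth_on_const[OF AQ AG open_UNIV, of g] smooth_on_ident[OF AQ open_UNIV]] act_smooth]
  by simp

text \<open>\<open>P (x, k)\<close> is \<open>exp k\<close> acting on a local section over the point with coordinates \<open>x\<close> in the chart \<open>c\<close>.
  In these coordinates fundamental vector fields are constant.\<close>

definition coords :: "('m, 'b) chart \<Rightarrow> 'b set \<Rightarrow> ('b \<times> 'k \<Rightarrow> 'q) \<Rightarrow> bool" where
  "coords c D P \<longleftrightarrow> c \<in> AM \<and> open D \<and> D \<subseteq> chart_img c \<and> smooth_on model_atlas AQ (D \<times> UNIV) P \<and>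
    (\<forall>x\<in>D. \<forall>k. \<phi> (P (x, k)) = chart_inv c x) \<and>
    (\<forall>x\<in>D. \<forall>k k'. l (Exp k') (P (x, k)) = P (x, k + k')) \<and>
    (\<forall>q. \<forall>x\<in>D. \<phi> q = chart_inv c x \<longrightarrow> (\<exists>k. q = P (x, k))) \<and>
    (\<forall>x\<in>D. \<forall>k. \<exists>N R T. open N \<and> P (x, k) \<in> N \<and> smooth_on AQ model_atlas N R \<and>
       (\<forall>q\<in>N. R q \<in> D \<times> UNIV \<and> P (R q) = q) \<and>
       open T \<and> (x, k) \<in> T \<and> (\<forall>y\<in>T. y \<in> D \<times> UNIV \<and> P y \<in> N \<and> R (P y) = y))"

text \<open>\<open>P\<close> is an inverse trivialisation with the group variable written as
  \<open>Exp k\<close>. Surjectivity of \<open>Exp\<close> makes \<open>P\<close> cover whole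
  fibres; as \<open>Exp\<close> may have a kernel, inverses of \<open>P\<close> are asked for only
  locally.\<close>

lemma coords_exist: "\<exists>c D P r. coords c D P \<and> m \<in> chart_dom c \<and> D = ball (chart_map c m) r \<and> r > 0"
proof -
  have "\<exists>V \<psi>. open V \<and> m \<in> V \<and>
        diffeo_on AQ (prod_atlas AM AG) (\<phi> -` V) (V \<times> UNIV) (\<lambda>q. (\<phi> q, \<psi> q)) \<and>
        (\<forall>q\<in>\<phi> -` V. \<forall>g. \<psi> (l g q) = g + \<psi> q)"
    using pb unfolding principal_bundle_def by (elim conjE) (erule spec)
  then obtain V \<psi> where V: "open V" "m \<in> V"
    and diffeo: "diffeo_on AQ (prod_atlas AM AG) (\<phi> -` V) (V \<times> UNIV) (\<lambda>q. (\<phi> q, \<psi> q))"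
    and equiv': "\<forall>q\<in>\<phi> -` V. \<forall>g. \<psi> (l g q) = g + \<psi> q" by (elim exE conjE)
  have equiv: "\<psi> (l g q) = g + \<psi> q" if "q \<in> \<phi> -` V" for q g by (rule equiv'[rule_format, OF that])
  let ?\<Phi> = "\<lambda>q. (\<phi> q, \<psi> q)"
  define \<Sigma> where "\<Sigma> = inv_into (\<phi> -` V) ?\<Phi>"
  have bij: "bij_betw ?\<Phi> (\<phi> -` V) (V \<times> UNIV)" and \<Phi>s: "smooth_on AQ (prod_atlas AM AG) (\<phi> -` V) ?\<Phi>"
    and \<Sigma>s: "smooth_on (prod_atlas AM AG) AQ (V \<times> UNIV) \<Sigma>"
    using diffeo by (auto simp: diffeo_on_def \<Sigma>_def)
  note inj = bij_betw_imp_inj_on[OF bij] and img = bij_betw_imp_surj_on[OF bij]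
  have \<Sigma>\<Phi>: "\<Sigma> (\<phi> q, \<psi> q) = q" if "\<phi> q \<in> V" for q
    unfolding \<Sigma>_def by (rule inv_into_f_f[OF inj]) (use that in simp)
  have \<Phi>\<Sigma>': "(\<phi> (\<Sigma> (p, g)), \<psi> (\<Sigma> (p, g))) = (p, g)" if "p \<in> V" for p g
    unfolding \<Sigma>_def by (rule f_inv_into_f[of "(p, g)" ?\<Phi>]) (simp add: img that)
  have \<Phi>\<Sigma>: "\<phi> (\<Sigma> (p, g)) = p" "\<psi> (\<Sigma> (p, g)) = g" if "p \<in> V" for p g
    using \<Phi>\<Sigma>'[OF that, of g] by simp_all
  have oV: "open (\<phi> -` V)" by (rule open_vimage[OF V(1) smooth_on_continuous[OF phi_smooth]])
  have \<psi>s: "smooth_on AQ AG (\<phi> -` V) \<psi>"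
    using smooth_on_compose[OF AQ smooth_atlas_prod[OF AM AG] AG oV open_UNIV \<Phi>s smooth_on_snd[OF AM AG]] by simp
  obtain c where c: "c \<in> AM" "m \<in> chart_dom c" using smooth_atlas_obtain_chart[OF AM] .
  let ?I = "chart_map c ` (V \<inter> chart_dom c)"
  have "open ?I" "chart_map c m \<in> ?I" using open_chart_image[OF AM c(1) V(1)] V c by auto
  then obtain r where r: "r > 0" "ball (chart_map c m) r \<subseteq> ?I" by (meson openE)
  define D where "D = ball (chart_map c m) r"
  have D: "open D" "D \<subseteq> chart_img c" using r by (auto simp: D_def)
  have DV: "chart_inv c x \<in> V" if "x \<in> D" for x
    by (rule chart_imageD(1)[OF AM c(1)]) (use r(2) that in \<open>auto simp: D_def\<close>)
  define P where "P y = \<Sigma> (chart_inv c (fst y), Exp (snd y))" for y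
  have oD: "open (D \<times> (UNIV :: 'k set))" by (intro open_Times D open_UNIV)
  have s1: "smooth_on model_atlas AM (D \<times> (UNIV :: 'k set)) (\<lambda>y. chart_inv c (fst y))"
    by (rule smooth_on_compose[OF smooth_atlas_model smooth_atlas_model AM oD open_chart_img[OF AM c(1)] _ smooth_on_chart_inv[OF AM c(1)]])
      (use D in \<open>auto simp: smooth_on_model Cinf_on_fst[OF oD]\<close>)
  have s2: "smooth_on model_atlas AG (D \<times> (UNIV :: 'k set)) (\<lambda>y. Exp (snd y))"
    by (rule smooth_on_Exp_compose[OF smooth_atlas_model oD]) (simp add: smooth_on_model Cinf_on_snd[OF oD])
  have Ps: "smooth_on model_atlas AQ (D \<times> UNIV) P" unfolding P_def
    by (rule smooth_on_compose[OF smooth_atlas_model smooth_atlas_prod[OF AM AG] AQ oD open_Times[OF V(1) open_UNIV]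
          smooth_on_Pair[OF smooth_atlas_model AM AG oD s1 s2] \<Sigma>s]) (use DV in auto)
  have \<phi>P: "\<phi> (P (x, k)) = chart_inv c x" and \<psi>P: "\<psi> (P (x, k)) = Exp k" if "x \<in> D" for x k
    using \<Phi>\<Sigma>[OF DV[OF that]] by (simp_all add: P_def)
  have actP: "l (Exp k') (P (x, k)) = P (x, k + k')" if x: "x \<in> D" for x k k'
  proof -
    have "\<phi> (l (Exp k') (P (x, k))) = chart_inv c x" using \<phi>P[OF x] by simp
    moreover have "\<psi> (l (Exp k') (P (x, k))) = Exp (k + k')"
      using equiv[of "P (x, k)" "Exp k'"] \<phi>P[OF x] \<psi>P[OF x] DV[OF x] by (simp add: Exp_add add.commute)
    ultimately show ?thesis using \<Sigma>\<Phi>[of "l (Exp k') (P (x, k))"] DV[OF x] by (simp add: P_def)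
  qed
  have surj: "\<exists>k. q = P (x, k)" if "x \<in> D" "\<phi> q = chart_inv c x" for q x
  proof -
    obtain k where "\<psi> q = Exp k" using Exp_surj[OF connected_G] .
    then have "q = P (x, k)" using \<Sigma>\<Phi>[of q] that DV[OF that(1)] by (simp add: P_def)
    then show ?thesis ..
  qed
  have loc: "\<exists>N R T. open N \<and> P (x1, k1) \<in> N \<and> smooth_on AQ model_atlas N R \<and>
       (\<forall>q\<in>N. R q \<in> D \<times> UNIV \<and> P (R q) = q) \<and>
       open T \<and> (x1, k1) \<in> T \<and> (\<forall>y\<in>T. y \<in> D \<times> UNIV \<and> P y \<in> N \<and> R (P y) = y)" if x1: "x1 \<in> D" for x1 k1
  proof -
    obtain V' Lg d where V': "open V'" "0 \<in> V'" "smooth_on AG model_atlas V' Lg" "\<And>g. g \<in> V' \<Longrightarrow> Exp (Lg g) = g"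
      and d: "d > 0" "\<And>v. norm v < d \<Longrightarrow> Exp v \<in> V'" "\<And>v. norm v < d \<Longrightarrow> Lg (Exp v) = v"
      using Exp_local_inverse by metis
    define W where "W = \<phi> -` (V \<inter> (chart_dom c \<inter> chart_map c -` D))"
    have W: "open W" unfolding W_def
      by (rule open_vimage[OF open_Int[OF V(1) open_chart_vimage[OF AM c(1) D(1)]] smooth_on_continuous[OF phi_smooth]])
    have WV: "W \<subseteq> \<phi> -` V" by (auto simp: W_def)
    have \<psi>W: "smooth_on AQ AG W (\<lambda>q. \<psi> q - Exp k1)"
      by (rule smooth_on_minus[OF AQ W smooth_on_subset[OF \<psi>s WV] smooth_on_const[OF AQ AG W]])
    define N where "N = W \<inter> (\<lambda>q. \<psi> q - Exp k1) -` V'"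
    have N: "open N" unfolding N_def by (rule continuous_open_preimage[OF smooth_on_continuous[OF \<psi>W] W V'(1)])
    \<comment> \<open>The local logarithm is available near the identity, so the group coordinate is
      first translated back by \<open>Exp k1\<close> and \<open>k1\<close> is added
      afterwards.\<close>
    define R where "R q = (chart_map c (\<phi> q), k1 + Lg (\<psi> q - Exp k1))" for q
    have R1: "smooth_on AQ model_atlas N (\<lambda>q. chart_map c (\<phi> q))"
      by (rule smooth_on_compose[OF AQ AM smooth_atlas_model N open_chart_dom[OF AM c(1)]
            smooth_on_subset[OF phi_smooth subset_UNIV] smooth_on_chart_map[OF AM c(1)]]) (simp add: N_def W_def)
    have R2: "smooth_on AQ model_atlas N (\<lambda>q. Lg (\<psi> q - Exp k1))"
      by (rule smooth_on_compose[OF AQ AG smooth_atlas_model N V'(1) smooth_on_subset[OF \<psi>W] V'(3)]) (auto simp: N_def)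
    have "smooth_on model_atlas model_atlas UNIV (\<lambda>k. k1 + k)"
      by (simp add: smooth_on_model Cinf_on_add Cinf_on_const Cinf_on_ident)
    from smooth_on_compose[OF AQ smooth_atlas_model smooth_atlas_model N open_UNIV R2 this UNIV_I]
    have R3: "smooth_on AQ model_atlas N (\<lambda>q. k1 + Lg (\<psi> q - Exp k1))" .
    have Rs: "smooth_on AQ model_atlas N R"
      using smooth_on_Pair[OF AQ smooth_atlas_model smooth_atlas_model N R1 R3] by (simp add: R_def[abs_def])
    have PN: "P y \<in> N" "R (P y) = y" if "fst y \<in> D" "norm (snd y - k1) < d" for y
    proof -
      have a: "\<phi> (P y) = chart_inv c (fst y)" "\<psi> (P y) = Exp (snd y)"
        using \<phi>P[OF that(1), of "snd y"] \<psi>P[OF that(1), of "snd y"] by simp_all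
      have b: "fst y \<in> chart_img c" using that(1) D(2) by blast
      show "P y \<in> N" "R (P y) = y"
        using that DV[OF that(1)] chart_inv_in[OF AM c(1) b] chart_map_inv[OF AM c(1) b] d(2,3)[OF that(2)]
        by (simp_all add: N_def W_def R_def a flip: Exp_diff)
    qed
    have RN: "R q \<in> D \<times> UNIV \<and> P (R q) = q" if "q \<in> N" for q
    proof -
      have q: "\<phi> q \<in> V" "\<phi> q \<in> chart_dom c" "chart_map c (\<phi> q) \<in> D" "\<psi> q - Exp k1 \<in> V'"
        using that by (simp_all add: N_def W_def)
      then show ?thesis using \<Sigma>\<Phi>[OF q(1)] V'(4)[OF q(4)] chart_inv_map[OF AM c(1) q(2)]
        by (simp add: R_def P_def Exp_add)
    qed
    have T: "open (D \<times> ball k1 d)" by (intro open_Times D open_ball)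
    have T': "y \<in> D \<times> UNIV \<and> P y \<in> N \<and> R (P y) = y" if "y \<in> D \<times> ball k1 d" for y
      using PN[of y] that by (auto simp: dist_norm norm_minus_commute)
    have mem: "(x1, k1) \<in> D \<times> ball k1 d" using x1 d(1) by simp
    show ?thesis
      by (rule exI[of _ N], rule exI[of _ R], rule exI[of _ "D \<times> ball k1 d"])
        (use N Rs RN T T' mem in blast)
  qed
  have "coords c D P" unfolding coords_def using c(1) D Ps \<phi>P actP surj loc by simp
  then show ?thesis using c(2) r(1) D_def by blast
qed

context
  fixes c D P
  assumes coords: "coords c D P"
begin

lemma coords_D: "c \<in> AM" "open D" "D \<subseteq> chart_img c" "open (D \<times> (UNIV :: 'k set))"
  and coords_smooth: "smooth_on model_atlas AQ (D \<times> UNIV) P"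
  and coords_phi: "x \<in> D \<Longrightarrow> \<phi> (P (x, k)) = chart_inv c x"
  and coords_act: "x \<in> D \<Longrightarrow> l (Exp k') (P (x, k)) = P (x, k + k')"
  and coords_surj: "x \<in> D \<Longrightarrow> \<phi> q = chart_inv c x \<Longrightarrow> \<exists>k. q = P (x, k)"
  using coords unfolding coords_def by (auto intro: open_Times)

lemma coords_local_inverse:
  assumes "x \<in> D"
  obtains N R T where "open N" "P (x, k) \<in> N" "smooth_on AQ model_atlas N R"
    "\<forall>q\<in>N. R q \<in> D \<times> UNIV \<and> P (R q) = q" "open T" "(x, k) \<in> T" "\<forall>y\<in>T. R (P y) = y"
proof -
  note loc = coords[unfolded coords_def, THEN conjunct2, THEN conjunct2, THEN conjunct2, THEN conjunct2,
      THEN conjunct2, THEN conjunct2, THEN conjunct2]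
  from bspec[OF loc assms, THEN spec, of k]
  obtain N R T where NR: "open N \<and> P (x, k) \<in> N \<and> smooth_on AQ model_atlas N R \<and>
       (\<forall>q\<in>N. R q \<in> D \<times> UNIV \<and> P (R q) = q) \<and>
       open T \<and> (x, k) \<in> T \<and> (\<forall>y\<in>T. y \<in> D \<times> UNIV \<and> P y \<in> N \<and> R (P y) = y)"
    by (elim exE)
  show thesis
    by (rule that[of N R T]) (use NR in simp_all)
qed

lemma coords_chart_at: "x \<in> D \<Longrightarrow> c \<in> charts_at AM (chart_inv c x)"
  and coords_map_inv: "x \<in> D \<Longrightarrow> chart_map c (chart_inv c x) = x"
  using coords_D chart_inv_in[OF AM coords_D(1)] chart_map_inv[OF AM coords_D(1)] by (auto simp: charts_at_iff)

text \<open>Near the point every \<open>q\<close> is \<open>P (R q)\<close>. Inserting this into a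
  chart parametrisation factors the vector through \<open>P\<close>, and \<open>w\<close> comes from
  the derivative of \<open>R\<close>.\<close>

lemma coords_tangent_obtain:
  assumes x: "x \<in> D" and v: "v \<in> tangent_space AQ (P (x, k))"
  obtains w where "v = pushv AQ P (x, k) w"
proof -
  obtain N R T where NRT: "open N" "P (x, k) \<in> N" "smooth_on AQ model_atlas N R"
    "\<forall>q\<in>N. R q \<in> D \<times> UNIV \<and> P (R q) = q" "open T" "(x, k) \<in> T" "\<forall>y\<in>T. R (P y) = y"
    by (rule coords_local_inverse[OF x])
  note N = NRT(1-3) NRT(4)[THEN bspec, THEN conjunct1] NRT(4)[THEN bspec, THEN conjunct2]
  note T = NRT(5,6) NRT(7)[THEN bspec]
  obtain e where e: "e \<in> AQ" "P (x, k) \<in> chart_dom e" using smooth_atlas_obtain_chart[OF AQ] .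
  then have ea: "e \<in> charts_at AQ (P (x, k))" by (simp add: charts_at_iff)
  let ?z = "chart_map e (P (x, k))"
  have ez: "chart_inv e ?z = P (x, k)" by (rule chart_inv_map[OF AQ e])
  have Rq: "R (P (x, k)) = (x, k)" by (rule T(3)[OF T(2)])
  have h: "((\<lambda>z. R (chart_inv e z)) has_derivative FD (\<lambda>z. R (chart_inv e z)) ?z) (at ?z)"
    using chart_rep_has_derivative[OF AQ smooth_atlas_model N(1,3,2) ea model_chart_at] by simp
  let ?O = "chart_map e ` (N \<inter> chart_dom e)"
  have O: "open ?O" "?z \<in> ?O" using open_chart_image[OF AQ e(1) N(1)] N(2) e(2) by auto
  have "v = pushv AQ (chart_inv e) ?z (v e)" by (rule tangent_eq_pushv[OF AQ v ea])
  also have "\<dots> = pushv AQ (\<lambda>z. P (R (chart_inv e z))) ?z (v e)"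
    by (rule pushv_cong[OF O]) (simp add: N(5)[OF chart_imageD(1)[OF AQ e(1)]])
  also have "\<dots> = pushv AQ P (R (chart_inv e ?z)) (FD (\<lambda>z. R (chart_inv e z)) ?z (v e))"
    by (rule pushv_chain[OF AQ coords_D(4) coords_smooth _ h]) (use N(2,4) in \<open>simp add: ez\<close>)
  finally show thesis using that by (simp add: ez Rq)
qed

text \<open>The tangent map of the local inverse \<open>R\<close> recovers \<open>w\<close>.\<close>

lemma coords_pushv_inj:
  assumes x: "x \<in> D" and eq: "pushv AQ P (x, k) w = pushv AQ P (x, k) w'"
  shows "w = w'"
proof -
  obtain N R T where NRT: "open N" "P (x, k) \<in> N" "smooth_on AQ model_atlas N R"
    "\<forall>q\<in>N. R q \<in> D \<times> UNIV \<and> P (R q) = q" "open T" "(x, k) \<in> T" "\<forall>y\<in>T. R (P y) = y"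
    by (rule coords_local_inverse[OF x])
  note N = NRT(1-3) NRT(4)[THEN bspec, THEN conjunct1] NRT(4)[THEN bspec, THEN conjunct2]
  note T = NRT(5,6) NRT(7)[THEN bspec]
  have "tangent_map AQ model_atlas R (P (x, k)) (pushv AQ P (x, k) w) (UNIV, \<lambda>x. x) = w" for w
  proof -
    have "FD (\<lambda>y. R (P y)) (x, k) = FD (\<lambda>y. y) (x, k)" by (rule FD_cong[OF T(1,2)]) (rule T(3))
    then show ?thesis
      using tangent_map_pushv[OF AQ smooth_atlas_model coords_D(4) coords_smooth _ N(1,3,2), of w] x
      by (simp add: pushv_model)
  qed
  then show ?thesis using eq by metis
qed

lemma coords_pushv_in: "x \<in> D \<Longrightarrow> pushv AQ P (x, k) w \<in> tangent_space AQ (P (x, k))"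
  by (rule pushv_in[OF AQ coords_D(4) coords_smooth]) simp

lemma coords_fund_field:
  assumes x: "x \<in> D"
  shows "fund_field AG AQ l (lalg \<kappa>) (P (x, k)) = pushv AQ P (x, k) (0, \<kappa>)"
proof -
  have h: "((\<lambda>t. (x, k + t *\<^sub>R \<kappa>)) has_vector_derivative (0, \<kappa>)) (at 0)"
    by (auto intro!: derivative_eq_intros has_vector_derivative_Pair)
  have "fund_field AG AQ l (lalg \<kappa>) (P (x, k)) = velocity AQ (\<lambda>t. P (x, k + t *\<^sub>R \<kappa>)) 0"
    by (simp add: fund_field_def lie_exp_tscale_lalg coords_act[OF x])
  also have "\<dots> = pushv AQ P (x, k + 0 *\<^sub>R \<kappa>) (0, \<kappa>)"
    by (rule velocity_eq_pushv[OF AQ coords_D(4) coords_smooth _ h]) (use x in simp)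
  finally show ?thesis by simp
qed

text \<open>In these coordinates \<open>Exp k'\<close> acts as translation by
  \<open>(0, k')\<close>, whose derivative is the identity.\<close>

lemma coords_act_pushv:
  assumes x: "x \<in> D"
  shows "tangent_map AQ AQ (l (Exp k')) (P (x, k)) (pushv AQ P (x, k) w) = pushv AQ P (x, k + k') w"
proof -
  have "tangent_map AQ AQ (l (Exp k')) (P (x, k)) (pushv AQ P (x, k) w) = pushv AQ (\<lambda>y. l (Exp k') (P y)) (x, k) w"
    by (rule tangent_map_pushv[OF AQ AQ coords_D(4) coords_smooth _ open_UNIV act_smooth_right UNIV_I]) (use x in simp)
  also have "\<dots> = pushv AQ (\<lambda>y. P (y + (0, k'))) (x, k) w"
    by (rule pushv_cong[OF coords_D(4)]) (use x coords_act in \<open>auto simp: split_beta\<close>)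
  also have "\<dots> = pushv AQ P ((x, k) + (0, k')) w"
    by (rule pushv_chain[OF AQ coords_D(4) coords_smooth]) (use x in \<open>auto intro!: derivative_eq_intros\<close>)
  finally show ?thesis by simp
qed

lemma coords_phi_pushv:
  assumes x: "x \<in> D"
  shows "tangent_map AQ AM \<phi> (P (x, k)) (pushv AQ P (x, k) w) = pushv AM (chart_inv c) x (fst w)"
proof -
  have "tangent_map AQ AM \<phi> (P (x, k)) (pushv AQ P (x, k) w) = pushv AM (\<lambda>y. \<phi> (P y)) (x, k) w"
    by (rule tangent_map_pushv[OF AQ AM coords_D(4) coords_smooth _ open_UNIV phi_smooth UNIV_I]) (use x in simp)
  also have "\<dots> = pushv AM (\<lambda>y. chart_inv c (fst y)) (x, k) w"
    by (rule pushv_cong[OF coords_D(4)]) (use x coords_phi in \<open>auto simp: split_beta\<close>)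
  also have "\<dots> = pushv AM (chart_inv c) (fst (x, k)) (fst w)"
    by (rule pushv_chain[OF AM open_chart_img[OF AM coords_D(1)] smooth_on_chart_inv[OF AM coords_D(1)]])
      (use x coords_D(3) in \<open>auto intro!: derivative_eq_intros\<close>)
  finally show ?thesis by simp
qed

lemma coords_base_app: "x \<in> D \<Longrightarrow> pushv AM (chart_inv c) x u c = u"
  using FD_transition_self[OF AM coords_chart_at] coords_chart_at coords_map_inv by (simp add: pushv_def)

lemma coords_base_in: "x \<in> D \<Longrightarrow> pushv AM (chart_inv c) x u \<in> tangent_space AM (chart_inv c x)"
  using pushv_in[OF AM open_chart_img[OF AM coords_D(1)] smooth_on_chart_inv[OF AM coords_D(1)]] coords_D(3) by blast

lemma coords_base_eq:
  "x \<in> D \<Longrightarrow> u \<in> tangent_space AM (chart_inv c x) \<Longrightarrow> u = pushv AM (chart_inv c) x (u c)"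
  using tangent_eq_pushv[OF AM _ coords_chart_at, of u x] coords_map_inv by simp

end

lemma lalg_inj: "lalg k = lalg k' \<Longrightarrow> k = k'"
  using lalg_gc by metis

lemma tadd_lalg: "tadd (lalg k) (lalg k') = lalg (k + k')"
  by (rule tangent_eqI[OF tadd_in[OF AG lalg_in lalg_in] lalg_in gc_at]) (simp add: tadd_def)

lemma obtain_coords:
  obtains c D P x where "coords c D P" "x \<in> D" "m = chart_inv c x"
proof -
  obtain c D P r where c: "coords c D P" "m \<in> chart_dom c" "D = ball (chart_map c m) r" "r > 0"
    using coords_exist by blast
  then show thesis using that[of c D P "chart_map c m"] chart_inv_map[OF AM coords_D(1)[OF c(1)] c(2)] by simp
qed

lemma fibre_eq_orbit: "{q'. \<phi> q' = \<phi> q} = range (\<lambda>g. l g q)"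
proof (intro equalityI subsetI)
  fix q' assume "q' \<in> {q'. \<phi> q' = \<phi> q}"
  then have q': "\<phi> q' = \<phi> q" by simp
  obtain c D P x where c: "coords c D P" "x \<in> D" "\<phi> q = chart_inv c x" using obtain_coords .
  obtain k where k: "q = P (x, k)" using coords_surj[OF c] by blast
  obtain k' where k': "q' = P (x, k')" using coords_surj[OF c(1,2), of q'] q' c(3) by auto
  have "q' = l (Exp (k' - k)) q" using coords_act[OF c(1,2), of "k' - k" k] by (simp add: k k')
  then show "q' \<in> range (\<lambda>g. l g q)" by (rule range_eqI)
qed auto

lemma fibre_nonempty: "\<exists>q. \<phi> q = m"
proof -
  obtain c D P x where c: "coords c D P" "x \<in> D" "m = chart_inv c x" using obtain_coords .
  then show ?thesis using coords_phi[OF c(1,2), of 0] by blast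
qed

end

section \<open>Connection forms in local coordinates and their curvature\<close>

context abelian_bundle
begin

context
  fixes A
  assumes conn: "connection_form AG AQ l A"
begin

lemma conn_in: "v \<in> tangent_space AQ q \<Longrightarrow> A q v \<in> lie_algebra AG"
  and conn_tadd: "v \<in> tangent_space AQ q \<Longrightarrow> w \<in> tangent_space AQ q \<Longrightarrow> A q (tadd v w) = tadd (A q v) (A q w)"
  and conn_tscale: "v \<in> tangent_space AQ q \<Longrightarrow> A q (tscale r v) = tscale r (A q v)"
  and conn_smooth: "e \<in> AQ \<Longrightarrow> Cinf_on (chart_img e \<times> UNIV)
        (\<lambda>(x, v). A (chart_inv e x) (tvec_of AQ (chart_inv e x) e v) gc)"
  and conn_fund: "A q (fund_field AG AQ l (lalg k) q) = lalg k"
  and conn_inv: "v \<in> tangent_space AQ q \<Longrightarrow> A (l g q) (tangent_map AQ AQ (l g) q v) = A q v"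
  using conn gc_at lalg_in unfolding connection_form_def by blast+

end

text \<open>The horizontal part of a connection form in the coordinates \<open>P\<close>; it does not depend on \<open>k\<close>.\<close>

definition conn_coeff :: "('q \<Rightarrow> ('q, 'e) tvec \<Rightarrow> ('g, 'k) tvec) \<Rightarrow> ('b \<times> 'k \<Rightarrow> 'q) \<Rightarrow> 'b \<Rightarrow> 'b \<Rightarrow> 'k" where
  "conn_coeff A P x u = A (P (x, 0)) (pushv AQ P (x, 0) (u, 0)) gc"

text \<open>The exterior derivative of the coefficient form, evaluated on the constant fields
  \<open>u\<close> and \<open>v\<close>.\<close>

definition conn_curv :: "('q \<Rightarrow> ('q, 'e) tvec \<Rightarrow> ('g, 'k) tvec) \<Rightarrow> ('b \<times> 'k \<Rightarrow> 'q) \<Rightarrow> 'b \<Rightarrow> 'b \<Rightarrow> 'b \<Rightarrow> 'k" where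
  "conn_curv A P x u v = FD (\<lambda>x. conn_coeff A P x v) x u - FD (\<lambda>x. conn_coeff A P x u) x v"

context
  fixes A c D P
  assumes conn: "connection_form AG AQ l A" and coords: "coords c D P"
begin

text \<open>In coordinates a connection form is dk plus a form in x: its values on fundamental
  fields give the first summand, and invariance under translations in k frees the second from
  k.\<close>

lemma conn_coords:
  assumes x: "x \<in> D"
  shows "A (P (x, k)) (pushv AQ P (x, k) (u, \<kappa>)) = lalg (\<kappa> + conn_coeff A P x u)"
proof -
  note pin = coords_pushv_in[OF coords x]
  have 1: "pushv AQ P (x, k) (u, \<kappa>) = tadd (pushv AQ P (x, k) (0, \<kappa>)) (pushv AQ P (x, k) (u, 0))"
    using pushv_add[OF AQ coords_D(4)[OF coords] coords_smooth[OF coords], of "(x, k)" "(0, \<kappa>)" "(u, 0)"] x by simp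
  have "A (P (x, k)) (pushv AQ P (x, k) (u, 0)) =
      A (l (Exp k) (P (x, 0))) (tangent_map AQ AQ (l (Exp k)) (P (x, 0)) (pushv AQ P (x, 0) (u, 0)))"
    by (simp add: coords_act_pushv[OF coords x] coords_act[OF coords x])
  also have "\<dots> = A (P (x, 0)) (pushv AQ P (x, 0) (u, 0))" by (rule conn_inv[OF conn pin])
  also have "\<dots> = lalg (conn_coeff A P x u)"
    unfolding conn_coeff_def by (rule lie_algebra_eq_lalg[OF conn_in[OF conn pin]])
  finally have 2: "A (P (x, k)) (pushv AQ P (x, k) (u, 0)) = lalg (conn_coeff A P x u)" .
  have "A (P (x, k)) (pushv AQ P (x, k) (0, \<kappa>)) = lalg \<kappa>"
    unfolding coords_fund_field[OF coords x, symmetric] by (rule conn_fund[OF conn])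
  then show ?thesis unfolding 1 conn_tadd[OF conn pin pin] 2 by (simp add: tadd_lalg)
qed

lemma conn_coeff_linear:
  assumes x: "x \<in> D"
  shows "linear (conn_coeff A P x)"
proof (rule linearI)
  note pin = coords_pushv_in[OF coords x]
  note add = pushv_add[OF AQ coords_D(4)[OF coords] coords_smooth[OF coords]]
  note scale = pushv_scale[OF AQ coords_D(4)[OF coords] coords_smooth[OF coords]]
  show "conn_coeff A P x (u + v) = conn_coeff A P x u + conn_coeff A P x v" for u v
  proof -
    have "pushv AQ P (x, 0) (u + v, 0) = tadd (pushv AQ P (x, 0) (u, 0)) (pushv AQ P (x, 0) (v, 0))"
      using add[where y = "(x, 0)" and v = "(u, 0)" and w = "(v, 0)"] x by simp
    then show ?thesis
      by (simp only: conn_coeff_def conn_tadd[OF conn pin pin]) (simp only: tadd_def)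
  qed
  show "conn_coeff A P x (r *\<^sub>R u) = r *\<^sub>R conn_coeff A P x u" for r u
  proof -
    have "pushv AQ P (x, 0) (r *\<^sub>R u, 0) = tscale r (pushv AQ P (x, 0) (u, 0))"
      using scale[where y = "(x, 0)" and v = "(u, 0)" and r = r] x by simp
    then show ?thesis
      by (simp only: conn_coeff_def conn_tscale[OF conn pin]) (simp only: tscale_def)
  qed
qed

text \<open>Smoothness of \<open>A\<close> is given in charts of the tangent bundle. The smooth map
  inserted there sends \<open>x\<close> to the chart coordinates of \<open>P (x, 0)\<close> together
  with those of the tangent vector along \<open>(u, 0)\<close>.\<close>

lemma conn_coeff_Cinf: "Cinf_on D (\<lambda>x. conn_coeff A P x u)"
proof (rule Cinf_on_local)
  fix x0 assume x0: "x0 \<in> D"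
  note D = coords_D[OF coords]
  obtain e where e: "e \<in> AQ" "P (x0, 0) \<in> chart_dom e" using smooth_atlas_obtain_chart[OF AQ] .
  let ?S = "{y \<in> D \<times> UNIV. P y \<in> chart_dom e}"
  have "open (D \<times> UNIV \<inter> P -` chart_dom e)"
    by (rule continuous_open_preimage[OF smooth_on_continuous[OF coords_smooth[OF coords]] D(4) open_chart_dom[OF AQ e(1)]])
  then have S: "open ?S" by (simp add: Int_def vimage_def)
  have f: "Cinf_on ?S (\<lambda>y. chart_map e (P y))" by (rule pushv_Cinf[OF AQ coords_smooth[OF coords] e(1)]) auto
  let ?N = "(\<lambda>x. (x, 0)) -` ?S"
  have "open ?N" by (rule open_vimage[OF S]) (intro continuous_intros)
  moreover have "x0 \<in> ?N" using x0 e(2) by simp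
  ultimately have N: "open ?N" "x0 \<in> ?N" .
  have i: "Cinf_on ?N (\<lambda>x. (x, 0::'k))" by (intro Cinf_on_Pair N Cinf_on_ident Cinf_on_const)
  have "Cinf_on ?N (\<lambda>x. (chart_map e (P (x, 0)), FD (\<lambda>y. chart_map e (P y)) (x, 0) (u, 0)))"
  proof (rule Cinf_on_Pair[OF N(1)])
    show "Cinf_on ?N (\<lambda>x. chart_map e (P (x, 0)))"
      by (rule Cinf_on_compose[OF N(1) S _ i f]) simp
    show "Cinf_on ?N (\<lambda>x. FD (\<lambda>y. chart_map e (P y)) (x, 0) (u, 0))"
      by (rule Cinf_on_FD_apply[OF S N(1) f i Cinf_on_const[OF N(1)]]) simp
  qed
  from Cinf_on_compose[OF N(1) open_Times[OF open_chart_img[OF AQ e(1)] open_UNIV] _ this conn_smooth[OF conn e(1)]]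
  have "Cinf_on ?N (\<lambda>x. A (chart_inv e (chart_map e (P (x, 0)))) (tvec_of AQ (chart_inv e (chart_map e (P (x, 0)))) e
      (FD (\<lambda>y. chart_map e (P y)) (x, 0) (u, 0))) gc)" by simp
  then have "Cinf_on ?N (\<lambda>x. conn_coeff A P x u)"
  proof (rule Cinf_on_congD[OF N(1)])
    fix x assume "x \<in> ?N"
    then have x: "x \<in> D" "P (x, 0) \<in> chart_dom e" by auto
    then have ea: "e \<in> charts_at AQ (P (x, 0))" using e(1) by (simp add: charts_at_iff)
    have "pushv AQ P (x, 0) (u, 0) = tvec_of AQ (P (x, 0)) e (pushv AQ P (x, 0) (u, 0) e)"
      by (rule tangent_eq_tvec_of[OF AQ coords_pushv_in[OF coords x(1)] ea])
    also have "pushv AQ P (x, 0) (u, 0) e = FD (\<lambda>y. chart_map e (P y)) (x, 0) (u, 0)"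
      using ea by (simp add: pushv_def)
    finally show "A (chart_inv e (chart_map e (P (x, 0)))) (tvec_of AQ (chart_inv e (chart_map e (P (x, 0)))) e
      (FD (\<lambda>y. chart_map e (P y)) (x, 0) (u, 0))) gc = conn_coeff A P x u"
      by (simp add: conn_coeff_def chart_inv_map[OF AQ e(1) x(2)])
  qed
  then show "\<exists>N. open N \<and> x0 \<in> N \<and> Cinf_on N (\<lambda>x. conn_coeff A P x u)" using N by blast
qed

text \<open>Lifts of the same vector differ in the vertical coordinate only, and subtracting the
  vertical part cancels it. The lift selected by \<open>SOME\<close> is therefore
  immaterial.\<close>

lemma horizontal_lift_coords:
  assumes x: "x \<in> D"
  shows "horizontal_lift AG AQ AM l \<phi> A (P (x, k)) (pushv AM (chart_inv c) x u) =
    pushv AQ P (x, k) (u, - conn_coeff A P x u)"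
proof -
  let ?q = "P (x, k)" and ?u = "pushv AM (chart_inv c) x u"
  define v where "v = (SOME v. v \<in> tangent_space AQ ?q \<and> tangent_map AQ AM \<phi> ?q v = ?u)"
  have ex: "\<exists>v. v \<in> tangent_space AQ ?q \<and> tangent_map AQ AM \<phi> ?q v = ?u"
    by (rule exI[of _ "pushv AQ P (x, k) (u, 0)"])
      (simp add: coords_pushv_in[OF coords x] coords_phi_pushv[OF coords x])
  have "v \<in> tangent_space AQ ?q \<and> tangent_map AQ AM \<phi> ?q v = ?u"
    unfolding v_def by (rule someI_ex[OF ex])
  then have v: "v \<in> tangent_space AQ ?q" "tangent_map AQ AM \<phi> ?q v = ?u" by auto
  obtain w where w: "v = pushv AQ P (x, k) w" using coords_tangent_obtain[OF coords x v(1)] .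
  have "pushv AM (chart_inv c) x (fst w) = ?u" using v(2) by (simp add: w coords_phi_pushv[OF coords x])
  then have fw: "fst w = u" using coords_base_app[OF coords x] by metis
  have "w = (u, snd w)" using fw by (simp add: prod_eq_iff)
  then have vw: "v = pushv AQ P (x, k) (u, snd w)" using w by (simp only:)
  have Aq: "A ?q v = lalg (snd w + conn_coeff A P x u)"
    unfolding vw by (rule conn_coords[OF x])
  have "horizontal_lift AG AQ AM l \<phi> A ?q ?u = tdiff v (fund_field AG AQ l (A ?q v) ?q)"
    unfolding horizontal_lift_def v_def[symmetric] Let_def by (rule refl)
  also have "\<dots> = tdiff (pushv AQ P (x, k) w) (pushv AQ P (x, k) (0, snd w + conn_coeff A P x u))"
    unfolding Aq coords_fund_field[OF coords x] unfolding w by (rule refl)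
  also have "\<dots> = pushv AQ P (x, k) (w - (0, snd w + conn_coeff A P x u))"
    by (rule pushv_diff[OF AQ coords_D(4)[OF coords] coords_smooth[OF coords], symmetric]) (use x in simp)
  finally have hl: "horizontal_lift AG AQ AM l \<phi> A ?q ?u = pushv AQ P (x, k) (w - (0, snd w + conn_coeff A P x u))" .
  have "w - (0, snd w + conn_coeff A P x u) = (u, - conn_coeff A P x u)"
    using fw by (simp add: prod_eq_iff)
  with hl show ?thesis by (simp only:)
qed

end

text \<open>In coordinates a horizontal lift does not depend on \<open>k\<close>, so the action
  carries the lift at one point of the fibre to the lift at any other. The point selected by
  \<open>SOME\<close> is therefore immaterial.\<close>

lemma splitting_eq:
  assumes conn: "connection_form AG AQ l A" and u: "u \<in> tangent_space AM m"
  shows "splitting AG AQ AM l \<phi> A m u = {(q, horizontal_lift AG AQ AM l \<phi> A q u) | q. \<phi> q = m}"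
proof -
  obtain c D P x where c: "coords c D P" "x \<in> D" "m = chart_inv c x" using obtain_coords .
  let ?H = "\<lambda>q. horizontal_lift AG AQ AM l \<phi> A q u"
  define q0 where "q0 = (SOME q. \<phi> q = m)"
  have q0: "\<phi> q0 = m" unfolding q0_def by (rule someI_ex[OF fibre_nonempty])
  have u': "u = pushv AM (chart_inv c) x (u c)" by (rule coords_base_eq[OF c(1,2)]) (use u c(3) in simp)
  have HP: "?H (P (x, k)) = pushv AQ P (x, k) (u c, - conn_coeff A P x (u c))" for k
    using horizontal_lift_coords[OF conn c(1,2), of k "u c"] u' by simp
  have "\<phi> q0 = chart_inv c x" using q0 c(3) by simp
  then obtain k0 where k0: "q0 = P (x, k0)" using coords_surj[OF c(1,2)] by blast
  have act: "(l g q0, tangent_map AQ AQ (l g) q0 (?H q0)) = (l g q0, ?H (l g q0))" for g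
  proof -
    obtain \<kappa> where "g = Exp \<kappa>" using Exp_surj[OF connected_G] .
    then show ?thesis by (simp add: k0 HP coords_act_pushv[OF c(1,2)] coords_act[OF c(1,2)])
  qed
  have "splitting AG AQ AM l \<phi> A m u = range (\<lambda>g. (l g q0, ?H (l g q0)))"
    by (simp add: splitting_def Let_def q0_def[symmetric] TQ_orbit_def act)
  also have "\<dots> = (\<lambda>q. (q, ?H q)) ` range (\<lambda>g. l g q0)" by (simp add: image_image)
  also have "range (\<lambda>g. l g q0) = {q. \<phi> q = m}" using fibre_eq_orbit[of q0] q0 by simp
  finally show ?thesis by auto
qed

text \<open>By \<open>splitting_eq\<close> the section is the graph of the horizontal lift over each
  fibre, which leaves exactly one candidate for the definite description.\<close>

lemma field_of_section_splitting:
  assumes conn: "connection_form AG AQ l A" and X: "\<And>m. X m \<in> tangent_space AM m"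
  shows "field_of_section \<phi> (\<lambda>m. splitting AG AQ AM l \<phi> A m (X m)) q = horizontal_lift AG AQ AM l \<phi> A q (X (\<phi> q))"
  by (simp add: field_of_section_def splitting_eq[OF conn X])

text \<open>Horizontal fields have coordinates (X, -aX) with a the coefficient form. In the vertical
  component of their bracket the derivatives of X and Y assemble to -a[X, Y], which the lift of
  [X, Y] cancels; the derivatives of a remain and form its exterior derivative.\<close>

lemma lie_bracket_horizontal:
  assumes conn: "connection_form AG AQ l A" and coords: "coords c D P" and x: "x \<in> D"
    and X: "smooth_vector_field AM X" and Y: "smooth_vector_field AM Y"
  defines "HX \<equiv> \<lambda>q. horizontal_lift AG AQ AM l \<phi> A q (X (\<phi> q))"
    and "HY \<equiv> \<lambda>q. horizontal_lift AG AQ AM l \<phi> A q (Y (\<phi> q))"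
    and "m \<equiv> chart_inv c x"
  shows "tdiff (horizontal_lift AG AQ AM l \<phi> A (P (x, k)) (lie_bracket AM X Y m)) (lie_bracket AQ HX HY (P (x, k)))
    = pushv AQ P (x, k) (0, conn_curv A P x (X m c) (Y m c))"
proof -
  note D = coords_D[OF coords] and Ps = coords_smooth[OF coords]
  let ?a = "conn_coeff A P"
  have mx: "chart_map c m = x" unfolding m_def by (rule coords_map_inv[OF coords x])
  have xy: "(x, k) \<in> D \<times> UNIV" using x by simp
  define W where "W Z y = (Z (chart_inv c (fst y)) c, - ?a (fst y) (Z (chart_inv c (fst y)) c))"
    for Z :: "'m \<Rightarrow> ('m, 'b) tvec" and y :: "'b \<times> 'k"
  define H where "H Z q = horizontal_lift AG AQ AM l \<phi> A q (Z (\<phi> q))" for Z q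
  have ZC: "Cinf_on D (\<lambda>x. Z (chart_inv c x) c)" if "smooth_vector_field AM Z" for Z
    by (rule Cinf_on_subset[OF vector_field_Cinf[OF that D(1)] D(3)])
  have aZC: "Cinf_on D (\<lambda>x. ?a x (Z (chart_inv c x) c))" if "smooth_vector_field AM Z" for Z
    by (rule Cinf_on_linear_family[OF D(2) conn_coeff_Cinf[OF conn coords] conn_coeff_linear[OF conn coords] ZC[OF that]])
  have WC: "Cinf_on (D \<times> UNIV) (W Z)" if Z: "smooth_vector_field AM Z" for Z
  proof -
    have "Cinf_on D (\<lambda>x. (Z (chart_inv c x) c, - ?a x (Z (chart_inv c x) c)))"
      by (intro Cinf_on_Pair Cinf_on_minus D ZC[OF Z] aZC[OF Z])
    from Cinf_on_compose[OF D(4) D(2) _ Cinf_on_fst[OF D(4)] this] show ?thesis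
      unfolding W_def[abs_def] by auto
  qed
  have rel: "H Z (P y) = pushv AQ P y (W Z y)" if Z: "smooth_vector_field AM Z" and y: "y \<in> D \<times> UNIV" for Z y
  proof -
    obtain x' k' where y': "y = (x', k')" "x' \<in> D" using y by auto
    have "x' \<in> chart_img c" using y'(2) D(3) by blast
    then have "Z (chart_inv c x') = pushv AM (chart_inv c) x' (Z (chart_inv c x') c)"
      by (rule vector_field_eq_pushv[OF AM Z D(1)])
    then show ?thesis
      using horizontal_lift_coords[OF conn coords y'(2), of k' "Z (chart_inv c x') c"] coords_phi[OF coords y'(2)]
      by (simp add: H_def W_def y'(1))
  qed
  \<comment> \<open>The fields are known in the coordinates \<open>P\<close>, whereas the bracket is
    taken in charts of \<open>AQ\<close>; the local inverse \<open>R\<close> mediates between the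
    two.\<close>
  have diff: "(\<lambda>z. H Z (chart_inv e z) e) differentiable (at (chart_map e (P (x, k))))"
    if Z: "smooth_vector_field AM Z" and ea: "e \<in> charts_at AQ (P (x, k))" for Z e
  proof -
    have e: "e \<in> AQ" "P (x, k) \<in> chart_dom e" using ea by (simp_all add: charts_at_iff)
    obtain N R T where NRT: "open N" "P (x, k) \<in> N" "smooth_on AQ model_atlas N R"
      "\<forall>q\<in>N. R q \<in> D \<times> UNIV \<and> P (R q) = q" "open T" "(x, k) \<in> T" "\<forall>y\<in>T. R (P y) = y"
      by (rule coords_local_inverse[OF coords x])
    note N = NRT(1-3) NRT(4)[THEN bspec, THEN conjunct1] NRT(4)[THEN bspec, THEN conjunct2]
    note T = NRT(5,6) NRT(7)[THEN bspec]
    let ?O = "chart_map e ` (N \<inter> chart_dom e)"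
    have O: "open ?O" "chart_map e (P (x, k)) \<in> ?O" using open_chart_image[OF AQ e(1) N(1)] N(2) e(2) by auto
    note OD = chart_imageD[OF AQ e(1), of _ N]
    let ?S = "{y \<in> D \<times> UNIV. P y \<in> chart_dom e}"
    have "open (D \<times> UNIV \<inter> P -` chart_dom e)"
      by (rule continuous_open_preimage[OF smooth_on_continuous[OF Ps] D(4) open_chart_dom[OF AQ e(1)]])
    then have S: "open ?S" by (simp add: Int_def vimage_def)
    have f: "Cinf_on ?S (\<lambda>y. chart_map e (P y))" by (rule pushv_Cinf[OF AQ Ps e(1)]) auto
    have "Cinf_on (chart_map e ` (N \<inter> chart_dom e)) (\<lambda>z. chart_map (UNIV, \<lambda>x. x) (R (chart_inv e z)))"
      by (rule smooth_onD[OF N(3) e(1)]) (simp_all add: model_atlas_def)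
    then have h: "Cinf_on ?O (\<lambda>z. R (chart_inv e z))" by simp
    have RS: "R (chart_inv e z) \<in> ?S" if "z \<in> ?O" for z
      using N(4,5)[OF OD(1)[OF that]] OD(2)[OF that] by simp
    have hW: "Cinf_on ?O (\<lambda>z. W Z (R (chart_inv e z)))"
      by (rule Cinf_on_compose[OF O(1) D(4) _ h WC[OF Z]]) (rule N(4)[OF OD(1)])
    have "Cinf_on ?O (\<lambda>z. FD (\<lambda>y. chart_map e (P y)) (R (chart_inv e z)) (W Z (R (chart_inv e z))))"
      by (rule Cinf_on_FD_apply[OF S O(1) f h hW RS])
    then have "Cinf_on ?O (\<lambda>z. H Z (chart_inv e z) e)"
    proof (rule Cinf_on_congD[OF O(1)])
      fix z assume z: "z \<in> ?O"
      have "H Z (chart_inv e z) = H Z (P (R (chart_inv e z)))" using N(5)[OF OD(1)[OF z]] by simp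
      also have "\<dots> = pushv AQ P (R (chart_inv e z)) (W Z (R (chart_inv e z)))"
        by (rule rel[OF Z N(4)[OF OD(1)[OF z]]])
      finally show "FD (\<lambda>y. chart_map e (P y)) (R (chart_inv e z)) (W Z (R (chart_inv e z))) = H Z (chart_inv e z) e"
        using N(5)[OF OD(1)[OF z]] OD(2)[OF z] e(1) by (simp add: pushv_def charts_at_iff)
    qed
    from differentiableI[OF Cinf_on_has_derivative[OF this O(2)]] show ?thesis .
  qed
  have Wd: "(W Z has_derivative (\<lambda>w. (FD (\<lambda>x. Z (chart_inv c x) c) x (fst w),
      - (FD (\<lambda>x. ?a x (Z m c)) x (fst w) + ?a x (FD (\<lambda>x. Z (chart_inv c x) c) x (fst w)))))) (at (x, k))"
    if Z: "smooth_vector_field AM Z" for Z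
  proof -
    have z: "((\<lambda>x. Z (chart_inv c x) c) has_derivative FD (\<lambda>x. Z (chart_inv c x) c) x) (at x)"
      by (rule Cinf_on_has_derivative[OF ZC[OF Z] x])
    have "((\<lambda>y. ?a y (Z (chart_inv c y) c)) has_derivative
        (\<lambda>u. FD (\<lambda>y. ?a y (Z (chart_inv c x) c)) x u + ?a x (FD (\<lambda>x. Z (chart_inv c x) c) x u))) (at x)"
      by (rule has_derivative_linear_family[OF D(2) x conn_coeff_linear[OF conn coords]
            differentiableI[OF Cinf_on_has_derivative[OF conn_coeff_Cinf[OF conn coords] x]] z])
    from has_derivative_Pair[OF z has_derivative_minus[OF this]]
    have "((\<lambda>y. (Z (chart_inv c y) c, - ?a y (Z (chart_inv c y) c))) has_derivative
      (\<lambda>u. (FD (\<lambda>x. Z (chart_inv c x) c) x u,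
        - (FD (\<lambda>y. ?a y (Z m c)) x u + ?a x (FD (\<lambda>x. Z (chart_inv c x) c) x u))))) (at (fst (x, k)))"
      by (simp add: m_def)
    from has_derivative_compose[OF has_derivative_fst[OF has_derivative_ident] this]
    show ?thesis unfolding W_def[abs_def] by simp
  qed
  let ?B = "FD (\<lambda>x. Y (chart_inv c x) c) x (X m c) - FD (\<lambda>x. X (chart_inv c x) c) x (Y m c)"
  note lin = conn_coeff_linear[OF conn coords x]
  have "lie_bracket AQ (H X) (H Y) (P (x, k)) =
      pushv AQ P (x, k) (FD (W Y) (x, k) (W X (x, k)) - FD (W X) (x, k) (W Y (x, k)))"
    by (rule lie_bracket_pushv[OF AQ D(4) Ps xy differentiableI[OF Wd[OF X]] differentiableI[OF Wd[OF Y]]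
          diff[OF X] diff[OF Y] rel[OF X] rel[OF Y]])
  also have "FD (W Y) (x, k) (W X (x, k)) - FD (W X) (x, k) (W Y (x, k)) =
      (?B, - ?a x ?B - conn_curv A P x (X m c) (Y m c))"
    unfolding FD_eq[OF Wd[OF X]] FD_eq[OF Wd[OF Y]]
    by (simp add: W_def m_def[symmetric] conn_curv_def linear_diff[OF lin] algebra_simps)
  finally have LB: "lie_bracket AQ HX HY (P (x, k)) = pushv AQ P (x, k) (?B, - ?a x ?B - conn_curv A P x (X m c) (Y m c))"
    by (simp add: H_def[abs_def] HX_def HY_def)
  have "lie_bracket AM X Y m = pushv AM (chart_inv c) x ?B"
    using lie_bracket_chart[OF AM X Y coords_chart_at[OF coords x]] by (simp add: mx flip: m_def)
  then have hl: "horizontal_lift AG AQ AM l \<phi> A (P (x, k)) (lie_bracket AM X Y m) = pushv AQ P (x, k) (?B, - ?a x ?B)"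
    by (simp add: horizontal_lift_coords[OF conn coords x])
  have "tdiff (horizontal_lift AG AQ AM l \<phi> A (P (x, k)) (lie_bracket AM X Y m)) (lie_bracket AQ HX HY (P (x, k)))
    = pushv AQ P (x, k) ((?B, - ?a x ?B) - (?B, - ?a x ?B - conn_curv A P x (X m c) (Y m c)))"
    unfolding hl LB by (rule pushv_diff[OF AQ D(4) Ps xy, symmetric])
  then show ?thesis by simp
qed

text \<open>For the definite description to denote, the prescribed value must not depend on the
  extending fields, which \<open>lie_bracket_horizontal\<close> ensures, and extending fields must
  exist, since otherwise every element of the fibre would qualify.\<close>

lemma curvature_coords:
  assumes conn: "connection_form AG AQ l A" and coords: "coords c D P" and x: "x \<in> D"
    and m: "m = chart_inv c x" and u: "u \<in> tangent_space AM m" and v: "v \<in> tangent_space AM m"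
  shows "curvature AG AQ AM l \<phi> A m u v = {(q, lalg (conn_curv A P x (u c) (v c))) | q. \<phi> q = m}"
proof -
  let ?\<kappa> = "conn_curv A P x (u c) (v c)"
  let ?s = "splitting AG AQ AM l \<phi> A"
  let ?b = "\<lambda>k. {(q, lalg k) | q. \<phi> q = m}"
  have fib: "\<exists>k. q = P (x, k)" if "\<phi> q = m" for q
    by (rule coords_surj[OF coords x]) (use that m in simp)
  have phi1: "phi1 AG AQ l (?b k) = {(q, fund_field AG AQ l (lalg k) q) | q. \<phi> q = m}" for k
    unfolding phi1_def by (auto simp: image_iff)
  have rhs: "TQ_orbit_diff (?s m (lie_bracket AM X Y m)) (section_bracket AQ \<phi> (\<lambda>x. ?s x (X x)) (\<lambda>x. ?s x (Y x)) m)
      = phi1 AG AQ l (?b ?\<kappa>)"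
    if X: "smooth_vector_field AM X" and Y: "smooth_vector_field AM Y" and Xm: "X m = u" and Ym: "Y m = v" for X Y
  proof -
    have Xt: "X p \<in> tangent_space AM p" and Yt: "Y p \<in> tangent_space AM p" for p
      using X Y by (simp_all add: smooth_vector_field_def)
    have "lie_bracket AM X Y m = pushv AM (chart_inv c) (chart_map c m)
      (FD (\<lambda>x. Y (chart_inv c x) c) (chart_map c m) (X m c) - FD (\<lambda>x. X (chart_inv c x) c) (chart_map c m) (Y m c))"
      by (rule lie_bracket_chart[OF AM X Y]) (use coords_chart_at[OF coords x] m in simp)
    then have bt: "lie_bracket AM X Y m \<in> tangent_space AM m"
      using coords_base_in[OF coords x] coords_map_inv[OF coords x] m by simp
    let ?HX = "\<lambda>q. horizontal_lift AG AQ AM l \<phi> A q (X (\<phi> q))" and ?HY = "\<lambda>q. horizontal_lift AG AQ AM l \<phi> A q (Y (\<phi> q))"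
    have "section_bracket AQ \<phi> (\<lambda>x. ?s x (X x)) (\<lambda>x. ?s x (Y x)) m = {(q, lie_bracket AQ ?HX ?HY q) | q. \<phi> q = m}"
      by (simp add: section_bracket_def section_of_field_def
          field_of_section_splitting[OF conn Xt, abs_def] field_of_section_splitting[OF conn Yt, abs_def])
    then have "TQ_orbit_diff (?s m (lie_bracket AM X Y m)) (section_bracket AQ \<phi> (\<lambda>x. ?s x (X x)) (\<lambda>x. ?s x (Y x)) m)
      = {(q, tdiff (horizontal_lift AG AQ AM l \<phi> A q (lie_bracket AM X Y m)) (lie_bracket AQ ?HX ?HY q)) | q. \<phi> q = m}"
      unfolding splitting_eq[OF conn bt] TQ_orbit_diff_def by auto
    also have "\<dots> = {(q, fund_field AG AQ l (lalg ?\<kappa>) q) | q. \<phi> q = m}"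
    proof -
      have td: "tdiff (horizontal_lift AG AQ AM l \<phi> A q (lie_bracket AM X Y m)) (lie_bracket AQ ?HX ?HY q) =
          fund_field AG AQ l (lalg ?\<kappa>) q" if q: "\<phi> q = m" for q
      proof -
        obtain k where k: "q = P (x, k)" using fib[OF q] by blast
        show ?thesis
          using lie_bracket_horizontal[OF conn coords x X Y, of k]
          by (simp add: k coords_fund_field[OF coords x] Xm Ym flip: m)
      qed
      show ?thesis
        unfolding setcompr_eq_image by (rule image_cong[OF refl]) (simp only: mem_Collect_eq td)
    qed
    finally show ?thesis unfolding phi1 .
  qed
  have mem: "?b k \<in> adjoint_fibre AG l \<phi> m" for k
  proof -
    obtain q0 where q0: "\<phi> q0 = m" using fibre_nonempty[of m] by (rule exE)
    have "{q. \<phi> q = m} = range (\<lambda>g. l g q0)" using fibre_eq_orbit[of q0] q0 by simp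
    then have "?b k = range (\<lambda>g. (l g q0, lalg k))"
      unfolding setcompr_eq_image by (simp only: image_image)
    then show ?thesis unfolding adjoint_fibre_def using q0 lalg_in by blast
  qed
  have form: "\<exists>k. b = ?b k" if b: "b \<in> adjoint_fibre AG l \<phi> m" for b
  proof -
    obtain q \<xi> where q: "b = range (\<lambda>g. (l g q, \<xi>))" "\<phi> q = m" "\<xi> \<in> lie_algebra AG"
      using b unfolding adjoint_fibre_def by blast
    have "{q. \<phi> q = m} = range (\<lambda>g. l g q)" using fibre_eq_orbit[of q] q(2) by simp
    then have "?b (\<xi> gc) = range (\<lambda>g. (l g q, lalg (\<xi> gc)))"
      unfolding setcompr_eq_image by (simp only: image_image)
    then have "b = ?b (\<xi> gc)" unfolding q(1) lie_algebra_eq_lalg[OF q(3), symmetric] by (rule sym)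
    then show ?thesis by (rule exI)
  qed
  obtain X where X: "smooth_vector_field AM X" "X m = u" using smooth_vector_field_extension[OF AM u] by blast
  obtain Y where Y: "smooth_vector_field AM Y" "Y m = v" using smooth_vector_field_extension[OF AM v] by blast
  have inj: "k = k'" if "phi1 AG AQ l (?b k) = phi1 AG AQ l (?b k')" for k k'
  proof -
    have "\<phi> (P (x, 0)) = m" using coords_phi[OF coords x] m by simp
    then have "(P (x, 0), fund_field AG AQ l (lalg k) (P (x, 0))) \<in> phi1 AG AQ l (?b k)" unfolding phi1 by blast
    then have "fund_field AG AQ l (lalg k) (P (x, 0)) = fund_field AG AQ l (lalg k') (P (x, 0))"
      unfolding that phi1 by blast
    then have "(0::'b, k) = (0, k')"
      unfolding coords_fund_field[OF coords x] by (rule coords_pushv_inj[OF coords x])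
    then show ?thesis by simp
  qed
  show ?thesis
    unfolding curvature_def Let_def
  proof (rule the_equality)
    show "?b ?\<kappa> \<in> adjoint_fibre AG l \<phi> m \<and>
        (\<forall>X Y. smooth_vector_field AM X \<and> smooth_vector_field AM Y \<and> X m = u \<and> Y m = v \<longrightarrow>
           phi1 AG AQ l (?b ?\<kappa>) =
             TQ_orbit_diff (?s m (lie_bracket AM X Y m))
               (section_bracket AQ \<phi> (\<lambda>x. ?s x (X x)) (\<lambda>x. ?s x (Y x)) m))"
      using mem rhs by simp
  next
    fix b
    assume b: "b \<in> adjoint_fibre AG l \<phi> m \<and>
        (\<forall>X Y. smooth_vector_field AM X \<and> smooth_vector_field AM Y \<and> X m = u \<and> Y m = v \<longrightarrow>
           phi1 AG AQ l b =
             TQ_orbit_diff (?s m (lie_bracket AM X Y m))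
               (section_bracket AQ \<phi> (\<lambda>x. ?s x (X x)) (\<lambda>x. ?s x (Y x)) m))"
    from form[OF conjunct1[OF b]] obtain k where k: "b = ?b k" by (rule exE)
    have "phi1 AG AQ l b = TQ_orbit_diff (?s m (lie_bracket AM X Y m))
        (section_bracket AQ \<phi> (\<lambda>x. ?s x (X x)) (\<lambda>x. ?s x (Y x)) m)"
      by (rule conjunct2[OF b, THEN spec, THEN spec, THEN mp]) (intro conjI X Y)
    also have "\<dots> = phi1 AG AQ l (?b ?\<kappa>)" by (rule rhs[OF X(1) Y(1) X(2) Y(2)])
    finally have "phi1 AG AQ l b = phi1 AG AQ l (?b ?\<kappa>)" .
    then have "k = ?\<kappa>" unfolding k by (rule inj)
    then show "b = ?b ?\<kappa>" using k by simp
  qed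
qed

end

section \<open>Derived connections and the integration theorem\<close>

lemma tangent_map_cong:
  assumes A: "smooth_atlas A" and N: "open N" "p \<in> N" and eq: "\<And>x. x \<in> N \<Longrightarrow> f x = g x"
  shows "tangent_map A B f p v = tangent_map A B g p v"
proof -
  define c where "c = (SOME c. c \<in> charts_at A p)"
  have "charts_at A p \<noteq> {}" using A by (simp add: smooth_atlas_def)
  then have "c \<in> charts_at A p" unfolding c_def by (rule some_in_eq[THEN iffD2])
  then have c: "c \<in> A" "p \<in> chart_dom c" by (simp_all add: charts_at_iff)
  let ?O = "chart_map c ` (N \<inter> chart_dom c)"
  have O: "open ?O" "chart_map c p \<in> ?O" using open_chart_image[OF A c(1) N(1)] N(2) c(2) by auto
  have D: "FD (chart_map d \<circ> f \<circ> chart_inv c) (chart_map c p) = FD (chart_map d \<circ> g \<circ> chart_inv c) (chart_map c p)" for d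
    by (rule FD_cong[OF O]) (simp add: eq[OF chart_imageD(1)[OF A c(1)]])
  show ?thesis
    unfolding tangent_map_def Let_def c_def[symmetric] D using eq[OF N(2)] by simp
qed

text \<open>A closed ball in a chart corresponds to a compact set, which is closed in a Hausdorff
  space. This provides the shrinking of neighbourhoods from which the gluing of potentials
  starts.\<close>

lemma chart_regular:
  fixes A :: "('m::t2_space, 'e::fin_dim_inner) chart set" and p :: 'm
  assumes A: "smooth_atlas A" and S: "open S" "p \<in> S"
  shows "\<exists>N. open N \<and> p \<in> N \<and> closure N \<subseteq> S"
proof -
  obtain c where c: "c \<in> A" "p \<in> chart_dom c" using smooth_atlas_obtain_chart[OF A] .
  let ?I = "chart_map c ` (S \<inter> chart_dom c)"
  have "open ?I" "chart_map c p \<in> ?I" using open_chart_image[OF A c(1) S(1)] S(2) c(2) by auto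
  then obtain r where r: "r > 0" "cball (chart_map c p) r \<subseteq> ?I" by (meson open_contains_cball)
  have rI: "cball (chart_map c p) r \<subseteq> chart_img c" using r(2) by blast
  let ?K = "chart_inv c ` cball (chart_map c p) r"
  have "compact ?K"
    by (intro compact_continuous_image continuous_on_subset[OF continuous_chart_inv[OF A c(1)] rI] compact_cball)
  then have K: "closed ?K" by (rule compact_imp_closed)
  let ?N = "chart_dom c \<inter> chart_map c -` ball (chart_map c p) r"
  have "?N \<subseteq> ?K"
  proof
    fix y assume y: "y \<in> ?N"
    then have "y = chart_inv c (chart_map c y)" using chart_inv_map[OF A c(1)] by simp
    moreover have "chart_map c y \<in> cball (chart_map c p) r" using y by simp
    ultimately show "y \<in> ?K" by (rule image_eqI)
  qed
  then have "closure ?N \<subseteq> ?K" using K by (rule closure_minimal)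
  also have "?K \<subseteq> S"
    by (rule image_subsetI) (rule chart_imageD(1)[OF A c(1) subsetD[OF r(2)]])
  finally have "closure ?N \<subseteq> S" .
  moreover have "open ?N" by (rule open_chart_vimage[OF A c(1) open_ball])
  ultimately show ?thesis using c(2) r(1) by (intro exI[of _ ?N]) simp
qed

lemma smooth_on_vec_diff:
  fixes f g :: "'m::topological_space \<Rightarrow> 'k::fin_dim_inner"
  assumes A: "smooth_atlas A" and S: "open S"
    and f: "smooth_on A model_atlas S f" and g: "smooth_on A model_atlas S g"
  shows "smooth_on A model_atlas S (\<lambda>p. f p - g p)"
proof -
  have m: "smooth_on model_atlas model_atlas UNIV (\<lambda>z::'k \<times> 'k. fst z - snd z)"
    unfolding smooth_on_model by (intro Cinf_on_diff Cinf_on_fst Cinf_on_snd open_UNIV)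
  have "smooth_on A model_atlas S (\<lambda>p. (f p, g p))"
    using smooth_on_Pair[OF A smooth_atlas_model smooth_atlas_model S f g] by simp
  from smooth_on_compose[OF A smooth_atlas_model smooth_atlas_model S open_UNIV this m UNIV_I]
  show ?thesis by simp
qed

context abelian_lie
begin

text \<open>The derivative of the group operation at the pair of identities restricts to the
  identity on both axes, hence is the addition of vectors.\<close>

lemma FD_gm_plus:
  fixes y0 :: "'a::fin_dim_inner"
  assumes S: "open S" "y0 \<in> S" and f: "smooth_on model_atlas AG S f" "f y0 = 0"
    and g: "smooth_on model_atlas AG S g" "g y0 = 0"
  shows "FD (\<lambda>y. gm (f y + g y)) y0 w = FD (\<lambda>y. gm (f y)) y0 w + FD (\<lambda>y. gm (g y)) y0 w"
proof -
  define M where "M z = gm (gi (fst z) + gi (snd z))" for z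
  have s: "smooth_on model_atlas AG (GI \<times> GI) (\<lambda>z. gi (fst z) + gi (snd z))"
    by (intro smooth_on_plus smooth_atlas_model smooth_on_gi_compose open_Times open_GI Cinf_on_fst Cinf_on_snd) auto
  have M: "(M has_derivative FD M (z0, z0)) (at (z0, z0))"
    unfolding M_def[abs_def]
    by (rule Cinf_on_has_derivative[OF Cinf_on_gm(2)[OF s open_Times[OF open_GI open_GI]]])
      (simp add: z0_in gi_z0 gc_0)
  have "FD (\<lambda>a. M (a, z0)) z0 = FD (\<lambda>a. a) z0" "FD (\<lambda>a. M (z0, a)) z0 = FD (\<lambda>a. a) z0"
    by (rule FD_cong[OF open_GI z0_in], simp add: M_def gi_z0 gm_gi)+
  then have "FD M (z0, z0) (\<alpha>, 0) = \<alpha>" "FD M (z0, z0) (0, \<alpha>) = \<alpha>" for \<alpha>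
    using FD_Pair_left[OF M, of \<alpha>] FD_Pair_right[OF M, of \<alpha>] by simp_all
  then have M1: "FD M (z0, z0) (\<alpha>, \<beta>) = \<alpha> + \<beta>" for \<alpha> \<beta>
    using linear_add[OF has_derivative_linear[OF M], of "(\<alpha>, 0)" "(0, \<beta>)"] by simp
  have fd: "((\<lambda>y. gm (f y)) has_derivative FD (\<lambda>y. gm (f y)) y0) (at y0)"
    by (rule pushv_has_derivative[OF AG S(1) f(1) S(2)]) (simp add: f(2) gc_at)
  have gd: "((\<lambda>y. gm (g y)) has_derivative FD (\<lambda>y. gm (g y)) y0) (at y0)"
    by (rule pushv_has_derivative[OF AG S(1) g(1) S(2)]) (simp add: g(2) gc_at)
  let ?N = "(S \<inter> f -` GD) \<inter> (S \<inter> g -` GD)"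
  have N: "open ?N"
    by (intro open_Int continuous_open_preimage smooth_on_continuous[OF f(1)] smooth_on_continuous[OF g(1)] S(1) open_GD)
  have yN: "y0 \<in> ?N" using S(2) f(2) g(2) gc_0 by simp
  have "FD (\<lambda>y. gm (f y + g y)) y0 = FD (\<lambda>y. M (gm (f y), gm (g y))) y0"
    by (rule FD_cong[OF N yN]) (simp add: M_def gi_gm)
  then have "FD (\<lambda>y. gm (f y + g y)) y0 w = FD (\<lambda>y. M (gm (f y), gm (g y))) y0 w" by (rule fun_cong)
  also have "\<dots> = FD M (z0, z0) (FD (\<lambda>y. gm (f y)) y0 w, FD (\<lambda>y. gm (g y)) y0 w)"
    by (rule FD_compose[OF has_derivative_Pair[OF fd gd]]) (simp add: f(2) g(2) M)
  also have "\<dots> = FD (\<lambda>y. gm (f y)) y0 w + FD (\<lambda>y. gm (g y)) y0 w" by (rule M1)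
  finally show ?thesis .
qed

end

section \<open>Connection forms derived from discrete connections\<close>

context abelian_bundle
begin

lemma D_type_slice:
  assumes "D_type l U"
  shows "open {q'. (q, q') \<in> U}" "q \<in> {q'. (q, q') \<in> U}"
proof -
  have "open (Pair q -` U)"
    using assms by (intro open_vimage continuous_intros) (simp add: D_type_def)
  then show "open {q'. (q, q') \<in> U}" by (simp add: vimage_def)
  show "q \<in> {q'. (q, q') \<in> U}" using assms by (simp add: D_type_def)
qed

lemma discrete_connectionD:
  assumes "discrete_connection AG AQ l U Ad"
  shows "D_type l U" "smooth_on (prod_atlas AQ AQ) AG U Ad" "Ad (q, q) = 0"
    "(q, q') \<in> U \<Longrightarrow> Ad (l g q, l g' q') = g' + Ad (q, q') - g"
  using assms by (auto simp: discrete_connection_def)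

lemma smooth_on_slice:
  assumes U: "open U" and f: "smooth_on (prod_atlas AQ AQ) AG U f" and o: "open {q'. (q, q') \<in> U}"
  shows "smooth_on AQ AG {q'. (q, q') \<in> U} (\<lambda>q'. f (q, q'))"
proof -
  have "smooth_on AQ (prod_atlas AQ AQ) {q'. (q, q') \<in> U} (\<lambda>q'. (q, q'))"
    by (rule smooth_on_Pair[OF AQ AQ AQ o smooth_on_const[OF AQ AQ o] smooth_on_ident[OF AQ o]])
  from smooth_on_compose[OF AQ smooth_atlas_prod[OF AQ AQ] AG o U this f] show ?thesis by simp
qed

context
  fixes U Ad
  assumes dc: "discrete_connection AG AQ l U Ad"
begin

lemma dc_slice: "open {q'. (q, q') \<in> U}" "q \<in> {q'. (q, q') \<in> U}"
    "smooth_on AQ AG {q'. (q, q') \<in> U} (\<lambda>q'. Ad (q, q'))"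
  using D_type_slice[OF discrete_connectionD(1)[OF dc]]
    smooth_on_slice[OF _ discrete_connectionD(2)[OF dc] D_type_slice(1)[OF discrete_connectionD(1)[OF dc]]]
    discrete_connectionD(1)[OF dc] by (simp_all add: D_type_def)

lemma derived_in:
  assumes "v \<in> tangent_space AQ q"
  shows "derived_connection AG AQ Ad q v \<in> lie_algebra AG"
  using tangent_map_in[OF AQ AG dc_slice(1,3,2) assms]
  by (simp add: derived_connection_def discrete_connectionD(3)[OF dc])

text \<open>Equivariance gives \<open>Ad (q, l (Exp k) q) = Exp k\<close>, so differentiating along
  the orbit differentiates \<open>Exp\<close> at 0.\<close>

lemma derived_fund: "derived_connection AG AQ Ad q (fund_field AG AQ l (lalg k) q) = lalg k"
proof -
  have s: "smooth_on model_atlas AQ UNIV (\<lambda>k. l (Exp k) q)"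
    using smooth_on_compose[OF smooth_atlas_model smooth_atlas_prod[OF AG AQ] AQ open_UNIV open_UNIV
        smooth_on_Pair[OF smooth_atlas_model AG AQ open_UNIV Exp_smooth smooth_on_const[OF smooth_atlas_model AQ open_UNIV, of q]] act_smooth]
    by simp
  have h: "((\<lambda>t. t *\<^sub>R k) has_vector_derivative k) (at 0)" by (auto intro!: derivative_eq_intros)
  have fund: "fund_field AG AQ l (lalg k) q = pushv AQ (\<lambda>k. l (Exp k) q) 0 k"
    using velocity_eq_pushv[OF AQ open_UNIV s UNIV_I h] by (simp add: fund_field_def lie_exp_tscale_lalg)
  have "tangent_map AQ AG (\<lambda>q'. Ad (q, q')) (l (Exp 0) q) (pushv AQ (\<lambda>k. l (Exp k) q) 0 k) =
      pushv AG (\<lambda>k. Ad (q, l (Exp k) q)) 0 k"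
    by (rule tangent_map_pushv[OF AQ AG open_UNIV s UNIV_I dc_slice(1) dc_slice(3)]) (use dc_slice(2) in \<open>simp add: act_0\<close>)
  moreover have "(q, q) \<in> U" using dc_slice(2) by simp
  then have "Ad (q, l (Exp k) q) = Exp k" for k
    using discrete_connectionD(4)[OF dc, of q q 0 "Exp k"] by (simp add: act_0 discrete_connectionD(3)[OF dc])
  ultimately show ?thesis unfolding fund derived_connection_def by (simp add: act_0 lalg_def)
qed

text \<open>Moving both arguments by the same \<open>g\<close> leaves \<open>Ad\<close> unchanged,
  since \<open>g\<close> and \<open>- g\<close> cancel in an abelian group.\<close>

lemma derived_inv:
  assumes v: "v \<in> tangent_space AQ q"
  shows "derived_connection AG AQ Ad (l g q) (tangent_map AQ AQ (l g) q v) = derived_connection AG AQ Ad q v"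
proof -
  have inv: "(l g q, l g q') \<in> U" if "(q, q') \<in> U" for q'
    using discrete_connectionD(1)[OF dc] that by (simp add: D_type_def)
  have "tangent_map AQ AG (\<lambda>q'. Ad (l g q, l g q')) q v =
      tangent_map AQ AG (\<lambda>q'. Ad (l g q, q')) (l g q) (tangent_map AQ AQ (l g) q v)"
    by (rule tangent_map_compose[OF AQ AQ AG dc_slice(1)[of q] dc_slice(1)[of "l g q"]
          smooth_on_subset[OF act_smooth_right subset_UNIV] dc_slice(3) _ dc_slice(2) v]) (simp add: inv)
  moreover have "tangent_map AQ AG (\<lambda>q'. Ad (l g q, l g q')) q v = tangent_map AQ AG (\<lambda>q'. Ad (q, q')) q v"
    by (rule tangent_map_cong[OF AQ dc_slice(1,2)]) (simp add: discrete_connectionD(4)[OF dc])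
  ultimately show ?thesis by (simp add: derived_connection_def)
qed

text \<open>The derived connection is a partial derivative in the second variable on the diagonal,
  and the diagonal lies in the open set where the local representative of \<open>Ad\<close> is
  smooth.\<close>

lemma derived_smooth:
  assumes c: "c \<in> AQ" and d: "d \<in> charts_at AG 0"
  shows "Cinf_on (chart_img c \<times> UNIV)
    (\<lambda>(x, v). derived_connection AG AQ Ad (chart_inv c x) (tvec_of AQ (chart_inv c x) c v) d)"
proof -
  let ?I = "chart_img c"
  note I = open_chart_img[OF AQ c]
  have U: "open U" using discrete_connectionD(1)[OF dc] by (simp add: D_type_def)
  have d': "d \<in> AG" "0 \<in> chart_dom d" using d by (simp_all add: charts_at_iff)
  have II: "open (?I \<times> ?I)" by (intro open_Times I)
  have Is: "open (?I \<times> (UNIV :: 'e set))" by (intro open_Times I open_UNIV)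
  have ci: "smooth_on model_atlas AQ (?I \<times> ?I) (\<lambda>z. chart_inv c (fst z))" "smooth_on model_atlas AQ (?I \<times> ?I) (\<lambda>z. chart_inv c (snd z))"
    by (rule smooth_on_compose[OF smooth_atlas_model smooth_atlas_model AQ II I _ smooth_on_chart_inv[OF AQ c]],
        simp add: smooth_on_model Cinf_on_fst[OF II] Cinf_on_snd[OF II], force)+
  have cc: "smooth_on model_atlas (prod_atlas AQ AQ) (?I \<times> ?I) (\<lambda>z. (chart_inv c (fst z), chart_inv c (snd z)))"
    by (rule smooth_on_Pair[OF smooth_atlas_model AQ AQ II ci])
  define S where "S = (?I \<times> ?I) \<inter> (\<lambda>z. (chart_inv c (fst z), chart_inv c (snd z))) -` U"
  have S: "open S" unfolding S_def by (rule continuous_open_preimage[OF smooth_on_continuous[OF cc] II U])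
  have SI: "S \<subseteq> ?I \<times> ?I" by (auto simp: S_def)
  have sA: "smooth_on model_atlas AG S (\<lambda>z. Ad (chart_inv c (fst z), chart_inv c (snd z)))"
    by (rule smooth_on_compose[OF smooth_atlas_model smooth_atlas_prod[OF AQ AQ] AG S U smooth_on_subset[OF cc SI]
          discrete_connectionD(2)[OF dc]]) (simp add: S_def)
  define F where "F z = chart_map d (Ad (chart_inv c (fst z), chart_inv c (snd z)))" for z
  define T where "T = S \<inter> (\<lambda>z. Ad (chart_inv c (fst z), chart_inv c (snd z))) -` chart_dom d"
  have T: "open T" unfolding T_def
    by (rule continuous_open_preimage[OF smooth_on_continuous[OF sA] S open_chart_dom[OF AG d'(1)]])
  have F: "Cinf_on T F" unfolding F_def[abs_def] by (rule pushv_Cinf[OF AG sA d'(1)]) (auto simp: T_def)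
  have diag: "(x, x) \<in> T" if "x \<in> ?I" for x
    using that d'(2) dc_slice(2) by (simp add: T_def S_def discrete_connectionD(3)[OF dc])
  have "Cinf_on (?I \<times> UNIV) (\<lambda>z. FD F (fst z, fst z) (0, snd z))"
    by (rule Cinf_on_FD_apply[OF T Is F])
      (use diag in \<open>auto intro!: Cinf_on_Pair Cinf_on_fst Cinf_on_snd Cinf_on_const Is\<close>)
  then show ?thesis
  proof (rule Cinf_on_congD[OF Is])
    fix z :: "'e \<times> 'e" assume "z \<in> ?I \<times> UNIV"
    then have x: "fst z \<in> ?I" by auto
    let ?q = "chart_inv c (fst z)"
    have cq: "c \<in> charts_at AQ ?q" "chart_map c ?q = fst z"
      using c chart_inv_in[OF AQ c x] chart_map_inv[OF AQ c x] by (simp_all add: charts_at_iff)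
    have da: "d \<in> charts_at AG (Ad (?q, ?q))" using d by (simp add: discrete_connectionD(3)[OF dc])
    have "derived_connection AG AQ Ad ?q (tvec_of AQ ?q c (snd z)) d = FD (\<lambda>y. chart_map d (Ad (?q, chart_inv c y))) (fst z) (snd z)"
      using tangent_map_app[OF AQ AG dc_slice(1,3,2) tvec_of_in[OF AQ cq(1)] cq(1) da] tvec_of_self[OF AQ cq(1)]
      by (simp add: derived_connection_def cq(2))
    also have "\<dots> = FD (\<lambda>y. F (fst z, y)) (fst z) (snd z)" by (simp add: F_def)
    also have "\<dots> = FD F (fst z, fst z) (0, snd z)"
      by (rule FD_Pair_right[OF Cinf_on_has_derivative[OF F diag[OF x]]])
    finally show "FD F (fst z, fst z) (0, snd z) =
        (case z of (x, v) \<Rightarrow> derived_connection AG AQ Ad (chart_inv c x) (tvec_of AQ (chart_inv c x) c v) d)"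
      by (simp add: split_beta)
  qed
qed

lemma derived_connection_form: "connection_form AG AQ l (derived_connection AG AQ Ad)"
  unfolding connection_form_def
proof (intro conjI allI ballI)
  fix q v w assume v: "v \<in> tangent_space AQ q" and w: "w \<in> tangent_space AQ q"
  show "derived_connection AG AQ Ad q (tadd v w) = tadd (derived_connection AG AQ Ad q v) (derived_connection AG AQ Ad q w)"
    unfolding derived_connection_def by (rule tangent_map_tadd[OF AQ AG dc_slice(1,3,2) v w])
next
  fix q v r assume v: "v \<in> tangent_space AQ q"
  show "derived_connection AG AQ Ad q (tscale r v) = tscale r (derived_connection AG AQ Ad q v)"
    unfolding derived_connection_def by (rule tangent_map_tscale[OF AQ AG dc_slice(1,3,2) v])
next
  fix q \<xi> assume "\<xi> \<in> lie_algebra AG"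
  then show "derived_connection AG AQ Ad q (fund_field AG AQ l \<xi> q) = \<xi>"
    using derived_fund[of q "\<xi> gc"] lie_algebra_eq_lalg[of \<xi>] by (simp only:)
qed (rule derived_in derived_smooth derived_inv; assumption)+

end

section \<open>Local potentials of the difference of two connections\<close>

text \<open>The differential of the pullback of \<open>h\<close> to the total space. Potentials on
  the base are compared there with connection forms, which keeps the descended 1-form
  implicit.\<close>

definition dphi :: "('m \<Rightarrow> 'k) \<Rightarrow> 'q \<Rightarrow> ('q, 'e) tvec \<Rightarrow> 'k" where
  "dphi h q v = tangent_map AQ model_atlas (\<lambda>q. h (\<phi> q)) q v (UNIV, \<lambda>x. x)"

lemma smooth_on_phi_compose:
  fixes h :: "'m \<Rightarrow> 'k"
  assumes "open B" "smooth_on AM model_atlas B h"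
  shows "open (\<phi> -` B)" "smooth_on AQ model_atlas (\<phi> -` B) (\<lambda>q. h (\<phi> q))"
proof -
  show o: "open (\<phi> -` B)" by (rule open_vimage[OF assms(1) smooth_on_continuous[OF phi_smooth]])
  show "smooth_on AQ model_atlas (\<phi> -` B) (\<lambda>q. h (\<phi> q))"
    by (rule smooth_on_compose[OF AQ AM smooth_atlas_model o assms(1) smooth_on_subset[OF phi_smooth subset_UNIV] assms(2)]) simp
qed

lemma base_coords_Cinf:
  fixes h :: "'m \<Rightarrow> 'k"
  assumes coords: "coords c D P" and B: "open B" and h: "smooth_on AM model_atlas B h"
  shows "open {x \<in> D. chart_inv c x \<in> B}" "Cinf_on {x \<in> D. chart_inv c x \<in> B} (\<lambda>x. h (chart_inv c x))"
proof -
  note D = coords_D[OF coords]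
  have ci: "smooth_on model_atlas AM D (chart_inv c)"
    by (rule smooth_on_subset[OF smooth_on_chart_inv[OF AM D(1)] D(3)])
  have "open (D \<inter> chart_inv c -` B)" by (rule continuous_open_preimage[OF smooth_on_continuous[OF ci] D(2) B])
  then show o: "open {x \<in> D. chart_inv c x \<in> B}" by (simp add: Int_def vimage_def)
  have "smooth_on model_atlas model_atlas {x \<in> D. chart_inv c x \<in> B} (\<lambda>x. h (chart_inv c x))"
    by (rule smooth_on_compose[OF smooth_atlas_model AM smooth_atlas_model o B smooth_on_subset[OF ci] h]) auto
  then show "Cinf_on {x \<in> D. chart_inv c x \<in> B} (\<lambda>x. h (chart_inv c x))" by (simp only: smooth_on_model)
qed

lemma coords_FD_base:
  assumes coords: "coords c D P" and x: "x \<in> D" and B: "open B" "chart_inv c x \<in> B"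
    and h: "smooth_on AM model_atlas B h"
  shows "((\<lambda>y. h (\<phi> (P y))) has_derivative (\<lambda>w. FD (\<lambda>x. h (chart_inv c x)) x (fst w))) (at (x, k))"
    and "dphi h (P (x, k)) (pushv AQ P (x, k) w) = FD (\<lambda>x. h (chart_inv c x)) x (fst w)"
proof -
  note D = coords_D[OF coords]
  have hd: "((\<lambda>x. h (chart_inv c x)) has_derivative FD (\<lambda>x. h (chart_inv c x)) x) (at (fst (x, k)))"
    using Cinf_on_has_derivative[OF base_coords_Cinf(2)[OF coords B(1) h], of x] x B(2) by simp
  have "((\<lambda>y. h (chart_inv c (fst y))) has_derivative (\<lambda>w. FD (\<lambda>x. h (chart_inv c x)) x (fst w))) (at (x, k))"
    by (rule has_derivative_compose[OF has_derivative_fst[OF has_derivative_ident] hd])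
  then show d: "((\<lambda>y. h (\<phi> (P y))) has_derivative (\<lambda>w. FD (\<lambda>x. h (chart_inv c x)) x (fst w))) (at (x, k))"
    by (rule has_derivative_transform_within_open[OF _ D(4)]) (use x coords_phi[OF coords] in \<open>auto simp: split_beta\<close>)
  have Pin: "P (x, k) \<in> \<phi> -` B" using coords_phi[OF coords x] B(2) by simp
  have xy: "(x, k) \<in> D \<times> UNIV" using x by simp
  show "dphi h (P (x, k)) (pushv AQ P (x, k) w) = FD (\<lambda>x. h (chart_inv c x)) x (fst w)"
    unfolding dphi_def tangent_map_pushv[OF AQ smooth_atlas_model D(4) coords_smooth[OF coords] xy
        smooth_on_phi_compose[OF B(1) h] Pin]
    by (simp add: pushv_model FD_eq[OF d])
qed

text \<open>Every base vector lifts to some \<open>(u, 0)\<close> in coordinates, so equal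
  differentials of the pullbacks give equal differentials on the base. The difference then has zero
  derivative on a ball, which is convex.\<close>

lemma potential_difference_locally_constant:
  assumes B: "open B" "open B'" and h: "smooth_on AM model_atlas B h" "smooth_on AM model_atlas B' h'"
    and eq: "\<And>q v. \<phi> q \<in> B \<inter> B' \<Longrightarrow> v \<in> tangent_space AQ q \<Longrightarrow> dphi h q v = dphi h' q v"
    and p: "p \<in> B" "p \<in> B'"
  shows "\<exists>N. open N \<and> p \<in> N \<and> N \<subseteq> B \<inter> B' \<and> (\<forall>y\<in>N. h y - h' y = h p - h' p)"
proof -
  obtain c D P x0 where c: "coords c D P" "x0 \<in> D" "p = chart_inv c x0" using obtain_coords .
  note D = coords_D[OF c(1)]
  let ?O = "{x \<in> D. chart_inv c x \<in> B} \<inter> {x \<in> D. chart_inv c x \<in> B'}"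
  have "open ?O" "x0 \<in> ?O"
    using base_coords_Cinf(1)[OF c(1) B(1) h(1)] base_coords_Cinf(1)[OF c(1) B(2) h(2)] c p by auto
  then obtain r where r: "r > 0" "ball x0 r \<subseteq> ?O" by (meson openE)
  have der: "((\<lambda>x. h (chart_inv c x) - h' (chart_inv c x)) has_derivative (\<lambda>_. 0)) (at x within ball x0 r)"
    if "x \<in> ball x0 r" for x
  proof -
    have x: "x \<in> D" "chart_inv c x \<in> B" "chart_inv c x \<in> B'" using that r(2) by auto
    have 1: "((\<lambda>x. h (chart_inv c x)) has_derivative FD (\<lambda>x. h (chart_inv c x)) x) (at x)"
      by (rule Cinf_on_has_derivative[OF base_coords_Cinf(2)[OF c(1) B(1) h(1)]]) (use x in simp)
    have 2: "((\<lambda>x. h' (chart_inv c x)) has_derivative FD (\<lambda>x. h' (chart_inv c x)) x) (at x)"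
      by (rule Cinf_on_has_derivative[OF base_coords_Cinf(2)[OF c(1) B(2) h(2)]]) (use x in simp)
    have "FD (\<lambda>x. h (chart_inv c x)) x u = FD (\<lambda>x. h' (chart_inv c x)) x u" for u
    proof -
      have "dphi h (P (x, 0)) (pushv AQ P (x, 0) (u, 0)) = dphi h' (P (x, 0)) (pushv AQ P (x, 0) (u, 0))"
        by (rule eq[OF _ coords_pushv_in[OF c(1) x(1)]]) (use x coords_phi[OF c(1) x(1)] in simp)
      then show ?thesis
        unfolding coords_FD_base(2)[OF c(1) x(1) B(1) x(2) h(1)] coords_FD_base(2)[OF c(1) x(1) B(2) x(3) h(2)] by simp
    qed
    then have "(\<lambda>u. FD (\<lambda>x. h (chart_inv c x)) x u - FD (\<lambda>x. h' (chart_inv c x)) x u) = (\<lambda>_. 0)" by simp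
    with has_derivative_diff[OF 1 2] show ?thesis by (simp add: has_derivative_at_withinI)
  qed
  let ?N = "chart_dom c \<inter> chart_map c -` ball x0 r"
  have xI: "x0 \<in> chart_img c" using c(2) D(3) by blast
  have N: "open ?N" by (rule open_chart_vimage[OF AM D(1) open_ball])
  have pN: "p \<in> ?N" using chart_inv_in[OF AM D(1) xI] chart_map_inv[OF AM D(1) xI] c(3) r(1) by simp
  have y: "y = chart_inv c (chart_map c y)" "chart_map c y \<in> ball x0 r" if "y \<in> ?N" for y
    using that chart_inv_map[OF AM D(1)] by simp_all
  have "y \<in> B \<inter> B'" if "y \<in> ?N" for y
    using subsetD[OF r(2) y(2)[OF that]] y(1)[OF that] by simp
  moreover have "h y - h' y = h p - h' p" if "y \<in> ?N" for y
    using has_derivative_zero_unique[OF convex_ball der y(2)[OF that], of x0] r(1) y(1)[OF that] c(3) by simp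
  ultimately show ?thesis using N pN by (intro exI[of _ ?N]) blast
qed

text \<open>By \<open>curvature_coords\<close> the curvature attaches one Lie algebra element to all
  points of a fibre; it is read off at \<open>P (x, 0)\<close>.\<close>

lemma conn_curv_unique:
  assumes A: "connection_form AG AQ l A" "connection_form AG AQ l A'" and coords: "coords c D P" and x: "x \<in> D"
    and eq: "\<And>m u v. u \<in> tangent_space AM m \<Longrightarrow> v \<in> tangent_space AM m \<Longrightarrow>
       curvature AG AQ AM l \<phi> A m u v = curvature AG AQ AM l \<phi> A' m u v"
  shows "conn_curv A P x u v = conn_curv A' P x u v"
proof -
  let ?u = "pushv AM (chart_inv c) x u" and ?v = "pushv AM (chart_inv c) x v"
  let ?m = "chart_inv c x"
  have in': "?u \<in> tangent_space AM ?m" "?v \<in> tangent_space AM ?m" using coords_base_in[OF coords x] by auto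
  have "{(q, lalg (conn_curv A P x u v)) | q. \<phi> q = ?m} = {(q, lalg (conn_curv A' P x u v)) | q. \<phi> q = ?m}"
    using curvature_coords[OF A(1) coords x refl in'] curvature_coords[OF A(2) coords x refl in'] eq[OF in']
    by (simp only: coords_base_app[OF coords x])
  moreover have "(P (x, 0), lalg (conn_curv A P x u v)) \<in> {(q, lalg (conn_curv A P x u v)) | q. \<phi> q = ?m}"
    using coords_phi[OF coords x] by simp
  ultimately have "(P (x, 0), lalg (conn_curv A P x u v)) \<in> {(q, lalg (conn_curv A' P x u v)) | q. \<phi> q = ?m}"
    by (simp only:)
  then have "lalg (conn_curv A P x u v) = lalg (conn_curv A' P x u v)" by simp
  then show ?thesis by (rule lalg_inj)
qed

text \<open>Both forms have the same dk part, so their difference is the difference of the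
  coefficient forms. Equal curvatures make it closed, and the Poincare lemma applies on the ball of
  coordinates.\<close>

lemma local_potential:
  assumes A: "connection_form AG AQ l A" "connection_form AG AQ l A'"
    and eq: "\<And>m u v. u \<in> tangent_space AM m \<Longrightarrow> v \<in> tangent_space AM m \<Longrightarrow>
       curvature AG AQ AM l \<phi> A m u v = curvature AG AQ AM l \<phi> A' m u v"
  shows "\<exists>B h. open B \<and> m \<in> B \<and> smooth_on AM model_atlas B h \<and>
    (\<forall>q v. \<phi> q \<in> B \<longrightarrow> v \<in> tangent_space AQ q \<longrightarrow> dphi h q v = A q v gc - A' q v gc)"
proof -
  obtain c D P r where c: "coords c D P" "m \<in> chart_dom c" "D = ball (chart_map c m) r" "r > 0"
    using coords_exist by blast
  note D = coords_D[OF c(1)]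
  let ?a = "conn_coeff A P" and ?a' = "conn_coeff A' P"
  define \<beta> where "\<beta> x u = ?a x u - ?a' x u" for x u
  note aC = conn_coeff_Cinf[OF A(1) c(1)] conn_coeff_Cinf[OF A(2) c(1)]
  have \<beta>C: "Cinf_on D (\<lambda>x. \<beta> x u)" for u
    unfolding \<beta>_def by (intro Cinf_on_diff D aC)
  have \<beta>l: "linear (\<beta> x)" if "x \<in> D" for x
    unfolding \<beta>_def[abs_def]
    by (rule linear_compose_sub[OF conn_coeff_linear[OF A(1) c(1) that] conn_coeff_linear[OF A(2) c(1) that]])
  have \<beta>c: "FD (\<lambda>x. \<beta> x v) x w = FD (\<lambda>x. \<beta> x w) x v" if x: "x \<in> D" for x v w
  proof -
    have fb: "FD (\<lambda>x. \<beta> x v) x w = FD (\<lambda>x. ?a x v) x w - FD (\<lambda>x. ?a' x v) x w" for v w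
      unfolding \<beta>_def
      using FD_eq[OF has_derivative_diff[OF Cinf_on_has_derivative[OF aC(1) x] Cinf_on_has_derivative[OF aC(2) x]]] by simp
    show ?thesis
      using conn_curv_unique[OF A c(1) x eq, of w v] unfolding fb by (simp add: conn_curv_def algebra_simps)
  qed
  have "\<exists>f. Cinf_on D f \<and> f (chart_map c m) = 0 \<and> (\<forall>x\<in>D. (f has_derivative \<beta> x) (at x))"
    unfolding c(3) by (rule Poincare_ball) (use \<beta>C \<beta>l \<beta>c c(3) in simp_all)
  then obtain f where f: "Cinf_on D f" "\<And>x. x \<in> D \<Longrightarrow> (f has_derivative \<beta> x) (at x)" by blast
  define B where "B = chart_dom c \<inter> chart_map c -` D"
  have B: "open B" unfolding B_def by (rule open_chart_vimage[OF AM D(1,2)])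
  have mB: "m \<in> B" using c by (simp add: B_def)
  define h where "h p = f (chart_map c p)" for p
  have fs: "smooth_on model_atlas model_atlas D f" using f(1) by (simp only: smooth_on_model)
  have cs: "smooth_on AM model_atlas B (chart_map c)"
    by (rule smooth_on_subset[OF smooth_on_chart_map[OF AM D(1)]]) (simp add: B_def)
  have h: "smooth_on AM model_atlas B h"
    unfolding h_def[abs_def]
    by (rule smooth_on_compose[OF AM smooth_atlas_model smooth_atlas_model B D(2) cs fs]) (simp add: B_def)
  have "dphi h q v = A q v gc - A' q v gc" if q: "\<phi> q \<in> B" and v: "v \<in> tangent_space AQ q" for q v
  proof -
    define x where "x = chart_map c (\<phi> q)"
    have x: "x \<in> D" "\<phi> q = chart_inv c x" using q chart_inv_map[OF AM D(1)] by (simp_all add: B_def x_def)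
    obtain k where k: "q = P (x, k)" using coords_surj[OF c(1) x] by blast
    obtain w where w: "v = pushv AQ P (x, k) w" using coords_tangent_obtain[OF c(1) x(1)] v k by blast
    have "dphi h q v = FD (\<lambda>x. h (chart_inv c x)) x (fst w)"
      unfolding k w by (rule coords_FD_base(2)[OF c(1) x(1) B _ h]) (use q x in simp)
    also have "FD (\<lambda>x. h (chart_inv c x)) x = FD f x"
      by (rule FD_cong[OF D(2) x(1)]) (simp add: h_def coords_map_inv[OF c(1)])
    also have "FD f x = \<beta> x" by (rule FD_eq[OF f(2)[OF x(1)]])
    also have "\<beta> x (fst w) = A q v gc - A' q v gc"
      using conn_coords[OF A(1) c(1) x(1), of k "fst w" "snd w"] conn_coords[OF A(2) c(1) x(1), of k "fst w" "snd w"]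
      by (simp add: \<beta>_def k w)
    finally show ?thesis .
  qed
  then show ?thesis using B mB h by blast
qed

lemma derived_gc:
  assumes o: "open S" and f: "smooth_on AQ AG S f" and q: "P (x, k) \<in> S" "f (P (x, k)) = 0"
    and coords: "coords c D P" and x: "x \<in> D"
  shows "tangent_map AQ AG f (P (x, k)) (pushv AQ P (x, k) w) gc = FD (\<lambda>y. gm (f (P y))) (x, k) w"
proof -
  have xy: "(x, k) \<in> D \<times> UNIV" using x by simp
  show ?thesis
    unfolding tangent_map_pushv[OF AQ AG coords_D(4)[OF coords] coords_smooth[OF coords] xy o f q(1)]
    using q(2) gc_at by (simp add: pushv_def)
qed

section \<open>Integration of a connection with prescribed discrete curvature\<close>

lemma integrate_connection:
  assumes dc: "discrete_connection AG AQ l U Ad'" and curv: "has_discrete_curvature U Ad' Bd"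
    and A: "connection_form AG AQ l A"
    and eq: "\<And>m u v. u \<in> tangent_space AM m \<Longrightarrow> v \<in> tangent_space AM m \<Longrightarrow>
       curvature AG AQ AM l \<phi> A m u v = curvature AG AQ AM l \<phi> (derived_connection AG AQ Ad') m u v"
  shows "\<exists>U0 Ad. D_type l U0 \<and> U0 \<subseteq> U \<and> discrete_connection AG AQ l U0 Ad \<and>
           (\<forall>q. \<forall>v\<in>tangent_space AQ q. derived_connection AG AQ Ad q v = A q v) \<and>
           has_discrete_curvature U0 Ad Bd"
proof -
  let ?A' = "derived_connection AG AQ Ad'"
  note A' = derived_connection_form[OF dc]
  define pot where "pot m B h \<longleftrightarrow> open B \<and> m \<in> B \<and> smooth_on AM model_atlas B h \<and>
    (\<forall>q v. \<phi> q \<in> B \<longrightarrow> v \<in> tangent_space AQ q \<longrightarrow> dphi h q v = A q v gc - ?A' q v gc)" for m B h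
  have ex: "\<exists>B h. pot m B h" for m
    unfolding pot_def by (rule local_potential[OF A A' eq])
  define B where "B m = (SOME B. \<exists>h. pot m B h)" for m
  define h where "h m = (SOME h. pot m (B m) h)" for m
  have Bh: "pot m (B m) (h m)" for m
  proof -
    have "\<exists>h. pot m (B m) h" unfolding B_def by (rule someI_ex[OF ex])
    then show ?thesis unfolding h_def by (rule someI_ex)
  qed
  have B: "open (B m)" "m \<in> B m" and h: "smooth_on AM model_atlas (B m) (h m)" for m
    using Bh[of m] by (simp_all add: pot_def)
  have dh: "dphi (h m) q v = A q v gc - ?A' q v gc" if "\<phi> q \<in> B m" "v \<in> tangent_space AQ q" for m q v
    using Bh[of m] that by (simp add: pot_def)
  have const: "\<exists>N. open N \<and> x \<in> N \<and> N \<subseteq> B i \<inter> B j \<and> (\<forall>y\<in>N. h i y - h j y = h i x - h j x)"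
    if "x \<in> B i" "x \<in> B j" for i j x
    by (rule potential_difference_locally_constant[OF B(1) B(1) h h _ that]) (simp add: dh)
  have "\<exists>W F. open W \<and> (\<forall>x. (x, x) \<in> W) \<and>
    (\<forall>x y. (x, y) \<in> W \<longrightarrow> (\<exists>i N N'. open N \<and> open N' \<and> x \<in> N \<and> y \<in> N' \<and> N \<subseteq> B i \<and> N' \<subseteq> B i \<and>
       (\<forall>x'\<in>N. \<forall>y'\<in>N'. (x', y') \<in> W \<and> F x' y' = h i y' - h i x'))) \<and>
    (\<forall>x y z. (x, y) \<in> W \<longrightarrow> (y, z) \<in> W \<longrightarrow> (x, z) \<in> W \<longrightarrow> F x y + F y z = F x z)"
  proof (rule glue_local_potentials)
    show "\<exists>N. open N \<and> p \<in> N \<and> closure N \<subseteq> S" if "open S" "p \<in> S" for p :: 'm and S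
      by (rule chart_regular[OF AM that])
  qed (rule B const; assumption?)+
  then obtain W F where W: "open W" "\<forall>x. (x, x) \<in> W"
    and loc: "\<forall>x y. (x, y) \<in> W \<longrightarrow> (\<exists>i N N'. open N \<and> open N' \<and> x \<in> N \<and> y \<in> N' \<and> N \<subseteq> B i \<and> N' \<subseteq> B i \<and>
       (\<forall>x'\<in>N. \<forall>y'\<in>N'. (x', y') \<in> W \<and> F x' y' = h i y' - h i x'))"
    and coc: "\<forall>x y z. (x, y) \<in> W \<longrightarrow> (y, z) \<in> W \<longrightarrow> (x, z) \<in> W \<longrightarrow> F x y + F y z = F x z"
    by (elim exE conjE)
  have F0: "F x x = 0" for x using coc[rule_format, of x x x] W(2) by simp
  define \<Phi> where "\<Phi> z = (\<phi> (fst z), \<phi> (snd z))" for z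
  have cont: "continuous_on UNIV \<Phi>"
    unfolding \<Phi>_def[abs_def]
    by (intro continuous_on_Pair continuous_on_compose2[OF smooth_on_continuous[OF phi_smooth]]
        continuous_on_fst continuous_on_snd continuous_on_id subset_UNIV)
  \<comment> \<open>\<open>W\<close> lives on the base, so its preimage is invariant under the
    action in each variable and \<open>U0\<close> remains of D-type.\<close>
  define U0 where "U0 = U \<inter> \<Phi> -` W"
  define Ad where "Ad z = Ad' z + Exp (F (\<phi> (fst z)) (\<phi> (snd z)))" for z
  note U = discrete_connectionD(1)[OF dc]
  have U0: "open U0" unfolding U0_def
    using U by (intro open_Int open_vimage[OF W(1) cont]) (simp add: D_type_def)
  have D0: "D_type l U0"
    using U U0 W(2) by (simp add: D_type_def U0_def \<Phi>_def)
  \<comment> \<open>Smoothness is local, and near each point \<open>F\<close> is a difference of two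
    pullbacks of a single potential \<open>h i\<close>.\<close>
  have Fs: "smooth_on (prod_atlas AQ AQ) model_atlas U0 (\<lambda>z. F (\<phi> (fst z)) (\<phi> (snd z)))"
  proof (rule smooth_on_local[OF smooth_atlas_prod[OF AQ AQ] smooth_atlas_model U0])
    fix z assume "z \<in> U0"
    then have "(\<phi> (fst z), \<phi> (snd z)) \<in> W" by (simp add: U0_def \<Phi>_def)
    from loc[rule_format, OF this] obtain i N N' where N: "open N" "open N'" "\<phi> (fst z) \<in> N" "\<phi> (snd z) \<in> N'"
      "N \<subseteq> B i" "N' \<subseteq> B i" "\<forall>x'\<in>N. \<forall>y'\<in>N'. (x', y') \<in> W \<and> F x' y' = h i y' - h i x'"
      by (elim exE conjE)
    let ?T = "\<Phi> -` (N \<times> N')"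
    have T: "open ?T" by (rule open_vimage[OF open_Times[OF N(1,2)] cont])
    note pB = smooth_on_phi_compose[OF B(1) h]
    have s1: "smooth_on (prod_atlas AQ AQ) model_atlas ?T (\<lambda>z. h i (\<phi> (fst z)))"
      by (rule smooth_on_compose[OF smooth_atlas_prod[OF AQ AQ] AQ smooth_atlas_model T pB(1)
            smooth_on_subset[OF smooth_on_fst[OF AQ AQ] subset_UNIV] pB(2)]) (use N(5) in \<open>auto simp: \<Phi>_def\<close>)
    have s2: "smooth_on (prod_atlas AQ AQ) model_atlas ?T (\<lambda>z. h i (\<phi> (snd z)))"
      by (rule smooth_on_compose[OF smooth_atlas_prod[OF AQ AQ] AQ smooth_atlas_model T pB(1)
            smooth_on_subset[OF smooth_on_snd[OF AQ AQ] subset_UNIV] pB(2)]) (use N(6) in \<open>auto simp: \<Phi>_def\<close>)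
    have "smooth_on (prod_atlas AQ AQ) model_atlas ?T (\<lambda>z. F (\<phi> (fst z)) (\<phi> (snd z)))"
      by (rule smooth_on_cong[OF smooth_atlas_prod[OF AQ AQ] smooth_atlas_model T
            smooth_on_vec_diff[OF smooth_atlas_prod[OF AQ AQ] T s2 s1]]) (use N(7) in \<open>simp add: \<Phi>_def\<close>)
    moreover have "z \<in> ?T" using N(3,4) by (simp add: \<Phi>_def)
    ultimately show "\<exists>N. open N \<and> z \<in> N \<and> smooth_on (prod_atlas AQ AQ) model_atlas N (\<lambda>z. F (\<phi> (fst z)) (\<phi> (snd z)))"
      using T by blast
  qed
  have Ads: "smooth_on (prod_atlas AQ AQ) AG U0 Ad"
    unfolding Ad_def[abs_def]
    by (intro smooth_on_plus smooth_on_Exp_compose smooth_atlas_prod AQ U0 Fs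
        smooth_on_subset[OF discrete_connectionD(2)[OF dc]]) (simp add: U0_def)
  have Ad0: "Ad (q, q) = 0" for q by (simp add: Ad_def F0 discrete_connectionD(3)[OF dc])
  \<comment> \<open>The correction sees base points only and is therefore unaffected by the action
    in either variable.\<close>
  have dc0: "discrete_connection AG AQ l U0 Ad"
    unfolding discrete_connection_def
  proof (intro conjI allI impI D0 Ads Ad0)
    fix q q' g g' assume "(q, q') \<in> U0"
    then have "(q, q') \<in> U" by (simp add: U0_def)
    then show "Ad (l g q, l g' q') = g' + Ad (q, q') - g"
      using discrete_connectionD(4)[OF dc, of q q' g g'] by (simp add: Ad_def algebra_simps)
  qed
  have der: "derived_connection AG AQ Ad q v = A q v" if v: "v \<in> tangent_space AQ q" for q v
  proof (rule tangent_eqI[OF derived_in[OF dc0 v] conn_in[OF A v] gc_at])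
    obtain c D P x where c: "coords c D P" "x \<in> D" "\<phi> q = chart_inv c x" using obtain_coords .
    obtain k where k: "q = P (x, k)" using coords_surj[OF c] by blast
    obtain w where w: "v = pushv AQ P (x, k) w" using coords_tangent_obtain[OF c(1,2)] v k by blast
    note D = coords_D[OF c(1)] and Ps = coords_smooth[OF c(1)]
    have xy: "(x, k) \<in> D \<times> UNIV" using c(2) by simp
    have "(\<phi> q, \<phi> q) \<in> W" using W(2) by (rule spec)
    from loc[rule_format, OF this] obtain i N N' where N: "open N" "open N'" "\<phi> q \<in> N" "\<phi> q \<in> N'"
      "N \<subseteq> B i" "N' \<subseteq> B i" "\<forall>x'\<in>N. \<forall>y'\<in>N'. (x', y') \<in> W \<and> F x' y' = h i y' - h i x'"
      by (elim exE conjE)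
    have qB: "\<phi> q \<in> B i" using N(3,5) by blast
    \<comment> \<open>The parameters of points \<open>q'\<close> near \<open>q\<close> for which
      \<open>F (\<phi> q) (\<phi> q')\<close> is \<open>h i (\<phi> q') - h i (\<phi> q)\<close>. As
      \<open>Exp\<close> has the identity as derivative at 0, the correction contributes exactly the
      differential of \<open>h i\<close>.\<close>
    define S where "S = (D \<times> UNIV) \<inter> P -` ({q'. (q, q') \<in> U} \<inter> \<phi> -` N')"
    have S: "open S" unfolding S_def
      by (rule continuous_open_preimage[OF smooth_on_continuous[OF Ps] D(4)
            open_Int[OF dc_slice(1)[OF dc] open_vimage[OF N(2) smooth_on_continuous[OF phi_smooth]]]])
    have yS: "(x, k) \<in> S" using xy dc_slice(2)[OF dc, of q] N(4) by (simp add: S_def flip: k)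
    have SD: "S \<subseteq> D \<times> UNIV" by (auto simp: S_def)
    have f1: "smooth_on model_atlas AG S (\<lambda>y. Ad' (q, P y))"
      by (rule smooth_on_compose[OF smooth_atlas_model AQ AG S dc_slice(1)[OF dc] smooth_on_subset[OF Ps SD] dc_slice(3)[OF dc]])
        (simp add: S_def)
    have hs: "smooth_on model_atlas model_atlas S (\<lambda>y. h i (\<phi> (P y)))"
      by (rule smooth_on_compose[OF smooth_atlas_model AQ smooth_atlas_model S smooth_on_phi_compose(1)[OF B(1) h]
            smooth_on_subset[OF Ps SD] smooth_on_phi_compose(2)[OF B(1) h]]) (use N(6) in \<open>auto simp: S_def\<close>)
    have f2: "smooth_on model_atlas AG S (\<lambda>y. Exp (h i (\<phi> (P y)) - h i (\<phi> q)))"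
      by (rule smooth_on_Exp_compose[OF smooth_atlas_model S smooth_on_vec_diff[OF smooth_atlas_model S hs
              smooth_on_const[OF smooth_atlas_model smooth_atlas_model S]]])
    have e1: "derived_connection AG AQ Ad q v gc = FD (\<lambda>y. gm (Ad (q, P y))) (x, k) w"
      unfolding derived_connection_def k w
      by (rule derived_gc[OF dc_slice(1)[OF dc0] dc_slice(3)[OF dc0] dc_slice(2)[OF dc0] Ad0 c(1,2)])
    have e2: "FD (\<lambda>y. gm (Ad (q, P y))) (x, k) = FD (\<lambda>y. gm (Ad' (q, P y) + Exp (h i (\<phi> (P y)) - h i (\<phi> q)))) (x, k)"
      by (rule FD_cong[OF S yS]) (use N(3,7) in \<open>simp add: Ad_def S_def\<close>)
    have e3: "FD (\<lambda>y. gm (Ad' (q, P y) + Exp (h i (\<phi> (P y)) - h i (\<phi> q)))) (x, k) w =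
        FD (\<lambda>y. gm (Ad' (q, P y))) (x, k) w + FD (\<lambda>y. gm (Exp (h i (\<phi> (P y)) - h i (\<phi> q)))) (x, k) w"
      by (rule FD_gm_plus[OF S yS f1 _ f2]) (simp_all add: discrete_connectionD(3)[OF dc] flip: k)
    have e4: "FD (\<lambda>y. gm (Ad' (q, P y))) (x, k) w = ?A' q v gc"
      unfolding derived_connection_def k w
      by (rule derived_gc[OF dc_slice(1)[OF dc] dc_slice(3)[OF dc] dc_slice(2)[OF dc] discrete_connectionD(3)[OF dc] c(1,2), symmetric])
    have e5: "FD (\<lambda>y. gm (Exp (h i (\<phi> (P y)) - h i (\<phi> q)))) (x, k) w = A q v gc - ?A' q v gc"
    proof -
      have cB: "chart_inv c x \<in> B i" using qB c(3) by simp
      have "((\<lambda>y. h i (\<phi> (P y)) - h i (\<phi> q)) has_derivative (\<lambda>w. FD (\<lambda>x. h i (chart_inv c x)) x (fst w) - 0)) (at (x, k))"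
        by (rule has_derivative_diff[OF coords_FD_base(1)[OF c(1,2) B(1) cB h] has_derivative_const])
      then have "FD (\<lambda>y. gm (Exp (h i (\<phi> (P y)) - h i (\<phi> q)))) (x, k) w = FD (\<lambda>x. h i (chart_inv c x)) x (fst w) - 0"
        by (rule FD_compose[where g = "\<lambda>v. gm (Exp v)" and g' = "\<lambda>v. v"]) (simp add: Exp_has_derivative flip: k)
      also have "\<dots> = dphi (h i) q v"
        unfolding k w using coords_FD_base(2)[OF c(1,2) B(1) cB h] by simp
      finally show ?thesis using dh[OF qB v] by simp
    qed
    show "derived_connection AG AQ Ad q v gc = A q v gc" unfolding e1 e2 e3 e4 e5 by simp
  qed
  have "has_discrete_curvature U0 Ad Bd"
    unfolding has_discrete_curvature_def
  proof
    fix t assume t: "t \<in> triples U0"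
    obtain q0 q1 q2 where q: "t = (q0, q1, q2)" by (cases t)
    have tU: "(q0, q1) \<in> U0" "(q0, q2) \<in> U0" "(q1, q2) \<in> U0" using t by (simp_all add: q triples_def)
    have "t \<in> triples U" using tU by (simp add: q triples_def U0_def)
    then have "discrete_curvature Ad' t = Bd t" using curv by (simp add: has_discrete_curvature_def)
    \<comment> \<open>The alternating sum of the correction over a triple is its cocycle defect,
      which vanishes.\<close>
    moreover have "F (\<phi> q0) (\<phi> q2) = F (\<phi> q0) (\<phi> q1) + F (\<phi> q1) (\<phi> q2)"
      using coc[rule_format, of "\<phi> q0" "\<phi> q1" "\<phi> q2"] tU by (simp add: U0_def \<Phi>_def)
    then have "Exp (F (\<phi> q0) (\<phi> q2)) = Exp (F (\<phi> q0) (\<phi> q1)) + Exp (F (\<phi> q1) (\<phi> q2))" by (simp only: Exp_add)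
    then have "discrete_curvature Ad t = discrete_curvature Ad' t"
      by (simp add: q discrete_curvature_def Ad_def algebra_simps)
    ultimately show "discrete_curvature Ad t = Bd t" by simp
  qed
  then show ?thesis using D0 dc0 der by (intro exI[of _ U0] exI[of _ Ad]) (simp add: U0_def)
qed

end

theorem theorem5p6:
  fixes AG :: "('g::{t2_space,second_countable_topology,ab_group_add}, 'k::fin_dim_inner) chart set"
    and AQ :: "('q::{t2_space,second_countable_topology}, 'e::fin_dim_inner) chart set"
    and AM :: "('m::{t2_space,second_countable_topology}, 'b::fin_dim_inner) chart set"
    and l :: "'g \<Rightarrow> 'q \<Rightarrow> 'q" and \<phi> :: "'q \<Rightarrow> 'm"
    and U :: "('q \<times> 'q) set" and Bd :: "'q \<times> 'q \<times> 'q \<Rightarrow> 'g"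
    and \<A> :: "'q \<Rightarrow> ('q, 'e) tvec \<Rightarrow> ('g, 'k) tvec"
  assumes "principal_bundle AG AQ AM l \<phi>"
    and "connected (UNIV :: 'g set)"
    and "D_type l U"
    and "\<exists>Ad'. discrete_connection AG AQ l U Ad' \<and> has_discrete_curvature U Ad' Bd"
    and "connection_form AG AQ l \<A>"
    and "\<And>m u v. u \<in> tangent_space AM m \<Longrightarrow> v \<in> tangent_space AM m \<Longrightarrow>
           curvature AG AQ AM l \<phi> \<A> m u v = curvature_of_discrete AG AQ AM l \<phi> U Bd m u v"
  shows "\<exists>U0 Ad. D_type l U0 \<and> U0 \<subseteq> U \<and> discrete_connection AG AQ l U0 Ad \<and>
           (\<forall>q. \<forall>v\<in>tangent_space AQ q. derived_connection AG AQ Ad q v = \<A> q v) \<and>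
           has_discrete_curvature U0 Ad Bd"
proof -
  interpret abelian_bundle AG AQ AM l \<phi>
    by unfold_locales (use assms(1,2) in \<open>simp_all add: principal_bundle_def\<close>)
  \<comment> \<open>The hypothesis on the curvature refers to the discrete connection selected by
    \<open>SOME\<close> in \<open>curvature_of_discrete\<close>, so the construction starts from
    exactly that one.\<close>
  define Ad0 where "Ad0 = (SOME Ad. discrete_connection AG AQ l U Ad \<and> has_discrete_curvature U Ad Bd)"
  have "discrete_connection AG AQ l U Ad0 \<and> has_discrete_curvature U Ad0 Bd"
    unfolding Ad0_def by (rule someI_ex[OF assms(4)])
  moreover have "curvature AG AQ AM l \<phi> \<A> m u v = curvature AG AQ AM l \<phi> (derived_connection AG AQ Ad0) m u v"
    if "u \<in> tangent_space AM m" "v \<in> tangent_space AM m" for m u v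
    using assms(6)[OF that] by (simp only: curvature_of_discrete_def Ad0_def)
  ultimately show ?thesis by (intro integrate_connection[OF _ _ assms(5)]) simp_all
qed

end
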